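(* Let $q\in\mathbb{C}\setminus\{0\}$ be not a root of unity. Let $\mathcal{S}$ be the set of all $U_q(\mathfrak{sl}_2)$-module algebra structures on the quantum plane $\mathbb{C}_q[x,y]$ such that $$(\mathsf{e}(x))_0=0,\quad(\mathsf{e}(y))_0\ne 0,\quad(\mathsf{f}(x))_0=0,\quad(\mathsf{f}(y))_0=0,$$ $$(\mathsf{e}(x))_1=(\mathsf{e}(y))_1=(\mathsf{f}(x))_1=(\mathsf{f}(y))_1=0 .$$ Then $\mathcal{S}$ consists of exactly the one-parameter family, indexed by $b_0\in\mathbb{C}\setminus\{0\}$, of structures given by $$\mathsf{k}(x)=qx,\quad \mathsf{k}(y)=q^{-2}y,\quad \mathsf{e}(x)=0,\quad \mathsf{e}(y)=b_0,\quad \mathsf{f}(x)=b_0^{-1}xy,\quad \mathsf{f}(y)=-qb_0^{-1}y^2 .$$ (Each $b_0\ne 0$ gives a well-defined structure.) All these structures are isomorphic, in particular to the one with $b_0=1$.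
   Context: The quantum plane $\mathbb{C}_q[x,y]$ is the unital associative $\mathbb{C}$-algebra with generators $x,y$ and the single relation $yx=qxy$; the monomials $x^my^n$ ($m,n\ge 0$) form a basis. Its $i$-th homogeneous component is the linear span of the $x^my^n$ with $m+n=i$; for a polynomial $p$, $(p)_i$ denotes the projection of $p$ to the $i$-th homogeneous component (parallel to the other components). $U_q(\mathfrak{sl}_2)$ is the unital associative $\mathbb{C}$-algebra with generators $\mathsf{k},\mathsf{k}^{-1},\mathsf{e},\mathsf{f}$ and relations $\mathsf{k}^{-1}\mathsf{k}=\mathsf{k}\mathsf{k}^{-1}=\mathbf{1}$, $\mathsf{k}\mathsf{e}=q^2\mathsf{e}\mathsf{k}$, $\mathsf{k}\mathsf{f}=q^{-2}\mathsf{f}\mathsf{k}$, $\mathsf{e}\mathsf{f}-\mathsf{f}\mathsf{e}=\frac{\mathsf{k}-\mathsf{k}^{-1}}{q-q^{-1}}$, with Hopf algebra structure $\Delta(\mathsf{k})=\mathsf{k}\otimes\mathsf{k}$, $\Delta(\mathsf{e})=\mathbf{1}\otimes\mathsf{e}+\mathsf{e}\otimes\mathsf{k}$, $\Delta(\mathsf{f})=\mathsf{f}\otimes\mathbf{1}+\mathsf{k}^{-1}\otimes\mathsf{f}$, $\varepsilon(\mathsf{k})=1$, $\varepsilon(\mathsf{e})=\varepsilon(\mathsf{f})=0$, $S(\mathsf{k})=\mathsf{k}^{-1}$, $S(\mathsf{e})=-\mathsf{e}\mathsf{k}^{-1}$, $S(\mathsf{f})=-\mathsf{k}\mathsf{f}$.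 For a Hopf algebra $H$ and a unital algebra $A$, a structure of $H$-module algebra on $A$ is an algebra homomorphism $\pi:H\to\operatorname{End}_{\mathbb{C}}A$ such that $\pi(h)(ab)=\sum_i\pi(h_i')(a)\,\pi(h_i'')(b)$ (where $\Delta(h)=\sum_i h_i'\otimes h_i''$) and $\pi(h)(\mathbf{1})=\varepsilon(h)\mathbf{1}$ for all $h\in H$, $a,b\in A$. One writes $h(a)$ for $\pi(h)(a)$. A structure on $\mathbb{C}_q[x,y]$ is uniquely determined by the values of $\mathsf{k},\mathsf{e},\mathsf{f}$ on $x,y$. Structures $\pi_1,\pi_2$ are isomorphic if there is an algebra automorphism $\Psi$ of $A$ with $\Psi\pi_1(h)\Psi^{-1}=\pi_2(h)$ for all $h\in H$. *)

theory Defs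
  imports Complex_Main "HOL-Algebra.QuotRing" "HOL-Algebra.Module" "HOL-Library.Poly_Mapping"
begin

section \<open>Complex algebras\<close>

text \<open>
  A unital associative complex algebra is a record of type \<open>(complex, 'a) module\<close>: a ring together
  with a scalar multiplication. (The locale \<open>algebra\<close> of the library is not used because it only
  covers commutative algebras.)
\<close>

definition complex_alg :: "(complex, complex) module" where
  "complex_alg = \<lparr>carrier = UNIV, mult = (*), one = 1, zero = 0, add = (+), smult = (*)\<rparr>"

definition opp_alg :: "(complex, 'a) module \<Rightarrow> (complex, 'a) module" where
  "opp_alg A = A\<lparr>mult := (\<lambda>a b. b \<otimes>\<^bsub>A\<^esub> a)\<rparr>"

text \<open>Homomorphisms are extensional, so that equality of homomorphisms is equality on the carrier.\<close>

definition alg_hom ::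
  "(complex, 'a, 'm) module_scheme \<Rightarrow> (complex, 'b, 'n) module_scheme \<Rightarrow> ('a \<Rightarrow> 'b) set" where
  "alg_hom A B = {h \<in> ring_hom A B \<inter> extensional (carrier A).
     \<forall>c. \<forall>a\<in>carrier A. h (c \<odot>\<^bsub>A\<^esub> a) = c \<odot>\<^bsub>B\<^esub> h a}"

definition lin_end :: "(complex, 'a) module \<Rightarrow> ('a \<Rightarrow> 'a) set" where
  "lin_end A = {f \<in> carrier A \<rightarrow>\<^sub>E carrier A.
     (\<forall>a\<in>carrier A. \<forall>b\<in>carrier A. f (a \<oplus>\<^bsub>A\<^esub> b) = f a \<oplus>\<^bsub>A\<^esub> f b) \<and>
     (\<forall>c. \<forall>a\<in>carrier A. f (c \<odot>\<^bsub>A\<^esub> a) = c \<odot>\<^bsub>A\<^esub> f a)}"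

definition End_alg :: "(complex, 'a) module \<Rightarrow> (complex, 'a \<Rightarrow> 'a) module" where
  "End_alg A = \<lparr>carrier = lin_end A,
     mult = (\<lambda>f g. compose (carrier A) f g),
     one = (\<lambda>a\<in>carrier A. a),
     zero = (\<lambda>a\<in>carrier A. \<zero>\<^bsub>A\<^esub>),
     add = (\<lambda>f g. \<lambda>a\<in>carrier A. f a \<oplus>\<^bsub>A\<^esub> g a),
     smult = (\<lambda>c f. \<lambda>a\<in>carrier A. c \<odot>\<^bsub>A\<^esub> f a)\<rparr>"

definition lin_span :: "(complex, 'a) module \<Rightarrow> 'a set \<Rightarrow> 'a set" where
  "lin_span A S = {(\<Oplus>\<^bsub>A\<^esub>v\<in>T. c v \<odot>\<^bsub>A\<^esub> v) | c T. finite T \<and> T \<subseteq> S}"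

definition quot_alg :: "(complex, 'a) module \<Rightarrow> 'a set \<Rightarrow> (complex, 'a set) module" where
  "quot_alg A I = \<lparr>carrier = carrier (A Quot I), mult = mult (A Quot I), one = one (A Quot I),
     zero = zero (A Quot I), add = add (A Quot I),
     smult = (\<lambda>c X. \<Union>a\<in>X. I +>\<^bsub>A\<^esub> (c \<odot>\<^bsub>A\<^esub> a))\<rparr>"

definition monoid_alg :: "('m, 'z) monoid_scheme \<Rightarrow> (complex, 'm \<Rightarrow>\<^sub>0 complex) module" where
  "monoid_alg M = \<lparr>carrier = {p. Poly_Mapping.keys p \<subseteq> carrier M},
     mult = (\<lambda>p r. \<Sum>u\<in>Poly_Mapping.keys p. \<Sum>v\<in>Poly_Mapping.keys r.
       Poly_Mapping.single (u \<otimes>\<^bsub>M\<^esub> v) (Poly_Mapping.lookup p u * Poly_Mapping.lookup r v)),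
     one = Poly_Mapping.single \<one>\<^bsub>M\<^esub> 1, zero = 0, add = (+),
     smult = (\<lambda>c. Poly_Mapping.map ((*) c))\<rparr>"

definition free_alg :: "(complex, 'g list \<Rightarrow>\<^sub>0 complex) module" where
  "free_alg = monoid_alg \<lparr>carrier = UNIV, mult = (@), one = []\<rparr>"

text \<open>The algebra generated by the elements of the type \<open>'g\<close>, subject to \<open>r = 0\<close> for \<open>r \<in> R\<close>.\<close>

definition presented_alg ::
  "('g list \<Rightarrow>\<^sub>0 complex) set \<Rightarrow> (complex, ('g list \<Rightarrow>\<^sub>0 complex) set) module" where
  "presented_alg R = quot_alg free_alg (Idl\<^bsub>free_alg\<^esub> R)"

definition gen :: "('g list \<Rightarrow>\<^sub>0 complex) set \<Rightarrow> 'g \<Rightarrow> ('g list \<Rightarrow>\<^sub>0 complex) set" where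
  "gen R g = (Idl\<^bsub>free_alg\<^esub> R) +>\<^bsub>free_alg\<^esub> Poly_Mapping.single [g] 1"

section \<open>Tensor products\<close>

text \<open>
  The monoid algebra of \<open>A \<times>\<times> B\<close> is the free vector space on pairs \<open>(a, b)\<close>, multiplied by
  \<open>(a, b) (a', b') = (a a', b b')\<close>. The linear span of the bilinearity relations is closed under
  multiplication by pairs from either side, so it is the ideal which they generate, and the quotient
  is the tensor product of vector spaces with its usual algebra structure.
\<close>

definition tensor_rels ::
  "(complex, 'a) module \<Rightarrow> (complex, 'b) module \<Rightarrow> ('a \<times> 'b \<Rightarrow>\<^sub>0 complex) set" where
  "tensor_rels A B =
     {Poly_Mapping.single (a \<oplus>\<^bsub>A\<^esub> a', b) 1
        - Poly_Mapping.single (a, b) 1 - Poly_Mapping.single (a', b) 1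
      | a a' b. a \<in> carrier A \<and> a' \<in> carrier A \<and> b \<in> carrier B} \<union>
     {Poly_Mapping.single (a, b \<oplus>\<^bsub>B\<^esub> b') 1
        - Poly_Mapping.single (a, b) 1 - Poly_Mapping.single (a, b') 1
      | a b b'. a \<in> carrier A \<and> b \<in> carrier B \<and> b' \<in> carrier B} \<union>
     {Poly_Mapping.single (c \<odot>\<^bsub>A\<^esub> a, b) 1 - Poly_Mapping.single (a, b) c
      | c a b. a \<in> carrier A \<and> b \<in> carrier B} \<union>
     {Poly_Mapping.single (a, c \<odot>\<^bsub>B\<^esub> b) 1 - Poly_Mapping.single (a, b) c
      | c a b. a \<in> carrier A \<and> b \<in> carrier B}"

definition tensor_ideal ::
  "(complex, 'a) module \<Rightarrow> (complex, 'b) module \<Rightarrow> ('a \<times> 'b \<Rightarrow>\<^sub>0 complex) set" where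
  "tensor_ideal A B = Idl\<^bsub>monoid_alg (A \<times>\<times> B)\<^esub> (tensor_rels A B)"

definition tensor_alg ::
  "(complex, 'a) module \<Rightarrow> (complex, 'b) module \<Rightarrow> (complex, ('a \<times> 'b \<Rightarrow>\<^sub>0 complex) set) module" where
  "tensor_alg A B = quot_alg (monoid_alg (A \<times>\<times> B)) (tensor_ideal A B)"

definition pure_tensor ::
  "(complex, 'a) module \<Rightarrow> (complex, 'b) module \<Rightarrow> 'a \<Rightarrow> 'b \<Rightarrow> ('a \<times> 'b \<Rightarrow>\<^sub>0 complex) set" where
  "pure_tensor A B a b =
     tensor_ideal A B +>\<^bsub>monoid_alg (A \<times>\<times> B)\<^esub> Poly_Mapping.single (a, b) 1"

section \<open>Module algebras\<close>

record 'h hopf = "(complex, 'h) module" +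
  comult :: "'h \<Rightarrow> ('h \<times> 'h \<Rightarrow>\<^sub>0 complex) set"
  counit :: "'h \<Rightarrow> complex"
  antipode :: "'h \<Rightarrow> 'h"

abbreviation hopf_alg :: "'h hopf \<Rightarrow> (complex, 'h) module" where
  "hopf_alg H \<equiv> module.truncate H"

text \<open>
  The compatibility with products is required for every way of writing \<open>comult H h\<close> as a sum of pure
  tensors; as the condition is bilinear in \<open>(h', h'')\<close>, it does not depend on this choice.
\<close>

definition module_algebra_structures :: "'h hopf \<Rightarrow> (complex, 'a) module \<Rightarrow> ('h \<Rightarrow> 'a \<Rightarrow> 'a) set" where
  "module_algebra_structures H A = {\<pi> \<in> alg_hom H (End_alg A).
     (\<forall>h\<in>carrier H. \<forall>a\<in>carrier A. \<forall>b\<in>carrier A. \<forall>(n::nat) h' h''.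
        h' \<in> {..<n} \<rightarrow> carrier H \<and> h'' \<in> {..<n} \<rightarrow> carrier H \<and>
        comult H h = (\<Oplus>\<^bsub>tensor_alg (hopf_alg H) (hopf_alg H)\<^esub>i\<in>{..<n}.
          pure_tensor (hopf_alg H) (hopf_alg H) (h' i) (h'' i)) \<longrightarrow>
        \<pi> h (a \<otimes>\<^bsub>A\<^esub> b) = (\<Oplus>\<^bsub>A\<^esub>i\<in>{..<n}. \<pi> (h' i) a \<otimes>\<^bsub>A\<^esub> \<pi> (h'' i) b)) \<and>
     (\<forall>h\<in>carrier H. \<pi> h \<one>\<^bsub>A\<^esub> = counit H h \<odot>\<^bsub>A\<^esub> \<one>\<^bsub>A\<^esub>)}"

definition isomorphic_structures ::
  "'h hopf \<Rightarrow> (complex, 'a) module \<Rightarrow> ('h \<Rightarrow> 'a \<Rightarrow> 'a) \<Rightarrow> ('h \<Rightarrow> 'a \<Rightarrow> 'a) \<Rightarrow> bool" where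
  "isomorphic_structures H A \<pi>1 \<pi>2 \<longleftrightarrow>
     (\<exists>\<Psi> \<in> alg_hom A A. bij_betw \<Psi> (carrier A) (carrier A) \<and>
       (\<forall>h\<in>carrier H. \<forall>a\<in>carrier A. \<Psi> (\<pi>1 h (inv_into (carrier A) \<Psi> a)) = \<pi>2 h a))"

section \<open>The quantum plane\<close>

datatype qp_gen = gX | gY

definition qp_rels :: "complex \<Rightarrow> (qp_gen list \<Rightarrow>\<^sub>0 complex) set" where
  "qp_rels q = {Poly_Mapping.single [gY, gX] 1 - Poly_Mapping.single [gX, gY] q}"

definition qplane :: "complex \<Rightarrow> (complex, (qp_gen list \<Rightarrow>\<^sub>0 complex) set) module" where
  "qplane q = presented_alg (qp_rels q)"

definition qx :: "complex \<Rightarrow> (qp_gen list \<Rightarrow>\<^sub>0 complex) set" where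
  "qx q = gen (qp_rels q) gX"

definition qy :: "complex \<Rightarrow> (qp_gen list \<Rightarrow>\<^sub>0 complex) set" where
  "qy q = gen (qp_rels q) gY"

definition qcomp :: "complex \<Rightarrow> nat \<Rightarrow> (qp_gen list \<Rightarrow>\<^sub>0 complex) set set" where
  "qcomp q i = lin_span (qplane q)
     {(qx q [^]\<^bsub>qplane q\<^esub> m) \<otimes>\<^bsub>qplane q\<^esub> (qy q [^]\<^bsub>qplane q\<^esub> n) | m n :: nat. m + n = i}"

definition qproj ::
  "complex \<Rightarrow> nat \<Rightarrow> (qp_gen list \<Rightarrow>\<^sub>0 complex) set \<Rightarrow> (qp_gen list \<Rightarrow>\<^sub>0 complex) set" where
  "qproj q i p = (THE r. r \<in> qcomp q i \<and>
     p \<ominus>\<^bsub>qplane q\<^esub> r \<in> lin_span (qplane q) (\<Union>j\<in>{j. j \<noteq> i}. qcomp q j))"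

section \<open>The quantum universal enveloping algebra\<close>

datatype uq_gen = gK | gKinv | gE | gF

definition uq_rels :: "complex \<Rightarrow> (uq_gen list \<Rightarrow>\<^sub>0 complex) set" where
  "uq_rels q =
     {Poly_Mapping.single [gKinv, gK] 1 - Poly_Mapping.single [] 1,
      Poly_Mapping.single [gK, gKinv] 1 - Poly_Mapping.single [] 1,
      Poly_Mapping.single [gK, gE] 1 - Poly_Mapping.single [gE, gK] (q powi 2),
      Poly_Mapping.single [gK, gF] 1 - Poly_Mapping.single [gF, gK] (q powi (-2)),
      Poly_Mapping.single [gE, gF] 1 - Poly_Mapping.single [gF, gE] 1
        - (Poly_Mapping.single [gK] (1 / (q - inverse q))
           - Poly_Mapping.single [gKinv] (1 / (q - inverse q)))}"

definition uq_alg :: "complex \<Rightarrow> (complex, (uq_gen list \<Rightarrow>\<^sub>0 complex) set) module" where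
  "uq_alg q = presented_alg (uq_rels q)"

definition uk :: "complex \<Rightarrow> (uq_gen list \<Rightarrow>\<^sub>0 complex) set" where
  "uk q = gen (uq_rels q) gK"

definition ukinv :: "complex \<Rightarrow> (uq_gen list \<Rightarrow>\<^sub>0 complex) set" where
  "ukinv q = gen (uq_rels q) gKinv"

definition ue :: "complex \<Rightarrow> (uq_gen list \<Rightarrow>\<^sub>0 complex) set" where
  "ue q = gen (uq_rels q) gE"

definition uf :: "complex \<Rightarrow> (uq_gen list \<Rightarrow>\<^sub>0 complex) set" where
  "uf q = gen (uq_rels q) gF"

abbreviation uq_tensor ::
  "complex \<Rightarrow> (uq_gen list \<Rightarrow>\<^sub>0 complex) set \<Rightarrow> (uq_gen list \<Rightarrow>\<^sub>0 complex) set \<Rightarrow>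
   ((uq_gen list \<Rightarrow>\<^sub>0 complex) set \<times> (uq_gen list \<Rightarrow>\<^sub>0 complex) set \<Rightarrow>\<^sub>0 complex) set" where
  "uq_tensor q \<equiv> pure_tensor (uq_alg q) (uq_alg q)"

definition uq_comult ::
  "complex \<Rightarrow> (uq_gen list \<Rightarrow>\<^sub>0 complex) set \<Rightarrow>
   ((uq_gen list \<Rightarrow>\<^sub>0 complex) set \<times> (uq_gen list \<Rightarrow>\<^sub>0 complex) set \<Rightarrow>\<^sub>0 complex) set" where
  "uq_comult q = (let U = uq_alg q; T = tensor_alg U U in
     THE \<Delta>. \<Delta> \<in> alg_hom U T \<and>
       \<Delta> (uk q) = uq_tensor q (uk q) (uk q) \<and>
       \<Delta> (ue q) = uq_tensor q \<one>\<^bsub>U\<^esub> (ue q) \<oplus>\<^bsub>T\<^esub> uq_tensor q (ue q) (uk q) \<and>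
       \<Delta> (uf q) = uq_tensor q (uf q) \<one>\<^bsub>U\<^esub> \<oplus>\<^bsub>T\<^esub> uq_tensor q (ukinv q) (uf q))"

definition uq_counit :: "complex \<Rightarrow> (uq_gen list \<Rightarrow>\<^sub>0 complex) set \<Rightarrow> complex" where
  "uq_counit q = (THE \<epsilon>. \<epsilon> \<in> alg_hom (uq_alg q) complex_alg \<and>
     \<epsilon> (uk q) = 1 \<and> \<epsilon> (ue q) = 0 \<and> \<epsilon> (uf q) = 0)"

definition uq_antipode ::
  "complex \<Rightarrow> (uq_gen list \<Rightarrow>\<^sub>0 complex) set \<Rightarrow> (uq_gen list \<Rightarrow>\<^sub>0 complex) set" where
  "uq_antipode q = (let U = uq_alg q in
     THE S. S \<in> alg_hom U (opp_alg U) \<and>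
       S (uk q) = ukinv q \<and>
       S (ue q) = \<ominus>\<^bsub>U\<^esub> (ue q \<otimes>\<^bsub>U\<^esub> ukinv q) \<and>
       S (uf q) = \<ominus>\<^bsub>U\<^esub> (uk q \<otimes>\<^bsub>U\<^esub> uf q))"

definition Uq_sl2 :: "complex \<Rightarrow> (uq_gen list \<Rightarrow>\<^sub>0 complex) set hopf" where
  "Uq_sl2 q = module.extend (uq_alg q) (hopf.fields (uq_comult q) (uq_counit q) (uq_antipode q))"

section \<open>The structures to be classified\<close>

type_synonym qplane_structure =
  "(uq_gen list \<Rightarrow>\<^sub>0 complex) set \<Rightarrow> (qp_gen list \<Rightarrow>\<^sub>0 complex) set \<Rightarrow> (qp_gen list \<Rightarrow>\<^sub>0 complex) set"

definition qplane_structures :: "complex \<Rightarrow> qplane_structure set" where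
  "qplane_structures q = module_algebra_structures (Uq_sl2 q) (qplane q)"

definition selected_structures :: "complex \<Rightarrow> qplane_structure set" where
  "selected_structures q = {\<pi> \<in> qplane_structures q.
     qproj q 0 (\<pi> (ue q) (qx q)) = \<zero>\<^bsub>qplane q\<^esub> \<and> qproj q 0 (\<pi> (ue q) (qy q)) \<noteq> \<zero>\<^bsub>qplane q\<^esub> \<and>
     qproj q 0 (\<pi> (uf q) (qx q)) = \<zero>\<^bsub>qplane q\<^esub> \<and> qproj q 0 (\<pi> (uf q) (qy q)) = \<zero>\<^bsub>qplane q\<^esub> \<and>
     qproj q 1 (\<pi> (ue q) (qx q)) = \<zero>\<^bsub>qplane q\<^esub> \<and> qproj q 1 (\<pi> (ue q) (qy q)) = \<zero>\<^bsub>qplane q\<^esub> \<and>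
     qproj q 1 (\<pi> (uf q) (qx q)) = \<zero>\<^bsub>qplane q\<^esub> \<and> qproj q 1 (\<pi> (uf q) (qy q)) = \<zero>\<^bsub>qplane q\<^esub>}"

definition family_values :: "complex \<Rightarrow> complex \<Rightarrow> qplane_structure \<Rightarrow> bool" where
  "family_values q b0 \<pi> \<longleftrightarrow> (let A = qplane q; x = qx q; y = qy q in
     \<pi> (uk q) x = q \<odot>\<^bsub>A\<^esub> x \<and>
     \<pi> (uk q) y = (q powi (-2)) \<odot>\<^bsub>A\<^esub> y \<and>
     \<pi> (ue q) x = \<zero>\<^bsub>A\<^esub> \<and>
     \<pi> (ue q) y = b0 \<odot>\<^bsub>A\<^esub> \<one>\<^bsub>A\<^esub> \<and>
     \<pi> (uf q) x = inverse b0 \<odot>\<^bsub>A\<^esub> (x \<otimes>\<^bsub>A\<^esub> y) \<and>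
     \<pi> (uf q) y = (- q * inverse b0) \<odot>\<^bsub>A\<^esub> (y \<otimes>\<^bsub>A\<^esub> y))"

end

theory Submission
  imports Defs
begin

text \<open>
  In the basis of the monomials \<open>x\<^sup>m y\<^sup>n\<close> the quantum plane is the space of finitely supported functions
  on pairs \<open>(m, n)\<close> with a twisted convolution. The coproduct of the generators turns a module algebra
  structure into operators \<open>K\<close>, \<open>E\<close>, \<open>F\<close> on this space: \<open>K\<close> is an automorphism, \<open>E\<close> and \<open>F\<close> are skew
  derivations with respect to \<open>K\<close> and its inverse, and the relations of the quantum group hold
  (\<open>uq_operators_of_structure\<close>). Every such system of operators comes from exactly one structure
  (\<open>structure_of_uq_operators\<close>, \<open>structure_determined_by_operators\<close>). This needs the tensor product and
  the coproduct: a skew product rule for the generators propagates to the whole quantum group because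
  the coproduct is multiplicative and bilinear maps factor through the tensor product.

  For \<open>q\<close> not a root of unity, an automorphism of the quantum plane rescales \<open>x\<close> and \<open>y\<close>
  (\<open>automorphism_diagonal\<close>): the leading exponents of the images of \<open>x\<close> and \<open>y\<close> form a matrix of
  determinant 1, and surjectivity forces it to be the identity. If \<open>E y\<close> has a nonzero constant term,
  then comparing coefficients in \<open>K E = q\<^sup>2 E K\<close> and \<open>E (y x) = q E (x y)\<close> yields \<open>K x = q x\<close> and
  \<open>K y = q\<^sup>-\<^sup>2 y\<close> (\<open>K_determined\<close>).

  Now \<open>x\<^sup>m y\<^sup>n\<close> has the \<open>K\<close>-eigenvalue \<open>q\<close> to the power \<open>m - 2 n\<close>. Hence \<open>E\<close> and \<open>F\<close> are finite sums
  \<open>\<Sum> \<lambda>\<^sub>r E\<^sub>r\<close> and \<open>\<Sum> \<mu>\<^sub>t F\<^sub>t\<close>, where \<open>E\<^sub>r\<close> is an explicit skew derivation of bidegree \<open>(2 r, r - 1)\<close> and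
  \<open>F\<^sub>t\<close> one of bidegree \<open>(2 t, t + 1)\<close> (\<open>e_decomposition\<close>, \<open>f_decomposition\<close>). Applied to \<open>x\<close>, the
  commutator of \<open>E\<^sub>r\<close> and \<open>F\<^sub>t\<close> is a monomial of bidegree \<open>(1 + 2 (r + t), r + t)\<close> whose coefficient
  contains the factors \<open>1 - q\<^sup>r\<^sup>+\<^sup>t\<^sup>+\<^sup>2\<close> and \<open>1 - q\<^sup>2\<^sup>r\<^sup>+\<^sup>2\<^sup>t\<^sup>+\<^sup>2\<close> and does not vanish (\<open>commutator_on_x\<close>).
  But the commutator of \<open>E\<close> and \<open>F\<close> maps \<open>x\<close> to itself. So the largest \<open>r\<close> and the largest \<open>t\<close> that
  occur are both 0, and \<open>\<lambda>\<^sub>0\<close> determines \<open>\<mu>\<^sub>0\<close> (\<open>operators_classified\<close>). Conversely \<open>E\<^sub>0\<close> and \<open>F\<^sub>0\<close>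
  with these scalars satisfy all relations (\<open>uq_operators_family\<close>), and rescaling \<open>y\<close> carries any
  member of the family to any other (\<open>rescale_intertwines\<close>).
\<close>

section \<open>Finitely supported functions\<close>

abbreviation "single \<equiv> Poly_Mapping.single"
abbreviation "lookup \<equiv> Poly_Mapping.lookup"
abbreviation "keys \<equiv> Poly_Mapping.keys"

definition pscale :: "complex \<Rightarrow> ('m \<Rightarrow>\<^sub>0 complex) \<Rightarrow> 'm \<Rightarrow>\<^sub>0 complex" (infixr \<open>*\<^sub>p\<close> 75) where
  "c *\<^sub>p p = Poly_Mapping.map ((*) c) p"

lemma lookup_pscale [simp]: "lookup (c *\<^sub>p p) u = c * lookup p u"
  by (simp add: pscale_def Poly_Mapping.map.rep_eq when_def)

lemma keys_pscale: "keys (c *\<^sub>p p) \<subseteq> keys p"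
  by (auto simp: in_keys_iff)

lemma pscale_add_left: "(c + d) *\<^sub>p p = c *\<^sub>p p + d *\<^sub>p p"
  by (rule poly_mapping_eqI) (simp add: lookup_add algebra_simps)

lemma pscale_add_right: "c *\<^sub>p (p + r) = c *\<^sub>p p + c *\<^sub>p r"
  by (rule poly_mapping_eqI) (simp add: lookup_add algebra_simps)

lemma pscale_diff_right: "c *\<^sub>p (p - r) = c *\<^sub>p p - c *\<^sub>p r"
  by (rule poly_mapping_eqI) (simp add: lookup_minus algebra_simps)

lemma pscale_pscale [simp]: "c *\<^sub>p d *\<^sub>p p = (c * d) *\<^sub>p p"
  by (rule poly_mapping_eqI) simp

lemma pscale_one [simp]: "1 *\<^sub>p p = p"
  by (rule poly_mapping_eqI) simp

lemma pscale_zero [simp]: "c *\<^sub>p 0 = 0" "0 *\<^sub>p p = 0"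
  by (rule poly_mapping_eqI, simp)+

lemma pscale_single [simp]: "c *\<^sub>p single u a = single u (c * a)"
  by (rule poly_mapping_eqI) (simp add: lookup_single when_def)

lemma poly_mapping_induct_on [consumes 1, case_names zero add]:
  fixes p :: "'m \<Rightarrow>\<^sub>0 complex"
  assumes "keys p \<subseteq> C" and "P 0"
    and step: "\<And>u c p. u \<in> C \<Longrightarrow> keys p \<subseteq> C \<Longrightarrow> P p \<Longrightarrow> P (single u c + p)"
  shows "P p"
  using assms(1)
proof (induction "card (keys p)" arbitrary: p)
  case 0
  then have "p = 0"
    by simp
  then show ?case
    using \<open>P 0\<close> by simp
next
  case (Suc n)
  then obtain u where u: "u \<in> keys p"
    by (metis card.empty ex_in_conv nat.distinct(1))
  define r where "r = p - single u (lookup p u)"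
  have "keys r = keys p - {u}"
    by (auto simp: r_def in_keys_iff lookup_minus lookup_single when_def split: if_splits)
  moreover from this have "n = card (keys r)"
    using Suc.hyps(2) u by simp
  ultimately have "P r" "keys r \<subseteq> C"
    using Suc.hyps(1)[of r] Suc.prems by auto
  moreover have "p = single u (lookup p u) + r"
    by (simp add: r_def)
  ultimately show ?case
    using step[of u r "lookup p u"] u Suc.prems by auto
qed

lemma poly_mapping_lin_induct [case_names zero single add]:
  fixes p :: "'m \<Rightarrow>\<^sub>0 complex"
  assumes "P 0" "\<And>u c. P (single u c)" "\<And>p r. P p \<Longrightarrow> P r \<Longrightarrow> P (p + r)"
  shows "P p"
  using subset_UNIV[of "keys p"] by (induction p rule: poly_mapping_induct_on) (use assms in auto)

subsection \<open>Twisted convolution\<close>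

text \<open>
  With \<open>c = 1\<close> this is the product of a monoid algebra. With \<open>c\<close> a power of \<open>q\<close> whose exponent is
  bilinear in the two basis elements it is the product of a quantum plane. Both are associative for
  the same reason: \<open>f\<close> is associative and \<open>c\<close> is a 2-cocycle.
\<close>

definition tmult ::
  "('m \<Rightarrow> 'm \<Rightarrow> 'm) \<Rightarrow> ('m \<Rightarrow> 'm \<Rightarrow> complex) \<Rightarrow> ('m \<Rightarrow>\<^sub>0 complex) \<Rightarrow> ('m \<Rightarrow>\<^sub>0 complex) \<Rightarrow> 'm \<Rightarrow>\<^sub>0 complex" where
  "tmult f c p r =
     (\<Sum>u\<in>keys p. \<Sum>v\<in>keys r. single (f u v) (c u v * (lookup p u * lookup r v)))"

lemma tmult_superset:
  assumes "finite S" "keys p \<subseteq> S" "finite T" "keys r \<subseteq> T"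
  shows "tmult f c p r = (\<Sum>u\<in>S. \<Sum>v\<in>T. single (f u v) (c u v * (lookup p u * lookup r v)))"
proof -
  have "tmult f c p r = (\<Sum>u\<in>S. \<Sum>v\<in>keys r. single (f u v) (c u v * (lookup p u * lookup r v)))"
    unfolding tmult_def using assms by (intro sum.mono_neutral_left) (auto simp: in_keys_iff)
  also have "\<dots> = (\<Sum>u\<in>S. \<Sum>v\<in>T. single (f u v) (c u v * (lookup p u * lookup r v)))"
    using assms by (intro sum.cong refl sum.mono_neutral_left) (auto simp: in_keys_iff)
  finally show ?thesis .
qed

lemma tmult_single [simp]: "tmult f c (single u a) (single v b) = single (f u v) (c u v * (a * b))"
  by (subst tmult_superset[of "{u}" _ "{v}"]) (auto simp: in_keys_iff lookup_single when_def)

lemma tmult_zero [simp]: "tmult f c 0 r = 0" "tmult f c p 0 = 0"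
  by (simp_all add: tmult_def)

lemma tmult_add_left: "tmult f c (p + p') r = tmult f c p r + tmult f c p' r"
proof -
  let ?S = "keys p \<union> keys p'"
  have "keys (p + p') \<subseteq> ?S"
    by (rule Poly_Mapping.keys_add)
  then show ?thesis
    by (subst (1 2 3) tmult_superset[of ?S _ "keys r"])
      (auto simp: lookup_add algebra_simps single_add sum.distrib)
qed

lemma tmult_add_right: "tmult f c p (r + r') = tmult f c p r + tmult f c p r'"
proof -
  let ?S = "keys r \<union> keys r'"
  have "keys (r + r') \<subseteq> ?S"
    by (rule Poly_Mapping.keys_add)
  then show ?thesis
    by (subst (1 2 3) tmult_superset[of "keys p" _ ?S])
      (auto simp: lookup_add algebra_simps single_add sum.distrib)
qed

lemma tmult_scale_left: "tmult f c (a *\<^sub>p p) r = a *\<^sub>p tmult f c p r"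
  by (induction p rule: poly_mapping_lin_induct; induction r rule: poly_mapping_lin_induct)
    (simp_all add: tmult_add_left tmult_add_right pscale_add_right algebra_simps)

lemma tmult_scale_right: "tmult f c p (a *\<^sub>p r) = a *\<^sub>p tmult f c p r"
  by (induction p rule: poly_mapping_lin_induct; induction r rule: poly_mapping_lin_induct)
    (simp_all add: tmult_add_left tmult_add_right pscale_add_right algebra_simps)

lemma keys_tmult: "keys (tmult f c p r) \<subseteq> (\<lambda>(u, v). f u v) ` (keys p \<times> keys r)"
proof
  fix w
  assume "w \<in> keys (tmult f c p r)"
  then have "(\<Sum>u\<in>keys p. \<Sum>v\<in>keys r. lookup (single (f u v) (c u v * (lookup p u * lookup r v))) w) \<noteq> 0"
    by (simp add: tmult_def in_keys_iff lookup_sum)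
  then obtain u v where "u \<in> keys p" "v \<in> keys r"
      "lookup (single (f u v) (c u v * (lookup p u * lookup r v))) w \<noteq> 0"
    by (meson sum.not_neutral_contains_not_neutral)
  then show "w \<in> (\<lambda>(u, v). f u v) ` (keys p \<times> keys r)"
    by (auto simp: lookup_single when_def split: if_splits)
qed

lemma tmult_assoc:
  assumes "\<And>u v w. u \<in> C \<Longrightarrow> v \<in> C \<Longrightarrow> w \<in> C \<Longrightarrow> f (f u v) w = f u (f v w)"
    and "\<And>u v w. u \<in> C \<Longrightarrow> v \<in> C \<Longrightarrow> w \<in> C \<Longrightarrow> c u v * c (f u v) w = c v w * c u (f v w)"
    and "keys p \<subseteq> C" "keys r \<subseteq> C" "keys s \<subseteq> C"
  shows "tmult f c (tmult f c p r) s = tmult f c p (tmult f c r s)"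
  using assms(3)
proof (induction p rule: poly_mapping_induct_on)
  case zero
  then show ?case by simp
next
  case (add u a p)
  have "tmult f c (tmult f c (single u a) r) s = tmult f c (single u a) (tmult f c r s)"
    using assms(4)
  proof (induction r rule: poly_mapping_induct_on)
    case zero
    then show ?case by simp
  next
    case (add v b r)
    have "tmult f c (tmult f c (single u a) (single v b)) s
        = tmult f c (single u a) (tmult f c (single v b) s)"
      using assms(5)
    proof (induction s rule: poly_mapping_induct_on)
      case zero
      then show ?case by simp
    next
      case (add w d s)
      have "c (f u v) w * (c u v * (a * b) * d) = (c u v * c (f u v) w) * (a * b * d)"
        by (simp add: mult_ac)
      also have "\<dots> = c u (f v w) * (a * (c v w * (b * d)))"
        by (simp add: assms(2)[OF \<open>u \<in> C\<close> \<open>v \<in> C\<close> \<open>w \<in> C\<close>] mult_ac)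
      finally have "single (f u (f v w)) (c (f u v) w * (c u v * (a * b) * d))
          = single (f u (f v w)) (c u (f v w) * (a * (c v w * (b * d))))"
        by (rule arg_cong)
      then show ?case
        using assms(1)[OF \<open>u \<in> C\<close> \<open>v \<in> C\<close> \<open>w \<in> C\<close>] add by (simp add: tmult_add_right)
    qed
    then show ?case
      using add by (simp add: tmult_add_left tmult_add_right)
  qed
  then show ?case
    using add by (simp add: tmult_add_left)
qed

section \<open>Complex algebras\<close>

locale calg = ring A for A :: "(complex, 'a, 'm) module_scheme" (structure) +
  assumes smult_closed [simp, intro]: "a \<in> carrier A \<Longrightarrow> c \<odot> a \<in> carrier A"
    and smult_add_left: "a \<in> carrier A \<Longrightarrow> (c + d) \<odot> a = c \<odot> a \<oplus> d \<odot> a"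
    and smult_add_right: "a \<in> carrier A \<Longrightarrow> b \<in> carrier A \<Longrightarrow> c \<odot> (a \<oplus> b) = c \<odot> a \<oplus> c \<odot> b"
    and smult_smult [simp]: "a \<in> carrier A \<Longrightarrow> c \<odot> (d \<odot> a) = (c * d) \<odot> a"
    and smult_one [simp]: "a \<in> carrier A \<Longrightarrow> 1 \<odot> a = a"
    and smult_mult_left: "a \<in> carrier A \<Longrightarrow> b \<in> carrier A \<Longrightarrow> (c \<odot> a) \<otimes> b = c \<odot> (a \<otimes> b)"
    and smult_mult_right: "a \<in> carrier A \<Longrightarrow> b \<in> carrier A \<Longrightarrow> a \<otimes> (c \<odot> b) = c \<odot> (a \<otimes> b)"
begin

lemma smult_zero_left [simp]:
  assumes "a \<in> carrier A"
  shows "0 \<odot> a = \<zero>"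
  using smult_add_left[OF assms, of 0 0] assms by (metis add.r_cancel_one' add_0 smult_closed)

lemma smult_zero_right [simp]: "c \<odot> \<zero> = \<zero>"
  using smult_add_right[of \<zero> \<zero> c] by (metis add.r_cancel_one' l_zero smult_closed zero_closed)

lemma smult_minus_one:
  assumes "a \<in> carrier A"
  shows "(- 1) \<odot> a = \<ominus> a"
proof -
  have "(- 1) \<odot> a \<oplus> a = (- 1 + 1) \<odot> a"
    using assms by (simp only: smult_add_left smult_one)
  then show ?thesis
    using assms by (simp add: minus_equality)
qed

lemma smult_finsum:
  assumes "f \<in> S \<rightarrow> carrier A"
  shows "c \<odot> (\<Oplus>i\<in>S. f i) = (\<Oplus>i\<in>S. c \<odot> f i)"
  using assms
  by (induction S rule: infinite_finite_induct) (auto simp: smult_add_right Pi_def)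

end

subsection \<open>Linear extension from a basis\<close>

definition lext ::
  "(complex, 'a, 'n) module_scheme \<Rightarrow> ('m \<Rightarrow> 'a) \<Rightarrow> ('m \<Rightarrow>\<^sub>0 complex) \<Rightarrow> 'a" where
  "lext A f p = (\<Oplus>\<^bsub>A\<^esub>u\<in>keys p. lookup p u \<odot>\<^bsub>A\<^esub> f u)"

context calg
begin

lemma lext_superset:
  assumes "finite S" "keys p \<subseteq> S" "f \<in> S \<rightarrow> carrier A"
  shows "lext A f p = (\<Oplus>u\<in>S. lookup p u \<odot> f u)"
  unfolding lext_def
  using assms by (intro add.finprod_mono_neutral_cong_left) (auto simp: in_keys_iff Pi_def)

lemma lext_closed [simp]:
  assumes "keys p \<subseteq> C" "f \<in> C \<rightarrow> carrier A"
  shows "lext A f p \<in> carrier A"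
  unfolding lext_def using assms by (intro finsum_closed) auto

lemma lext_zero [simp]: "lext A f 0 = \<zero>"
  by (simp add: lext_def)

lemma lext_single [simp]:
  assumes "f u \<in> carrier A"
  shows "lext A f (single u c) = c \<odot> f u"
  using assms by (subst lext_superset[of "{u}"]) (auto simp: Pi_def)

lemma lext_add:
  assumes "keys p \<subseteq> C" "keys r \<subseteq> C" "f \<in> C \<rightarrow> carrier A"
  shows "lext A f (p + r) = lext A f p \<oplus> lext A f r"
proof -
  let ?S = "keys p \<union> keys r"
  have "keys (p + r) \<subseteq> ?S"
    by (rule Poly_Mapping.keys_add)
  moreover have f: "f \<in> ?S \<rightarrow> carrier A"
    using assms by auto
  ultimately have "lext A f (p + r) = (\<Oplus>u\<in>?S. (lookup p u + lookup r u) \<odot> f u)"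
    by (subst lext_superset[of ?S]) (auto simp: lookup_add)
  also have "\<dots> = (\<Oplus>u\<in>?S. lookup p u \<odot> f u \<oplus> lookup r u \<odot> f u)"
    using f by (intro finsum_cong') (auto simp: smult_add_left Pi_def)
  also have "\<dots> = (\<Oplus>u\<in>?S. lookup p u \<odot> f u) \<oplus> (\<Oplus>u\<in>?S. lookup r u \<odot> f u)"
    using f by (intro finsum_addf) (auto simp: Pi_def)
  also have "\<dots> = lext A f p \<oplus> lext A f r"
    using f by (simp add: lext_superset[of ?S])
  finally show ?thesis .
qed

lemma lext_scale:
  assumes "keys p \<subseteq> C" "f \<in> C \<rightarrow> carrier A"
  shows "lext A f (c *\<^sub>p p) = c \<odot> lext A f p"
proof -
  have f: "f \<in> keys p \<rightarrow> carrier A"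
    using assms by auto
  then have "lext A f (c *\<^sub>p p) = (\<Oplus>u\<in>keys p. (c * lookup p u) \<odot> f u)"
    by (subst lext_superset[of "keys p"]) (auto simp: keys_pscale)
  also have "\<dots> = (\<Oplus>u\<in>keys p. c \<odot> (lookup p u \<odot> f u))"
    using f by (intro finsum_cong') (auto simp: Pi_def)
  also have "\<dots> = c \<odot> lext A f p"
    unfolding lext_def using f by (subst smult_finsum) (auto simp: Pi_def)
  finally show ?thesis .
qed

lemma lext_diff:
  assumes "keys p \<subseteq> C" "keys r \<subseteq> C" "f \<in> C \<rightarrow> carrier A"
  shows "lext A f (p - r) = lext A f p \<ominus> lext A f r"
proof -
  have r: "- r = (- 1) *\<^sub>p r"
    by (rule poly_mapping_eqI) simp
  have "keys (- r) \<subseteq> C"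
    using assms by simp
  then have "lext A f (p + - r) = lext A f p \<oplus> lext A f (- r)"
    using assms by (intro lext_add[of _ C])
  also have "lext A f (- r) = \<ominus> lext A f r"
    unfolding r using assms smult_minus_one[OF lext_closed[of r C f]] lext_scale[of r C f "- 1"] by simp
  finally show ?thesis
    by (simp add: minus_eq)
qed

text \<open>
  The universal property of a twisted monoid algebra: by bilinearity, multiplicativity needs to be
  known on basis elements only.
\<close>

lemma lext_tmult:
  assumes "keys p \<subseteq> C" "keys r \<subseteq> C" and f: "f \<in> C \<rightarrow> carrier A"
    and op: "\<And>u v. u \<in> C \<Longrightarrow> v \<in> C \<Longrightarrow> op u v \<in> C"
    and hom: "\<And>u v. u \<in> C \<Longrightarrow> v \<in> C \<Longrightarrow> c u v \<odot> f (op u v) = f u \<otimes> f v"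
  shows "lext A f (tmult op c p r) = lext A f p \<otimes> lext A f r"
  using assms(1)
proof (induction p rule: poly_mapping_induct_on)
  case zero
  then show ?case
    using assms by (simp add: lext_closed[of r C])
next
  case (add u a p)
  have u: "keys (single u a) \<subseteq> C" and fu: "f u \<in> carrier A"
    using add f by auto
  have keys: "keys (tmult op c p' r') \<subseteq> C" if "keys p' \<subseteq> C" "keys r' \<subseteq> C" for p' r'
    using keys_tmult[of op c p' r'] that op by fastforce
  have "lext A f (tmult op c (single u a) r) = lext A f (single u a) \<otimes> lext A f r"
    using assms(2)
  proof (induction r rule: poly_mapping_induct_on)
    case zero
    then show ?case
      using fu by simp
  next
    case (add v b r)
    have v: "keys (single v b) \<subseteq> C" and fv: "f v \<in> carrier A" "f (op u v) \<in> carrier A"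
      using add f op \<open>u \<in> C\<close> by auto
    have "lext A f (single (op u v) (c u v * (a * b))) = (a * b) \<odot> (c u v \<odot> f (op u v))"
      using fv by (simp add: mult_ac)
    also have "\<dots> = lext A f (single u a) \<otimes> lext A f (single v b)"
      using fu fv hom[OF \<open>u \<in> C\<close> \<open>v \<in> C\<close>]
      by (simp add: smult_mult_left smult_mult_right mult.commute[of a b])
    finally show ?case
      using add keys[OF u v] keys[OF u \<open>keys r \<subseteq> C\<close>] u v fu fv f lext_closed[of r C f]
      by (simp add: tmult_add_right lext_add[of _ C] r_distr)
  qed
  then show ?case
    using add assms(2) keys[OF u assms(2)] keys[OF \<open>keys p \<subseteq> C\<close> assms(2)] u fu f
      lext_closed[of r C f] lext_closed[of p C f]
    by (simp add: tmult_add_left lext_add[of _ C] l_distr)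
qed

text \<open>
  In a monoid algebra, multiplication by a multiple of a basis element, from the left or from the
  right, is a map \<open>\<Phi>\<close> of this kind. The lemma moves it from the argument of a
  linear extension into the function that is extended.
\<close>

lemma lext_pushforward:
  assumes p: "keys p \<subseteq> C" and g: "g \<in> C \<rightarrow> D" and f: "f \<in> D \<rightarrow> carrier A"
    and \<Phi>: "\<Phi> 0 = 0" "\<And>p r. \<Phi> (p + r) = \<Phi> p + \<Phi> r" "\<And>u b. \<Phi> (single u b) = single (g u) (a * b)"
  shows "lext A f (\<Phi> p) = a \<odot> lext A (\<lambda>u. f (g u)) p"
proof -
  have fg: "(\<lambda>u. f (g u)) \<in> C \<rightarrow> carrier A"
    using f g by auto
  have "keys (\<Phi> p) \<subseteq> D \<and> lext A f (\<Phi> p) = a \<odot> lext A (\<lambda>u. f (g u)) p"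
    using p
  proof (induction p rule: poly_mapping_induct_on)
    case zero
    then show ?case
      by (simp add: \<Phi>)
  next
    case (add u b p)
    have gu: "g u \<in> D" "f (g u) \<in> carrier A"
      using g f \<open>u \<in> C\<close> by auto
    have "lext A f (single (g u) (a * b) + \<Phi> p) = lext A f (single (g u) (a * b)) \<oplus> lext A f (\<Phi> p)"
      using add gu by (intro lext_add[OF _ _ f]) auto
    moreover have "lext A (\<lambda>u. f (g u)) (single u b + p) = lext A (\<lambda>u. f (g u)) (single u b) \<oplus> lext A (\<lambda>u. f (g u)) p"
      using add by (intro lext_add[OF _ _ fg]) auto
    moreover have "keys (single (g u) (a * b) + \<Phi> p) \<subseteq> D"
      using Poly_Mapping.keys_add[of "single (g u) (a * b)" "\<Phi> p"] add gu by (auto split: if_splits)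
    ultimately show ?case
      using add gu lext_closed[OF \<open>keys p \<subseteq> C\<close> fg] by (simp add: \<Phi> smult_add_right)
  qed
  then show ?thesis ..
qed

end

subsection \<open>Twisted monoid algebras\<close>

definition twisted_alg ::
  "'m set \<Rightarrow> ('m \<Rightarrow> 'm \<Rightarrow> 'm) \<Rightarrow> ('m \<Rightarrow> 'm \<Rightarrow> complex) \<Rightarrow> 'm \<Rightarrow> (complex, 'm \<Rightarrow>\<^sub>0 complex) module" where
  "twisted_alg C f c e = \<lparr>carrier = {p. keys p \<subseteq> C}, mult = tmult f c, one = single e 1,
     zero = 0, add = (+), smult = pscale\<rparr>"

lemma calg_twisted:
  assumes closed: "\<And>u v. u \<in> C \<Longrightarrow> v \<in> C \<Longrightarrow> f u v \<in> C"
    and assoc: "\<And>u v w. u \<in> C \<Longrightarrow> v \<in> C \<Longrightarrow> w \<in> C \<Longrightarrow> f (f u v) w = f u (f v w)"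
    and cocycle: "\<And>u v w. u \<in> C \<Longrightarrow> v \<in> C \<Longrightarrow> w \<in> C \<Longrightarrow> c u v * c (f u v) w = c v w * c u (f v w)"
    and e: "e \<in> C"
    and unit: "\<And>u. u \<in> C \<Longrightarrow> f e u = u \<and> f u e = u \<and> c e u = 1 \<and> c u e = 1"
  shows "calg (twisted_alg C f c e)" (is "calg ?T")
proof -
  have keys: "keys (tmult f c p r) \<subseteq> C" if "keys p \<subseteq> C" "keys r \<subseteq> C" for p r
    using keys_tmult[of f c p r] that closed by fastforce
  have one: "tmult f c (single e 1) p = p" "tmult f c p (single e 1) = p" if "keys p \<subseteq> C" for p
    using that
    by (induction p rule: poly_mapping_induct_on) (auto simp: tmult_add_left tmult_add_right unit e)
  have add: "keys (p + r) \<subseteq> C" if "keys p \<subseteq> C" "keys r \<subseteq> C" for p r :: "'a \<Rightarrow>\<^sub>0 complex"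
    using that Poly_Mapping.keys_add[of p r] by auto
  have scale: "keys (a *\<^sub>p p) \<subseteq> C" if "keys p \<subseteq> C" for a and p :: "'a \<Rightarrow>\<^sub>0 complex"
    using that keys_pscale[of a p] by auto
  have "ring ?T"
  proof (rule ringI)
    have "\<exists>r. keys r \<subseteq> C \<and> r + p = 0" if "keys p \<subseteq> C" for p :: "'a \<Rightarrow>\<^sub>0 complex"
      using that by (intro exI[of _ "- p"]) simp
    then show "abelian_group ?T"
      by (intro abelian_groupI) (auto simp: twisted_alg_def add add_ac intro: subsetD[OF add])
    show "monoid ?T"
      by (rule monoidI) (auto simp: twisted_alg_def e one tmult_assoc[OF assoc cocycle] intro: subsetD[OF keys])
  qed (simp_all add: twisted_alg_def tmult_add_left tmult_add_right)
  then show ?thesis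
    using scale
    by (intro calg.intro)
      (auto intro!: calg_axioms.intro simp: twisted_alg_def pscale_add_left pscale_add_right tmult_scale_left
        tmult_scale_right scale subset_iff)
qed

lemma monoid_alg_twisted:
  "monoid_alg M = twisted_alg (carrier M) (mult M) (\<lambda>_ _. 1) \<one>\<^bsub>M\<^esub>"
  by (auto simp: monoid_alg_def twisted_alg_def tmult_def fun_eq_iff pscale_def)

lemma calg_monoid_alg: "monoid M \<Longrightarrow> calg (monoid_alg M)"
  unfolding monoid_alg_twisted by (rule calg_twisted) (auto simp: monoid.m_assoc monoid.m_closed monoid.one_closed monoid.l_one monoid.r_one)

section \<open>Homomorphisms, endomorphisms and quotients\<close>

lemma alg_homI:
  assumes "h \<in> extensional (carrier A)"
    and "\<And>a. a \<in> carrier A \<Longrightarrow> h a \<in> carrier B"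
    and "\<And>a b. a \<in> carrier A \<Longrightarrow> b \<in> carrier A \<Longrightarrow> h (a \<otimes>\<^bsub>A\<^esub> b) = h a \<otimes>\<^bsub>B\<^esub> h b"
    and "\<And>a b. a \<in> carrier A \<Longrightarrow> b \<in> carrier A \<Longrightarrow> h (a \<oplus>\<^bsub>A\<^esub> b) = h a \<oplus>\<^bsub>B\<^esub> h b"
    and "h \<one>\<^bsub>A\<^esub> = \<one>\<^bsub>B\<^esub>"
    and "\<And>c a. a \<in> carrier A \<Longrightarrow> h (c \<odot>\<^bsub>A\<^esub> a) = c \<odot>\<^bsub>B\<^esub> h a"
  shows "h \<in> alg_hom A B"
  using assms by (auto simp: alg_hom_def intro: ring_hom_memI)

lemma alg_hom_memD:
  assumes "h \<in> alg_hom A B"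
  shows "h \<in> extensional (carrier A)"
    and "a \<in> carrier A \<Longrightarrow> h a \<in> carrier B"
    and "a \<in> carrier A \<Longrightarrow> b \<in> carrier A \<Longrightarrow> h (a \<otimes>\<^bsub>A\<^esub> b) = h a \<otimes>\<^bsub>B\<^esub> h b"
    and "a \<in> carrier A \<Longrightarrow> b \<in> carrier A \<Longrightarrow> h (a \<oplus>\<^bsub>A\<^esub> b) = h a \<oplus>\<^bsub>B\<^esub> h b"
    and "h \<one>\<^bsub>A\<^esub> = \<one>\<^bsub>B\<^esub>"
    and "a \<in> carrier A \<Longrightarrow> h (c \<odot>\<^bsub>A\<^esub> a) = c \<odot>\<^bsub>B\<^esub> h a"
  using assms by (auto simp: alg_hom_def ring_hom_memE)

lemma alg_hom_zero:
  assumes "calg A" "calg B" "h \<in> alg_hom A B"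
  shows "h \<zero>\<^bsub>A\<^esub> = \<zero>\<^bsub>B\<^esub>"
  using assms by (intro ring_hom_zero) (auto simp: alg_hom_def calg_def)

lemma alg_hom_compose:
  assumes "g \<in> alg_hom A B" "h \<in> alg_hom B C" "calg A"
  shows "compose (carrier A) h g \<in> alg_hom A C"
proof -
  interpret A: calg A by fact
  show ?thesis
    using alg_hom_memD[OF assms(1)] alg_hom_memD[OF assms(2)]
    by (intro alg_homI) (auto simp: compose_eq)
qed

lemma (in calg) alg_hom_id: "(\<lambda>a\<in>carrier A. a) \<in> alg_hom A A"
  by (intro alg_homI) auto

lemma calg_End_alg:
  fixes A :: "(complex, 'a) module" (structure)
  assumes "calg A"
  shows "calg (End_alg A)" (is "calg ?E")
proof -
  interpret calg A by fact
  have E: "f \<in> lin_end A \<Longrightarrow> a \<in> carrier A \<Longrightarrow> f a \<in> carrier A"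
    "f \<in> lin_end A \<Longrightarrow> a \<in> carrier A \<Longrightarrow> b \<in> carrier A \<Longrightarrow> f (a \<oplus> b) = f a \<oplus> f b"
    "f \<in> lin_end A \<Longrightarrow> a \<in> carrier A \<Longrightarrow> f (c \<odot> a) = c \<odot> f a"
    "f \<in> lin_end A \<Longrightarrow> f \<in> extensional (carrier A)" for f a b c
    by (auto simp: lin_end_def PiE_def)
  have I: "f \<in> lin_end A" if "f \<in> extensional (carrier A)" "\<And>a. a \<in> carrier A \<Longrightarrow> f a \<in> carrier A"
    "\<And>a b. a \<in> carrier A \<Longrightarrow> b \<in> carrier A \<Longrightarrow> f (a \<oplus> b) = f a \<oplus> f b"
    "\<And>c a. a \<in> carrier A \<Longrightarrow> f (c \<odot> a) = c \<odot> f a" for f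
    using that by (auto simp: lin_end_def PiE_def)
  have eq: "f = g" if "f \<in> extensional (carrier A)" "g \<in> extensional (carrier A)"
    "\<And>a. a \<in> carrier A \<Longrightarrow> f a = g a" for f g :: "'a \<Rightarrow> 'a"
    using that by (rule extensionalityI)
  have add: "(\<lambda>a\<in>carrier A. f a \<oplus> g a) \<in> lin_end A" if "f \<in> lin_end A" "g \<in> lin_end A" for f g
    using that by (intro I) (auto simp: E a_ac smult_add_right)
  have scale: "(\<lambda>a\<in>carrier A. c \<odot> f a) \<in> lin_end A" if "f \<in> lin_end A" for c f
    using that by (intro I) (auto simp: E smult_add_right mult.commute)
  have comp: "compose (carrier A) f g \<in> lin_end A" if "f \<in> lin_end A" "g \<in> lin_end A" for f g
    using that by (intro I) (auto simp: E compose_eq)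
  have zero: "(\<lambda>a\<in>carrier A. \<zero>) \<in> lin_end A"
    by (intro I) auto
  have id: "(\<lambda>a\<in>carrier A. a) \<in> lin_end A"
    by (intro I) auto
  have ext: "compose (carrier A) f g \<in> extensional (carrier A)" for f g :: "'a \<Rightarrow> 'a"
    by (simp add: compose_def)
  have "ring ?E"
  proof (rule ringI)
    show "abelian_group ?E"
    proof (rule abelian_groupI)
      fix f
      assume f: "f \<in> carrier ?E"
      then have "(\<lambda>a\<in>carrier A. (- 1) \<odot> f a) \<in> carrier ?E"
        by (simp add: End_alg_def scale)
      moreover have "(\<lambda>a\<in>carrier A. (- 1) \<odot> f a) \<oplus>\<^bsub>?E\<^esub> f = \<zero>\<^bsub>?E\<^esub>"
        using f by (auto simp: End_alg_def smult_minus_one E l_neg intro!: eq)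
      ultimately show "\<exists>g\<in>carrier ?E. g \<oplus>\<^bsub>?E\<^esub> f = \<zero>\<^bsub>?E\<^esub>"
        by blast
    qed (auto simp: End_alg_def add zero a_ac E intro!: eq)
    show "monoid ?E"
      by (rule monoidI) (auto simp: End_alg_def comp id compose_eq E ext intro!: eq)
  qed (auto simp: End_alg_def compose_eq E ext add intro!: eq)
  then show ?thesis
    by (intro calg.intro calg_axioms.intro)
      (auto simp: End_alg_def compose_eq E ext scale smult_add_left smult_add_right intro!: eq)
qed

text \<open>
  An ideal of a complex algebra is a linear subspace because \<open>c \<odot> i = (c \<odot> \<one>) \<otimes> i\<close>. Hence the scalar
  multiplication of the quotient is independent of representatives.
\<close>

locale calg_ideal = calg A + ideal I A for A :: "(complex, 'a) module" (structure) and I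
begin

lemma quot_alg_simps:
  shows "X \<in> carrier (quot_alg A I) \<longleftrightarrow> (\<exists>a\<in>carrier A. X = I +> a)"
    and "a \<in> carrier A \<Longrightarrow> b \<in> carrier A \<Longrightarrow> (I +> a) \<otimes>\<^bsub>quot_alg A I\<^esub> (I +> b) = I +> (a \<otimes> b)"
    and "a \<in> carrier A \<Longrightarrow> b \<in> carrier A \<Longrightarrow> (I +> a) \<oplus>\<^bsub>quot_alg A I\<^esub> (I +> b) = I +> (a \<oplus> b)"
    and "\<one>\<^bsub>quot_alg A I\<^esub> = I +> \<one>"
    and "\<zero>\<^bsub>quot_alg A I\<^esub> = I +> \<zero>"
  using a_coset_add_zero[OF a_subset]
  by (auto simp: quot_alg_def FactRing_simps rcoset_mult_add a_rcos_sum)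

lemma coset_eq_iff:
  "a \<in> carrier A \<Longrightarrow> b \<in> carrier A \<Longrightarrow> I +> a = I +> b \<longleftrightarrow> a \<ominus> b \<in> I"
  using quotient_eq_iff_same_a_r_cos[OF is_ideal] by blast

lemma smult_ideal:
  assumes "i \<in> I"
  shows "c \<odot> i \<in> I"
proof -
  have "c \<odot> i = (c \<odot> \<one>) \<otimes> i"
    using a_Hcarr[OF assms] by (simp add: smult_mult_left)
  then show ?thesis
    using assms by (simp add: I_l_closed)
qed

lemma coset_memD: "b \<in> I +> a \<Longrightarrow> \<exists>i\<in>I. b = i \<oplus> a"
  by (auto simp: a_r_coset_def')

lemma quot_smult:
  assumes a: "a \<in> carrier A"
  shows "c \<odot>\<^bsub>quot_alg A I\<^esub> (I +> a) = I +> (c \<odot> a)"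
proof -
  have "I +> (c \<odot> b) = I +> (c \<odot> a)" if "b \<in> I +> a" for b
  proof -
    obtain i where i: "i \<in> I" "b = i \<oplus> a"
      using coset_memD[OF \<open>b \<in> I +> a\<close>] by blast
    have "c \<odot> b \<ominus> c \<odot> a = c \<odot> i"
      using i a a_Hcarr[OF i(1)] by (simp add: smult_add_right minus_eq a_assoc r_neg)
    then show ?thesis
      using i a a_Hcarr[OF i(1)] smult_ideal[OF i(1)] by (subst coset_eq_iff) auto
  qed
  moreover have "a \<in> I +> a"
    using a by (rule a_rcos_self)
  ultimately have "(\<Union>b\<in>I +> a. I +> (c \<odot> b)) = I +> (c \<odot> a)"
    by blast
  then show ?thesis
    by (simp add: quot_alg_def)
qed

lemma calg_quot: "calg (quot_alg A I)"
proof -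
  interpret Q: ring "A Quot I"
    by (rule quotient_is_ring)
  have eqs: "carrier (quot_alg A I) = carrier (A Quot I)" "mult (quot_alg A I) = mult (A Quot I)"
    "add (quot_alg A I) = add (A Quot I)" "one (quot_alg A I) = one (A Quot I)"
    "zero (quot_alg A I) = zero (A Quot I)"
    by (simp_all add: quot_alg_def)
  have "ring (quot_alg A I)"
    by (intro ringI abelian_groupI monoidI)
      (auto simp: eqs Q.m_assoc Q.a_ac Q.l_distr Q.r_distr intro: Q.add.l_inv_ex[simplified])
  moreover have "c \<odot>\<^bsub>quot_alg A I\<^esub> X \<in> carrier (quot_alg A I)" if "X \<in> carrier (quot_alg A I)" for c X
    using that smult_closed by (auto simp: quot_alg_simps(1) quot_smult)
  ultimately show ?thesis
    by (intro calg.intro)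
      (auto intro!: calg_axioms.intro simp: quot_alg_simps quot_smult smult_add_left smult_add_right
        smult_mult_left smult_mult_right)
qed

end

definition quot_lift :: "(complex, 'a) module \<Rightarrow> 'a set \<Rightarrow> ('a \<Rightarrow> 'b) \<Rightarrow> 'a set \<Rightarrow> 'b" where
  "quot_lift A I h = (\<lambda>X\<in>carrier (quot_alg A I). h (SOME a. a \<in> X))"

lemma (in calg_ideal) quot_lift_coset:
  assumes "calg B"
    and add: "\<And>a b. a \<in> carrier A \<Longrightarrow> b \<in> carrier A \<Longrightarrow> h (a \<oplus> b) = h a \<oplus>\<^bsub>B\<^esub> h b"
    and zero: "\<And>i. i \<in> I \<Longrightarrow> h i = \<zero>\<^bsub>B\<^esub>"
    and a: "a \<in> carrier A" "h a \<in> carrier B"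
  shows "quot_lift A I h (I +> a) = h a"
proof -
  interpret B: calg B by fact
  have "a \<in> I +> a"
    using a by (intro a_rcos_self)
  then have "(SOME b. b \<in> I +> a) \<in> I +> a"
    by (rule someI)
  then obtain i where "i \<in> I" "(SOME b. b \<in> I +> a) = i \<oplus> a"
    by (blast dest: coset_memD)
  then have "h (SOME b. b \<in> I +> a) = h a"
    using a by (simp add: add zero a_Hcarr)
  then show ?thesis
    using a by (auto simp: quot_lift_def quot_alg_simps)
qed

lemma (in calg_ideal) quot_lift_alg_hom:
  assumes B: "calg B" and h: "h \<in> alg_hom A B" and zero: "\<And>i. i \<in> I \<Longrightarrow> h i = \<zero>\<^bsub>B\<^esub>"
  shows "quot_lift A I h \<in> alg_hom (quot_alg A I) B"
proof -
  note hD = alg_hom_memD[OF h]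
  have *: "quot_lift A I h (I +> a) = h a" if "a \<in> carrier A" for a
    using that by (intro quot_lift_coset[OF B]) (auto simp: zero hD)
  interpret Q: calg "quot_alg A I" by (rule calg_quot)
  show ?thesis
  proof (rule alg_homI)
    show "quot_lift A I h \<in> extensional (carrier (quot_alg A I))"
      by (simp add: quot_lift_def)
  next
    fix X Y c
    assume "X \<in> carrier (quot_alg A I)" "Y \<in> carrier (quot_alg A I)"
    then obtain a b where "a \<in> carrier A" "X = I +> a" "b \<in> carrier A" "Y = I +> b"
      by (auto simp: quot_alg_simps(1))
    then show "quot_lift A I h X \<in> carrier B"
      and "quot_lift A I h (X \<otimes>\<^bsub>quot_alg A I\<^esub> Y) = quot_lift A I h X \<otimes>\<^bsub>B\<^esub> quot_lift A I h Y"
      and "quot_lift A I h (X \<oplus>\<^bsub>quot_alg A I\<^esub> Y) = quot_lift A I h X \<oplus>\<^bsub>B\<^esub> quot_lift A I h Y"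
      and "quot_lift A I h (c \<odot>\<^bsub>quot_alg A I\<^esub> X) = c \<odot>\<^bsub>B\<^esub> quot_lift A I h X"
      by (simp_all add: quot_alg_simps(2,3) quot_smult * hD)
  qed (simp add: quot_alg_simps(4) * hD)
qed

lemma Idl_le_kernel:
  assumes "calg A" "calg B" and h: "h \<in> alg_hom A B" and "R \<subseteq> carrier A"
    and "\<And>r. r \<in> R \<Longrightarrow> h r = \<zero>\<^bsub>B\<^esub>" and "i \<in> Idl\<^bsub>A\<^esub> R"
  shows "h i = \<zero>\<^bsub>B\<^esub>"
proof -
  interpret A: calg A by fact
  interpret B: calg B by fact
  interpret ring_hom_ring A B h
    using h by (intro ring_hom_ringI2) (auto simp: alg_hom_def A.ring_axioms B.ring_axioms)
  have "R \<subseteq> a_kernel A B h"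
    unfolding a_kernel_def' using assms(4,5) by blast
  then have "Idl\<^bsub>A\<^esub> R \<subseteq> a_kernel A B h"
    by (rule A.genideal_minimal[OF kernel_is_ideal])
  then show ?thesis
    using assms(6) unfolding a_kernel_def' by blast
qed

section \<open>Algebras given by generators and relations\<close>

definition word_prod :: "(complex, 'a, 'n) module_scheme \<Rightarrow> ('g \<Rightarrow> 'a) \<Rightarrow> 'g list \<Rightarrow> 'a" where
  "word_prod B g w = foldr (\<lambda>x a. g x \<otimes>\<^bsub>B\<^esub> a) w \<one>\<^bsub>B\<^esub>"

lemma word_prod_simps [simp]:
  "word_prod B g [] = \<one>\<^bsub>B\<^esub>" "word_prod B g (x # w) = g x \<otimes>\<^bsub>B\<^esub> word_prod B g w"
  by (simp_all add: word_prod_def)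

lemma (in calg) word_prod_closed [simp]:
  "(\<And>x. g x \<in> carrier A) \<Longrightarrow> word_prod A g w \<in> carrier A"
  by (induction w) auto

lemma (in calg) word_prod_append:
  "(\<And>x. g x \<in> carrier A) \<Longrightarrow> word_prod A g (v @ w) = word_prod A g v \<otimes> word_prod A g w"
  by (induction v) (auto simp: m_assoc)

lemma free_alg_twisted: "free_alg = twisted_alg UNIV (@) (\<lambda>_ _. 1) []"
  by (simp add: free_alg_def monoid_alg_twisted)

lemma calg_free_alg: "calg free_alg"
  unfolding free_alg_twisted by (rule calg_twisted) auto

lemma carrier_free_alg [simp]: "carrier free_alg = UNIV"
  by (simp add: free_alg_twisted twisted_alg_def)

definition free_eval ::
  "(complex, 'a, 'n) module_scheme \<Rightarrow> ('g \<Rightarrow> 'a) \<Rightarrow> ('g list \<Rightarrow>\<^sub>0 complex) \<Rightarrow> 'a" where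
  "free_eval B g = lext B (word_prod B g)"

lemma (in calg) free_eval_alg_hom:
  assumes "\<And>x. g x \<in> carrier A"
  shows "free_eval A g \<in> alg_hom free_alg A"
proof (rule alg_homI)
  fix p r :: "'b list \<Rightarrow>\<^sub>0 complex"
  have w: "word_prod A g \<in> UNIV \<rightarrow> carrier A"
    using assms by auto
  show "free_eval A g p \<in> carrier A"
    unfolding free_eval_def by (rule lext_closed[OF subset_UNIV w])
  show "free_eval A g (p \<oplus>\<^bsub>free_alg\<^esub> r) = free_eval A g p \<oplus> free_eval A g r"
    using lext_add[OF subset_UNIV subset_UNIV w]
    by (simp add: free_eval_def free_alg_twisted twisted_alg_def)
  show "free_eval A g (c \<odot>\<^bsub>free_alg\<^esub> p) = c \<odot> free_eval A g p" for c
    using lext_scale[OF subset_UNIV w] by (simp add: free_eval_def free_alg_twisted twisted_alg_def)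
  show "free_eval A g (p \<otimes>\<^bsub>free_alg\<^esub> r) = free_eval A g p \<otimes> free_eval A g r"
    unfolding free_eval_def free_alg_twisted twisted_alg_def
    by (simp, intro lext_tmult[OF subset_UNIV subset_UNIV w]) (use assms in \<open>auto simp: word_prod_append\<close>)
  show "free_eval A g \<one>\<^bsub>free_alg\<^esub> = \<one>"
    by (simp add: free_eval_def free_alg_twisted twisted_alg_def)
qed simp

lemma (in calg) free_eval_simps:
  assumes "\<And>x. g x \<in> carrier A"
  shows "free_eval A g (p - r) = free_eval A g p \<ominus> free_eval A g r"
    and "free_eval A g (single w c) = c \<odot> word_prod A g w"
    and "free_eval A g p \<in> carrier A"
  using lext_diff[OF subset_UNIV subset_UNIV, of "word_prod A g" p r] assms
    lext_closed[OF subset_UNIV, of "word_prod A g" p]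
  by (auto simp: free_eval_def)

lemma Idl_free_calg_ideal: "calg_ideal free_alg (Idl\<^bsub>free_alg\<^esub> R)"
proof -
  interpret calg free_alg by (rule calg_free_alg)
  show ?thesis
    by (intro calg_ideal.intro calg_free_alg genideal_ideal) simp
qed

lemma calg_presented: "calg (presented_alg R)"
  unfolding presented_alg_def by (rule calg_ideal.calg_quot[OF Idl_free_calg_ideal])

lemma gen_closed: "gen R x \<in> carrier (presented_alg R)"
  by (auto simp: gen_def presented_alg_def calg_ideal.quot_alg_simps(1)[OF Idl_free_calg_ideal])

lemma presented_word:
  "word_prod (presented_alg R) (gen R) w = Idl\<^bsub>free_alg\<^esub> R +>\<^bsub>free_alg\<^esub> single w 1"
proof (induction w)
  case Nil
  then show ?case
    by (simp add: presented_alg_def calg_ideal.quot_alg_simps[OF Idl_free_calg_ideal])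
      (simp add: free_alg_twisted twisted_alg_def)
next
  case (Cons x w)
  then show ?case
    by (simp add: presented_alg_def gen_def calg_ideal.quot_alg_simps[OF Idl_free_calg_ideal])
      (simp add: free_alg_twisted twisted_alg_def)
qed

text \<open>
  A relation and its meaning in the presented algebra are linked by this formula: the coset of a
  noncommutative polynomial is its value at the generators.
\<close>

lemma presented_free_eval:
  "free_eval (presented_alg R) (gen R) p = Idl\<^bsub>free_alg\<^esub> R +>\<^bsub>free_alg\<^esub> p"
proof -
  interpret F: calg_ideal free_alg "Idl\<^bsub>free_alg\<^esub> R" by (rule Idl_free_calg_ideal)
  interpret P: calg "presented_alg R" by (rule calg_presented)
  note hom = alg_hom_memD[OF P.free_eval_alg_hom[of "gen R", OF gen_closed]]
  have add: "p \<oplus>\<^bsub>free_alg\<^esub> r = p + r" and zero: "\<zero>\<^bsub>free_alg\<^esub> = 0"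
    and scale: "c \<odot>\<^bsub>free_alg\<^esub> p = c *\<^sub>p p" for p r :: "'a list \<Rightarrow>\<^sub>0 complex" and c
    by (simp_all add: free_alg_twisted twisted_alg_def)
  show ?thesis
  proof (induction p rule: poly_mapping_lin_induct)
    case zero
    show ?case
      by (simp add: free_eval_def) (simp add: presented_alg_def F.quot_alg_simps(5) \<open>\<zero>\<^bsub>free_alg\<^esub> = 0\<close>)
  next
    case (single w c)
    show ?case
      using F.quot_smult[of "single w 1" c]
      by (simp add: P.free_eval_simps gen_closed presented_word) (simp add: presented_alg_def scale)
  next
    case (add p r)
    then show ?case
      using hom(4)[of p r] F.quot_alg_simps(3)[of p r] by (simp add: \<open>\<And>r p. p \<oplus>\<^bsub>free_alg\<^esub> r = p + r\<close> presented_alg_def)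
  qed
qed

lemma presented_relation:
  assumes "r \<in> R"
  shows "free_eval (presented_alg R) (gen R) r = \<zero>\<^bsub>presented_alg R\<^esub>"
proof -
  interpret F: calg_ideal free_alg "Idl\<^bsub>free_alg\<^esub> R" by (rule Idl_free_calg_ideal)
  have "r \<in> Idl\<^bsub>free_alg\<^esub> R"
    using F.genideal_self[of R] assms by auto
  then have "Idl\<^bsub>free_alg\<^esub> R +>\<^bsub>free_alg\<^esub> r = Idl\<^bsub>free_alg\<^esub> R +>\<^bsub>free_alg\<^esub> \<zero>\<^bsub>free_alg\<^esub>"
    by (subst F.coset_eq_iff) (simp_all add: F.minus_eq)
  then show ?thesis
    unfolding presented_free_eval by (simp only: presented_alg_def F.quot_alg_simps(5))
qed

definition presented_lift ::
  "('g list \<Rightarrow>\<^sub>0 complex) set \<Rightarrow> (complex, 'a, 'n) module_scheme \<Rightarrow> ('g \<Rightarrow> 'a) \<Rightarrow> ('g list \<Rightarrow>\<^sub>0 complex) set \<Rightarrow> 'a" where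
  "presented_lift R B g = quot_lift free_alg (Idl\<^bsub>free_alg\<^esub> R) (free_eval B g)"

lemma presented_lift:
  assumes B: "calg B" and g: "\<And>x. g x \<in> carrier B"
    and R: "\<And>r. r \<in> R \<Longrightarrow> free_eval B g r = \<zero>\<^bsub>B\<^esub>"
  shows "presented_lift R B g \<in> alg_hom (presented_alg R) B"
    and "presented_lift R B g (gen R x) = g x"
proof -
  interpret F: calg_ideal free_alg "Idl\<^bsub>free_alg\<^esub> R" by (rule Idl_free_calg_ideal)
  interpret B: calg B by fact
  note hom = B.free_eval_alg_hom[of g, OF g]
  have zero: "free_eval B g i = \<zero>\<^bsub>B\<^esub>" if "i \<in> Idl\<^bsub>free_alg\<^esub> R" for i
    by (rule Idl_le_kernel[OF calg_free_alg B hom _ R that]) auto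
  show "presented_lift R B g \<in> alg_hom (presented_alg R) B"
    unfolding presented_lift_def presented_alg_def by (rule F.quot_lift_alg_hom[OF B hom zero])
  have "presented_lift R B g (gen R x) = free_eval B g (single [x] 1)"
    unfolding presented_lift_def gen_def
    by (rule F.quot_lift_coset[OF B]) (use zero alg_hom_memD[OF hom] in auto)
  then show "presented_lift R B g (gen R x) = g x"
    using g by (simp add: B.free_eval_simps)
qed

text \<open>The words in the generators span the algebra, and a word arises from 1 by right multiplications.\<close>

lemma presented_induct [consumes 1, case_names one mult add scale]:
  assumes "X \<in> carrier (presented_alg R)"
    and one: "P \<one>\<^bsub>presented_alg R\<^esub>"
    and mult: "\<And>X x. X \<in> carrier (presented_alg R) \<Longrightarrow> P X \<Longrightarrow> P (X \<otimes>\<^bsub>presented_alg R\<^esub> gen R x)"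
    and add: "\<And>X Y. X \<in> carrier (presented_alg R) \<Longrightarrow> Y \<in> carrier (presented_alg R) \<Longrightarrow> P X \<Longrightarrow> P Y
      \<Longrightarrow> P (X \<oplus>\<^bsub>presented_alg R\<^esub> Y)"
    and scale: "\<And>X c. X \<in> carrier (presented_alg R) \<Longrightarrow> P X \<Longrightarrow> P (c \<odot>\<^bsub>presented_alg R\<^esub> X)"
  shows "P X"
proof -
  interpret F: calg_ideal free_alg "Idl\<^bsub>free_alg\<^esub> R" by (rule Idl_free_calg_ideal)
  interpret P: calg "presented_alg R" by (rule calg_presented)
  note hom = alg_hom_memD[OF P.free_eval_alg_hom[of "gen R", OF gen_closed]]
  have word: "P (word_prod (presented_alg R) (gen R) w)" for w
    by (induction w rule: rev_induct) (auto simp: P.word_prod_append gen_closed one mult)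
  have "P (free_eval (presented_alg R) (gen R) p)" for p
  proof (induction p rule: poly_mapping_lin_induct)
    case zero
    have "P (0 \<odot>\<^bsub>presented_alg R\<^esub> \<one>\<^bsub>presented_alg R\<^esub>)"
      by (intro scale one) simp
    then show ?case
      by (simp add: free_eval_def)
  next
    case (single w c)
    show ?case
      by (simp add: P.free_eval_simps gen_closed scale word)
  next
    case (add p r)
    then have "P (free_eval (presented_alg R) (gen R) p \<oplus>\<^bsub>presented_alg R\<^esub> free_eval (presented_alg R) (gen R) r)"
      by (intro assms(4)) (simp_all add: P.free_eval_simps gen_closed)
    then show ?case
      using hom(4)[of p r] by (simp add: free_alg_twisted twisted_alg_def)
  qed
  moreover obtain p where "X = free_eval (presented_alg R) (gen R) p"
    using assms(1) unfolding presented_free_eval by (auto simp: presented_alg_def F.quot_alg_simps(1))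
  ultimately show ?thesis
    by simp
qed

lemma presented_hom_eqI:
  assumes "g \<in> alg_hom (presented_alg R) B" "h \<in> alg_hom (presented_alg R) B"
    and "\<And>x. g (gen R x) = h (gen R x)"
  shows "g = h"
proof (rule extensionalityI)
  interpret P: calg "presented_alg R" by (rule calg_presented)
  fix X
  assume "X \<in> carrier (presented_alg R)"
  then show "g X = h X"
    by (induction X rule: presented_induct)
      (simp_all add: alg_hom_memD(2-6)[OF assms(1)] alg_hom_memD(2-6)[OF assms(2)] gen_closed assms(3))
qed (use alg_hom_memD(1) assms in auto)

section \<open>Tensor products\<close>

definition bilinear_map ::
  "(complex, 'a) module \<Rightarrow> (complex, 'b) module \<Rightarrow> (complex, 'c) module \<Rightarrow> ('a \<Rightarrow> 'b \<Rightarrow> 'c) \<Rightarrow> bool" where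
  "bilinear_map A B C \<beta> \<longleftrightarrow>
     (\<forall>a\<in>carrier A. \<forall>b\<in>carrier B. \<beta> a b \<in> carrier C) \<and>
     (\<forall>a\<in>carrier A. \<forall>a'\<in>carrier A. \<forall>b\<in>carrier B. \<beta> (a \<oplus>\<^bsub>A\<^esub> a') b = \<beta> a b \<oplus>\<^bsub>C\<^esub> \<beta> a' b) \<and>
     (\<forall>a\<in>carrier A. \<forall>b\<in>carrier B. \<forall>b'\<in>carrier B. \<beta> a (b \<oplus>\<^bsub>B\<^esub> b') = \<beta> a b \<oplus>\<^bsub>C\<^esub> \<beta> a b') \<and>
     (\<forall>c. \<forall>a\<in>carrier A. \<forall>b\<in>carrier B. \<beta> (c \<odot>\<^bsub>A\<^esub> a) b = c \<odot>\<^bsub>C\<^esub> \<beta> a b) \<and>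
     (\<forall>c. \<forall>a\<in>carrier A. \<forall>b\<in>carrier B. \<beta> a (c \<odot>\<^bsub>B\<^esub> b) = c \<odot>\<^bsub>C\<^esub> \<beta> a b)"

lemma bilinear_mapD:
  assumes "bilinear_map A B C \<beta>" and "a \<in> carrier A" "b \<in> carrier B"
  shows "\<beta> a b \<in> carrier C"
    and "a' \<in> carrier A \<Longrightarrow> \<beta> (a \<oplus>\<^bsub>A\<^esub> a') b = \<beta> a b \<oplus>\<^bsub>C\<^esub> \<beta> a' b"
    and "b' \<in> carrier B \<Longrightarrow> \<beta> a (b \<oplus>\<^bsub>B\<^esub> b') = \<beta> a b \<oplus>\<^bsub>C\<^esub> \<beta> a b'"
    and "\<beta> (c \<odot>\<^bsub>A\<^esub> a) b = c \<odot>\<^bsub>C\<^esub> \<beta> a b"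
    and "\<beta> a (c \<odot>\<^bsub>B\<^esub> b) = c \<odot>\<^bsub>C\<^esub> \<beta> a b"
  using assms unfolding bilinear_map_def by blast+

lemma bilinear_map_mult:
  assumes "calg A" "calg B" "bilinear_map A B C \<beta>" "a \<in> carrier A" "b \<in> carrier B"
  shows "bilinear_map A B C (\<lambda>x y. \<beta> (a \<otimes>\<^bsub>A\<^esub> x) (b \<otimes>\<^bsub>B\<^esub> y))"
    and "bilinear_map A B C (\<lambda>x y. \<beta> (x \<otimes>\<^bsub>A\<^esub> a) (y \<otimes>\<^bsub>B\<^esub> b))"
proof -
  interpret A: calg A by fact
  interpret B: calg B by fact
  note \<beta> = bilinear_mapD[OF assms(3)]
  show "bilinear_map A B C (\<lambda>x y. \<beta> (a \<otimes>\<^bsub>A\<^esub> x) (b \<otimes>\<^bsub>B\<^esub> y))"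
    unfolding bilinear_map_def using assms(4,5)
    by (auto simp: \<beta> A.r_distr B.r_distr A.smult_mult_right B.smult_mult_right)
  show "bilinear_map A B C (\<lambda>x y. \<beta> (x \<otimes>\<^bsub>A\<^esub> a) (y \<otimes>\<^bsub>B\<^esub> b))"
    unfolding bilinear_map_def using assms(4,5)
    by (auto simp: \<beta> A.l_distr B.l_distr A.smult_mult_left B.smult_mult_left)
qed

locale tensor = A: calg A + B: calg B
  for A :: "(complex, 'a) module" and B :: "(complex, 'b) module"
begin

abbreviation "M \<equiv> monoid_alg (A \<times>\<times> B)"
abbreviation "T \<equiv> tensor_alg A B"
abbreviation "J \<equiv> tensor_ideal A B"
abbreviation "pt \<equiv> pure_tensor A B"

lemma M_simps:
  "carrier M = {p. keys p \<subseteq> carrier A \<times> carrier B}" "\<zero>\<^bsub>M\<^esub> = 0"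
  "p \<oplus>\<^bsub>M\<^esub> r = p + r" "c \<odot>\<^bsub>M\<^esub> p = c *\<^sub>p p" "\<one>\<^bsub>M\<^esub> = single (\<one>\<^bsub>A\<^esub>, \<one>\<^bsub>B\<^esub>) 1"
  "p \<otimes>\<^bsub>M\<^esub> r = tmult (mult (A \<times>\<times> B)) (\<lambda>_ _. 1) p r"
  by (auto simp: monoid_alg_twisted twisted_alg_def)

lemma calg_M: "calg M"
  by (intro calg_monoid_alg DirProd_monoid A.monoid_axioms B.monoid_axioms)

sublocale M: calg M by (rule calg_M)

lemma M_minus:
  assumes "p \<in> carrier M" "r \<in> carrier M"
  shows "p \<ominus>\<^bsub>M\<^esub> r = p - r"
proof -
  have "(- 1) *\<^sub>p r = - r"
    by (rule poly_mapping_eqI) simp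
  then show ?thesis
    using M.smult_minus_one[of r] assms by (simp add: M.minus_eq) (simp add: M_simps)
qed

lemma rels_closed: "tensor_rels A B \<subseteq> carrier M"
proof -
  have "keys (p - r) \<subseteq> carrier A \<times> carrier B"
    if "keys p \<subseteq> carrier A \<times> carrier B" "keys r \<subseteq> carrier A \<times> carrier B" for p r
    using that Poly_Mapping.keys_diff[of p r] by auto
  note keys = this
  have "r \<in> carrier M" if "r \<in> tensor_rels A B" for r
    using that unfolding tensor_rels_def by (elim UnE CollectE exE conjE) (simp_all add: M_simps keys)
  then show ?thesis
    by blast
qed

sublocale Q: calg_ideal M J
  unfolding tensor_ideal_def
  by (intro calg_ideal.intro calg_M M.genideal_ideal rels_closed)

sublocale T: calg T
  unfolding tensor_alg_def by (rule Q.calg_quot)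

lemma rel_in_ideal: "p \<in> tensor_rels A B \<Longrightarrow> p \<in> J"
  unfolding tensor_ideal_def using M.genideal_self[OF rels_closed] by blast

lemma single_closed [simp]: "a \<in> carrier A \<Longrightarrow> b \<in> carrier B \<Longrightarrow> single (a, b) c \<in> carrier M"
  by (simp add: M_simps)

lemma pt_closed [simp]: "a \<in> carrier A \<Longrightarrow> b \<in> carrier B \<Longrightarrow> pt a b \<in> carrier T"
  by (auto simp: pure_tensor_def tensor_alg_def Q.quot_alg_simps(1))

lemma pt_mult:
  "a \<in> carrier A \<Longrightarrow> b \<in> carrier B \<Longrightarrow> a' \<in> carrier A \<Longrightarrow> b' \<in> carrier B \<Longrightarrow>
    pt a b \<otimes>\<^bsub>T\<^esub> pt a' b' = pt (a \<otimes>\<^bsub>A\<^esub> a') (b \<otimes>\<^bsub>B\<^esub> b')"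
  by (simp add: pure_tensor_def tensor_alg_def Q.quot_alg_simps(2)) (simp add: M_simps)

lemma pt_one: "\<one>\<^bsub>T\<^esub> = pt \<one>\<^bsub>A\<^esub> \<one>\<^bsub>B\<^esub>"
  by (simp add: pure_tensor_def tensor_alg_def Q.quot_alg_simps(4)) (simp add: M_simps)

lemma coset_eq_if_rel:
  assumes "p \<in> carrier M" "r \<in> carrier M" "p - r \<in> tensor_rels A B"
  shows "J +>\<^bsub>M\<^esub> p = J +>\<^bsub>M\<^esub> r"
  using assms rel_in_ideal by (subst Q.coset_eq_iff) (simp_all add: M_minus)

lemma pt_sum:
  "a \<in> carrier A \<Longrightarrow> b \<in> carrier B \<Longrightarrow> a' \<in> carrier A \<Longrightarrow> b' \<in> carrier B \<Longrightarrow>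
    pt a b \<oplus>\<^bsub>T\<^esub> pt a' b' = J +>\<^bsub>M\<^esub> (single (a, b) 1 + single (a', b') 1)"
  by (simp add: pure_tensor_def tensor_alg_def Q.quot_alg_simps(3)) (simp add: M_simps)

lemma pt_add_left:
  assumes "a \<in> carrier A" "a' \<in> carrier A" "b \<in> carrier B"
  shows "pt (a \<oplus>\<^bsub>A\<^esub> a') b = pt a b \<oplus>\<^bsub>T\<^esub> pt a' b"
  unfolding pt_sum[OF assms(1,3,2,3)] unfolding pure_tensor_def
proof (rule coset_eq_if_rel)
  show "single (a \<oplus>\<^bsub>A\<^esub> a', b) 1 - (single (a, b) 1 + single (a', b) 1) \<in> tensor_rels A B"
    using assms unfolding tensor_rels_def diff_diff_eq[symmetric] by blast
qed (use assms M.a_closed[OF single_closed single_closed] in \<open>auto simp: M_simps(3)\<close>)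

lemma pt_add_right:
  assumes "a \<in> carrier A" "b \<in> carrier B" "b' \<in> carrier B"
  shows "pt a (b \<oplus>\<^bsub>B\<^esub> b') = pt a b \<oplus>\<^bsub>T\<^esub> pt a b'"
  unfolding pt_sum[OF assms(1,2,1,3)] unfolding pure_tensor_def
proof (rule coset_eq_if_rel)
  show "single (a, b \<oplus>\<^bsub>B\<^esub> b') 1 - (single (a, b) 1 + single (a, b') 1) \<in> tensor_rels A B"
    using assms unfolding tensor_rels_def diff_diff_eq[symmetric] by blast
qed (use assms M.a_closed[OF single_closed single_closed] in \<open>auto simp: M_simps(3)\<close>)

lemma pt_smult:
  assumes "a \<in> carrier A" "b \<in> carrier B"
  shows "pt (c \<odot>\<^bsub>A\<^esub> a) b = c \<odot>\<^bsub>T\<^esub> pt a b" and "pt a (c \<odot>\<^bsub>B\<^esub> b) = c \<odot>\<^bsub>T\<^esub> pt a b"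
proof -
  have *: "c \<odot>\<^bsub>T\<^esub> pt a b = J +>\<^bsub>M\<^esub> single (a, b) c"
    using Q.quot_smult[OF single_closed[OF assms, of 1], of c]
    by (simp add: pure_tensor_def tensor_alg_def) (simp add: M_simps)
  have "single (c \<odot>\<^bsub>A\<^esub> a, b) 1 - single (a, b) c \<in> tensor_rels A B"
    and "single (a, c \<odot>\<^bsub>B\<^esub> b) 1 - single (a, b) c \<in> tensor_rels A B"
    using assms unfolding tensor_rels_def by blast+
  then show "pt (c \<odot>\<^bsub>A\<^esub> a) b = c \<odot>\<^bsub>T\<^esub> pt a b" and "pt a (c \<odot>\<^bsub>B\<^esub> b) = c \<odot>\<^bsub>T\<^esub> pt a b"
    using assms unfolding * unfolding pure_tensor_def by (simp_all add: coset_eq_if_rel)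
qed

lemma lext_mult_single:
  assumes C: "calg C" and \<beta>: "bilinear_map A B C \<beta>" and ab: "a \<in> carrier A" "b \<in> carrier B"
    and p: "p \<in> carrier M"
  shows "lext C (case_prod \<beta>) (single (a, b) c \<otimes>\<^bsub>M\<^esub> p)
    = c \<odot>\<^bsub>C\<^esub> lext C (\<lambda>(x, y). \<beta> (a \<otimes>\<^bsub>A\<^esub> x) (b \<otimes>\<^bsub>B\<^esub> y)) p"
    and "lext C (case_prod \<beta>) (p \<otimes>\<^bsub>M\<^esub> single (a, b) c)
    = c \<odot>\<^bsub>C\<^esub> lext C (\<lambda>(x, y). \<beta> (x \<otimes>\<^bsub>A\<^esub> a) (y \<otimes>\<^bsub>B\<^esub> b)) p"
proof -
  interpret C: calg C by fact
  have p: "keys p \<subseteq> carrier A \<times> carrier B"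
    using p by (simp add: M_simps)
  have f: "case_prod \<beta> \<in> carrier A \<times> carrier B \<rightarrow> carrier C"
    using bilinear_mapD(1)[OF \<beta>] by auto
  have "lext C (case_prod \<beta>) (single (a, b) c \<otimes>\<^bsub>M\<^esub> p)
      = c \<odot>\<^bsub>C\<^esub> lext C (\<lambda>u. (case_prod \<beta>) (mult (A \<times>\<times> B) (a, b) u)) p"
    unfolding M_simps using ab
    by (intro C.lext_pushforward[OF p _ f]) (auto simp: tmult_add_right)
  then show "lext C (case_prod \<beta>) (single (a, b) c \<otimes>\<^bsub>M\<^esub> p)
    = c \<odot>\<^bsub>C\<^esub> lext C (\<lambda>(x, y). \<beta> (a \<otimes>\<^bsub>A\<^esub> x) (b \<otimes>\<^bsub>B\<^esub> y)) p"
    by (simp add: mult_DirProd' case_prod_unfold)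
  have "lext C (case_prod \<beta>) (p \<otimes>\<^bsub>M\<^esub> single (a, b) c)
      = c \<odot>\<^bsub>C\<^esub> lext C (\<lambda>u. (case_prod \<beta>) (mult (A \<times>\<times> B) u (a, b))) p"
    unfolding M_simps using ab
    by (intro C.lext_pushforward[OF p _ f]) (auto simp: tmult_add_left mult.commute)
  then show "lext C (case_prod \<beta>) (p \<otimes>\<^bsub>M\<^esub> single (a, b) c)
    = c \<odot>\<^bsub>C\<^esub> lext C (\<lambda>(x, y). \<beta> (x \<otimes>\<^bsub>A\<^esub> a) (y \<otimes>\<^bsub>B\<^esub> b)) p"
    by (simp add: mult_DirProd' case_prod_unfold)
qed

text \<open>
  The elements killed by all bilinear maps into \<open>C\<close> form an ideal, because \<open>\<beta> (a _) (b _)\<close> and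
  \<open>\<beta> (_ a) (_ b)\<close> are again bilinear. This ideal contains the defining relations. It follows that
  every bilinear map factors through the tensor product.
\<close>

lemma bilinear_kills_ideal:
  assumes C: "calg C" and \<beta>: "bilinear_map A B C \<beta>" and p: "p \<in> J"
  shows "lext C (case_prod \<beta>) p = \<zero>\<^bsub>C\<^esub>"
proof -
  interpret C: calg C by fact
  define K where "K = {p \<in> carrier M. \<forall>\<beta>. bilinear_map A B C \<beta> \<longrightarrow> lext C (case_prod \<beta>) p = \<zero>\<^bsub>C\<^esub>}"
  have f: "case_prod \<beta> \<in> carrier A \<times> carrier B \<rightarrow> carrier C" if "bilinear_map A B C \<beta>" for \<beta>
    using bilinear_mapD(1)[OF that] by auto
  have add: "p + r \<in> K" if "p \<in> K" "r \<in> K" for p r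
  proof -
    have "p \<oplus>\<^bsub>M\<^esub> r \<in> carrier M"
      using that by (intro M.a_closed) (auto simp: K_def)
    then show ?thesis
      using that f by (auto simp: K_def M_simps C.lext_add[of _ "carrier A \<times> carrier B"])
  qed
  have scale: "c *\<^sub>p p \<in> K" if "p \<in> K" for c p
  proof -
    have "c \<odot>\<^bsub>M\<^esub> p \<in> carrier M"
      using that by (intro M.smult_closed) (auto simp: K_def)
    then show ?thesis
      using that f by (auto simp: K_def M_simps C.lext_scale[of _ "carrier A \<times> carrier B"])
  qed
  have zero: "0 \<in> K"
    by (simp add: K_def M_simps)
  have left: "r \<otimes>\<^bsub>M\<^esub> p \<in> K" and right: "p \<otimes>\<^bsub>M\<^esub> r \<in> K" if p: "p \<in> K" and r: "r \<in> carrier M" for p r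
  proof -
    have "keys r \<subseteq> carrier A \<times> carrier B"
      using r by (simp add: M_simps)
    then have "r \<otimes>\<^bsub>M\<^esub> p \<in> K \<and> p \<otimes>\<^bsub>M\<^esub> r \<in> K"
    proof (induction r rule: poly_mapping_induct_on)
      case zero
      show ?case
        using \<open>0 \<in> K\<close> by (simp add: M_simps)
    next
      case (add u c r)
      obtain a b where u: "u = (a, b)" "a \<in> carrier A" "b \<in> carrier B"
        using add by auto
      have "lext C (\<lambda>(x, y). \<beta> (a \<otimes>\<^bsub>A\<^esub> x) (b \<otimes>\<^bsub>B\<^esub> y)) p = \<zero>\<^bsub>C\<^esub>"
        "lext C (\<lambda>(x, y). \<beta> (x \<otimes>\<^bsub>A\<^esub> a) (y \<otimes>\<^bsub>B\<^esub> b)) p = \<zero>\<^bsub>C\<^esub>" if "bilinear_map A B C \<beta>" for \<beta>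
        using p bilinear_map_mult[OF A.calg_axioms B.calg_axioms that u(2,3)] unfolding K_def by blast+
      then have "single u c \<otimes>\<^bsub>M\<^esub> p \<in> K" "p \<otimes>\<^bsub>M\<^esub> single u c \<in> K"
        using p u by (auto simp: K_def lext_mult_single[OF C])
      moreover have "(single u c + r) \<otimes>\<^bsub>M\<^esub> p = single u c \<otimes>\<^bsub>M\<^esub> p + r \<otimes>\<^bsub>M\<^esub> p"
        "p \<otimes>\<^bsub>M\<^esub> (single u c + r) = p \<otimes>\<^bsub>M\<^esub> single u c + p \<otimes>\<^bsub>M\<^esub> r"
        by (simp_all add: M_simps tmult_add_left tmult_add_right)
      ultimately show ?case
        using add by (simp add: \<open>\<And>r p. p \<in> K \<Longrightarrow> r \<in> K \<Longrightarrow> p + r \<in> K\<close>)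
    qed
    then show "r \<otimes>\<^bsub>M\<^esub> p \<in> K" "p \<otimes>\<^bsub>M\<^esub> r \<in> K" by auto
  qed
  have minus: "\<ominus>\<^bsub>M\<^esub> p \<in> K" if "p \<in> K" for p
  proof -
    have "(- 1) \<odot>\<^bsub>M\<^esub> p = \<ominus>\<^bsub>M\<^esub> p"
      using that by (intro M.smult_minus_one) (auto simp: K_def)
    then show ?thesis
      using scale[OF that, of "- 1"] by (simp add: M_simps)
  qed
  have sub: "K \<subseteq> carrier M"
    by (auto simp: K_def)
  have "ideal K M"
  proof (rule idealI)
    show "subgroup K (add_monoid M)"
      by (rule M.add.subgroupI) (use sub add zero minus in \<open>auto simp: M_simps(3)\<close>)
  qed (use left right M.ring_axioms in auto)
  moreover have "tensor_rels A B \<subseteq> K"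
  proof
    fix r
    assume r: "r \<in> tensor_rels A B"
    then have rM: "r \<in> carrier M"
      using rels_closed by blast
    have "lext C (case_prod \<beta>) r = \<zero>\<^bsub>C\<^esub>" if \<beta>: "bilinear_map A B C \<beta>" for \<beta>
    proof -
      note \<beta>D = bilinear_mapD[OF \<beta>]
      have diff: "lext C (case_prod \<beta>) (p - single (a, b) c) = lext C (case_prod \<beta>) p \<ominus>\<^bsub>C\<^esub> c \<odot>\<^bsub>C\<^esub> \<beta> a b"
        if "keys p \<subseteq> carrier A \<times> carrier B" "a \<in> carrier A" "b \<in> carrier B" for p a b c
        using C.lext_diff[OF that(1) _ f[OF \<beta>], of "single (a, b) c"] that by (simp add: \<beta>D)
      have keys: "keys (p - r) \<subseteq> carrier A \<times> carrier B"
        if "keys p \<subseteq> carrier A \<times> carrier B" "keys r \<subseteq> carrier A \<times> carrier B" for p r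
        using that Poly_Mapping.keys_diff[of p r] by auto
      have cancel: "(x \<oplus>\<^bsub>C\<^esub> y) \<ominus>\<^bsub>C\<^esub> x \<ominus>\<^bsub>C\<^esub> y = \<zero>\<^bsub>C\<^esub>" if "x \<in> carrier C" "y \<in> carrier C" for x y
        using that by algebra
      show ?thesis
        using r unfolding tensor_rels_def
        by (elim UnE CollectE exE conjE) (simp_all add: diff keys \<beta>D cancel C.minus_eq C.r_neg cancel[unfolded C.minus_eq])
    qed
    then show "r \<in> K"
      using rM by (simp add: K_def)
  qed
  ultimately have "J \<subseteq> K"
    unfolding tensor_ideal_def by (rule M.genideal_minimal)
  then show ?thesis
    using p \<beta> by (auto simp: K_def)
qed

definition tensor_lift :: "(complex, 'c) module \<Rightarrow> ('a \<Rightarrow> 'b \<Rightarrow> 'c) \<Rightarrow> ('a \<times> 'b \<Rightarrow>\<^sub>0 complex) set \<Rightarrow> 'c" where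
  "tensor_lift C \<beta> = quot_lift M J (lext C (case_prod \<beta>))"

context
  fixes C :: "(complex, 'c) module" and \<beta>
  assumes C: "calg C" and \<beta>: "bilinear_map A B C \<beta>"
begin

interpretation C: calg C by (rule C)

lemma bilinear_funcset: "case_prod \<beta> \<in> carrier A \<times> carrier B \<rightarrow> carrier C"
  using bilinear_mapD(1)[OF \<beta>] by auto

lemma tensor_lift_coset:
  assumes "p \<in> carrier M"
  shows "tensor_lift C \<beta> (J +>\<^bsub>M\<^esub> p) = lext C (case_prod \<beta>) p"
  unfolding tensor_lift_def
  by (rule Q.quot_lift_coset[OF C])
    (use assms bilinear_kills_ideal[OF C \<beta>] in \<open>auto simp: M_simps C.lext_add[OF _ _ bilinear_funcset]
      intro: C.lext_closed[OF _ bilinear_funcset]\<close>)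

lemma T_memE:
  assumes "t \<in> carrier T"
  obtains p where "p \<in> carrier M" "t = J +>\<^bsub>M\<^esub> p"
  using assms by (auto simp: tensor_alg_def Q.quot_alg_simps(1))

lemma tensor_lift_closed [simp]:
  assumes "t \<in> carrier T"
  shows "tensor_lift C \<beta> t \<in> carrier C"
proof -
  obtain p where "p \<in> carrier M" "t = J +>\<^bsub>M\<^esub> p"
    using assms by (rule T_memE)
  then show ?thesis
    using C.lext_closed[OF _ bilinear_funcset, of p] by (simp add: tensor_lift_coset) (simp add: M_simps)
qed

lemma tensor_lift_add:
  assumes "s \<in> carrier T" "t \<in> carrier T"
  shows "tensor_lift C \<beta> (s \<oplus>\<^bsub>T\<^esub> t) = tensor_lift C \<beta> s \<oplus>\<^bsub>C\<^esub> tensor_lift C \<beta> t"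
proof -
  obtain p where p: "p \<in> carrier M" "s = J +>\<^bsub>M\<^esub> p"
    using assms(1) by (rule T_memE)
  obtain r where r: "r \<in> carrier M" "t = J +>\<^bsub>M\<^esub> r"
    using assms(2) by (rule T_memE)
  have "s \<oplus>\<^bsub>T\<^esub> t = J +>\<^bsub>M\<^esub> (p \<oplus>\<^bsub>M\<^esub> r)"
    using p r by (simp add: tensor_alg_def Q.quot_alg_simps(3))
  then show ?thesis
    using p r C.lext_add[OF _ _ bilinear_funcset, of p r] by (simp add: tensor_lift_coset) (simp add: M_simps)
qed

lemma tensor_lift_scale:
  assumes "t \<in> carrier T"
  shows "tensor_lift C \<beta> (c \<odot>\<^bsub>T\<^esub> t) = c \<odot>\<^bsub>C\<^esub> tensor_lift C \<beta> t"
proof -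
  obtain p where p: "p \<in> carrier M" "t = J +>\<^bsub>M\<^esub> p"
    using assms(1) by (rule T_memE)
  have "c \<odot>\<^bsub>T\<^esub> t = J +>\<^bsub>M\<^esub> (c \<odot>\<^bsub>M\<^esub> p)"
    using p by (simp add: tensor_alg_def Q.quot_smult)
  then show ?thesis
    using p C.lext_scale[OF _ bilinear_funcset, of p c] by (simp add: tensor_lift_coset) (simp add: M_simps)
qed

lemma tensor_lift_pt:
  assumes "a \<in> carrier A" "b \<in> carrier B"
  shows "tensor_lift C \<beta> (pt a b) = \<beta> a b"
  unfolding pure_tensor_def using assms bilinear_mapD(1)[OF \<beta>] by (simp add: tensor_lift_coset)

text \<open>
  Multiplying by a pure tensor amounts to changing the bilinear map. This is what makes inductions
  along right multiplication by generators work for coproducts.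
\<close>

lemma tensor_lift_mult_pt:
  assumes "t \<in> carrier T" "a \<in> carrier A" "b \<in> carrier B"
  shows "tensor_lift C \<beta> (t \<otimes>\<^bsub>T\<^esub> pt a b) = tensor_lift C (\<lambda>x y. \<beta> (x \<otimes>\<^bsub>A\<^esub> a) (y \<otimes>\<^bsub>B\<^esub> b)) t"
proof -
  obtain p where p: "p \<in> carrier M" "t = J +>\<^bsub>M\<^esub> p"
    using assms(1) by (rule T_memE)
  note \<beta>' = bilinear_map_mult(2)[OF A.calg_axioms B.calg_axioms \<beta> assms(2,3)]
  have "t \<otimes>\<^bsub>T\<^esub> pt a b = J +>\<^bsub>M\<^esub> (p \<otimes>\<^bsub>M\<^esub> single (a, b) 1)"
    using p assms by (simp add: tensor_alg_def pure_tensor_def Q.quot_alg_simps(2))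
  moreover have "tensor_lift C (\<lambda>x y. \<beta> (x \<otimes>\<^bsub>A\<^esub> a) (y \<otimes>\<^bsub>B\<^esub> b)) t
      = lext C (\<lambda>(x, y). \<beta> (x \<otimes>\<^bsub>A\<^esub> a) (y \<otimes>\<^bsub>B\<^esub> b)) p"
    unfolding p(2) tensor_lift_def
    by (rule Q.quot_lift_coset[OF C])
      (use p \<beta>' bilinear_kills_ideal[OF C \<beta>'] in \<open>auto simp: M_simps bilinear_map_def
        intro!: C.lext_add[of _ "carrier A \<times> carrier B"] C.lext_closed[of _ "carrier A \<times> carrier B"]\<close>)
  moreover have "lext C (\<lambda>(x, y). \<beta> (x \<otimes>\<^bsub>A\<^esub> a) (y \<otimes>\<^bsub>B\<^esub> b)) p \<in> carrier C"
    using p by (intro C.lext_closed[of _ "carrier A \<times> carrier B"]) (use \<beta>' in \<open>auto simp: M_simps bilinear_map_def\<close>)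
  ultimately show ?thesis
    using p assms by (simp add: tensor_lift_coset lext_mult_single(2)[OF C \<beta>])
qed

lemma tensor_lift_cong:
  assumes "t \<in> carrier T" and eq: "\<And>a b. a \<in> carrier A \<Longrightarrow> b \<in> carrier B \<Longrightarrow> \<gamma> a b = \<beta> a b"
  shows "tensor_lift C \<gamma> t = tensor_lift C \<beta> t"
proof -
  obtain p where p: "p \<in> carrier M" "t = J +>\<^bsub>M\<^esub> p"
    using assms(1) by (rule T_memE)
  have lext_eq: "lext C (case_prod \<gamma>) r = lext C (case_prod \<beta>) r" if "r \<in> carrier M" for r
    unfolding lext_def using that bilinear_funcset eq by (intro C.finsum_cong') (auto simp: M_simps Pi_def)
  have "lext C (case_prod \<beta>) (a \<oplus>\<^bsub>M\<^esub> b) = lext C (case_prod \<beta>) a \<oplus>\<^bsub>C\<^esub> lext C (case_prod \<beta>) b"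
    if "a \<in> carrier M" "b \<in> carrier M" for a b
    using that C.lext_add[OF _ _ bilinear_funcset] by (simp add: M_simps)
  moreover have "lext C (case_prod \<beta>) p \<in> carrier C"
    using p C.lext_closed[OF _ bilinear_funcset] by (simp add: M_simps)
  ultimately have "tensor_lift C \<gamma> t = lext C (case_prod \<gamma>) p"
    unfolding p(2) tensor_lift_def
    by (intro Q.quot_lift_coset[OF C])
      (use p bilinear_kills_ideal[OF C \<beta>] Q.a_Hcarr in \<open>simp_all add: lext_eq\<close>)
  then show ?thesis
    using p lext_eq tensor_lift_coset by simp
qed

lemma tensor_lift_sum:
  assumes "g \<in> {..<n::nat} \<rightarrow> carrier A" "h \<in> {..<n} \<rightarrow> carrier B"
  shows "tensor_lift C \<beta> (\<Oplus>\<^bsub>T\<^esub>i\<in>{..<n}. pt (g i) (h i)) = (\<Oplus>\<^bsub>C\<^esub>i\<in>{..<n}. \<beta> (g i) (h i))"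
  using assms
proof (induction n)
  case 0
  have "tensor_lift C \<beta> (0 \<odot>\<^bsub>T\<^esub> \<one>\<^bsub>T\<^esub>) = \<zero>\<^bsub>C\<^esub>"
    by (subst tensor_lift_scale) auto
  then show ?case
    by simp
next
  case (Suc n)
  have gh: "g i \<in> carrier A" "h i \<in> carrier B" if "i < Suc n" for i
    using Suc.prems that by auto
  have "g \<in> {..<n} \<rightarrow> carrier A" "h \<in> {..<n} \<rightarrow> carrier B"
    using gh by auto
  moreover have "(\<Oplus>\<^bsub>T\<^esub>i\<in>{..<n}. pt (g i) (h i)) \<in> carrier T"
    by (intro T.finsum_closed) (use gh in auto)
  ultimately show ?case
    using Suc.IH gh bilinear_mapD(1)[OF \<beta>]
    by (simp add: lessThan_Suc T.finsum_insert C.finsum_insert Pi_def tensor_lift_add tensor_lift_pt)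
qed

end

end

section \<open>The Hopf algebra structure of the quantum group\<close>

lemma (in calg) minus_eq_zero_iff:
  assumes "a \<in> carrier A" "b \<in> carrier A"
  shows "a \<ominus> b = \<zero> \<longleftrightarrow> a = b"
proof
  assume "a \<ominus> b = \<zero>"
  moreover have "a = (a \<ominus> b) \<oplus> b"
    using assms by algebra
  ultimately show "a = b"
    using assms by simp
qed (use assms in \<open>simp add: minus_eq r_neg\<close>)

definition uq_relations :: "complex \<Rightarrow> (complex, 'a) module \<Rightarrow> 'a \<Rightarrow> 'a \<Rightarrow> 'a \<Rightarrow> 'a \<Rightarrow> bool" where
  "uq_relations q A k k' e f \<longleftrightarrow>
     k' \<otimes>\<^bsub>A\<^esub> k = \<one>\<^bsub>A\<^esub> \<and> k \<otimes>\<^bsub>A\<^esub> k' = \<one>\<^bsub>A\<^esub> \<and>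
     k \<otimes>\<^bsub>A\<^esub> e = (q powi 2) \<odot>\<^bsub>A\<^esub> (e \<otimes>\<^bsub>A\<^esub> k) \<and>
     k \<otimes>\<^bsub>A\<^esub> f = (q powi (-2)) \<odot>\<^bsub>A\<^esub> (f \<otimes>\<^bsub>A\<^esub> k) \<and>
     e \<otimes>\<^bsub>A\<^esub> f \<ominus>\<^bsub>A\<^esub> f \<otimes>\<^bsub>A\<^esub> e
       = (1 / (q - inverse q)) \<odot>\<^bsub>A\<^esub> k \<ominus>\<^bsub>A\<^esub> (1 / (q - inverse q)) \<odot>\<^bsub>A\<^esub> k'"

lemma uq_rels_eval_iff:
  assumes "calg A" and g: "\<And>x. g x \<in> carrier A"
  shows "(\<forall>r\<in>uq_rels q. free_eval A g r = \<zero>\<^bsub>A\<^esub>) \<longleftrightarrow> uq_relations q A (g gK) (g gKinv) (g gE) (g gF)"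
proof -
  interpret calg A by fact
  show ?thesis
    unfolding uq_rels_def uq_relations_def
    by (simp add: free_eval_simps g minus_eq_zero_iff del: One_nat_def)
qed

lemma uq_lift:
  assumes "calg B" "k \<in> carrier B" "k' \<in> carrier B" "e \<in> carrier B" "f \<in> carrier B"
    and "uq_relations q B k k' e f"
  obtains h where "h \<in> alg_hom (uq_alg q) B"
    "h (uk q) = k" "h (ukinv q) = k'" "h (ue q) = e" "h (uf q) = f"
proof -
  define g where "g = case_uq_gen k k' e f"
  have g: "g x \<in> carrier B" for x
    using assms by (cases x) (auto simp: g_def)
  have rel: "free_eval B g r = \<zero>\<^bsub>B\<^esub>" if "r \<in> uq_rels q" for r
    using uq_rels_eval_iff[OF assms(1), of g q] g assms(6) that by (auto simp: g_def)
  show ?thesis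
    using presented_lift[of B g "uq_rels q", OF assms(1) g rel]
    by (intro that[of "presented_lift (uq_rels q) B g"])
      (simp_all add: uq_alg_def uk_def ukinv_def ue_def uf_def, simp_all add: g_def)
qed

lemma calg_uq: "calg (uq_alg q)"
  unfolding uq_alg_def by (rule calg_presented)

lemma uq_gens_closed [simp]:
  "uk q \<in> carrier (uq_alg q)" "ukinv q \<in> carrier (uq_alg q)"
  "ue q \<in> carrier (uq_alg q)" "uf q \<in> carrier (uq_alg q)"
  by (simp_all add: uk_def ukinv_def ue_def uf_def uq_alg_def gen_closed)

lemma uq_alg_relations: "uq_relations q (uq_alg q) (uk q) (ukinv q) (ue q) (uf q)"
  using uq_rels_eval_iff[of "presented_alg (uq_rels q)" "gen (uq_rels q)" q, OF calg_presented gen_closed]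
    presented_relation[of _ "uq_rels q"]
  by (simp add: uk_def ukinv_def ue_def uf_def uq_alg_def)

lemma uq_induct [consumes 1, case_names one k kinv e f add scale]:
  assumes "X \<in> carrier (uq_alg q)"
    and "P \<one>\<^bsub>uq_alg q\<^esub>"
    and "\<And>X. X \<in> carrier (uq_alg q) \<Longrightarrow> P X \<Longrightarrow> P (X \<otimes>\<^bsub>uq_alg q\<^esub> uk q)"
    and "\<And>X. X \<in> carrier (uq_alg q) \<Longrightarrow> P X \<Longrightarrow> P (X \<otimes>\<^bsub>uq_alg q\<^esub> ukinv q)"
    and "\<And>X. X \<in> carrier (uq_alg q) \<Longrightarrow> P X \<Longrightarrow> P (X \<otimes>\<^bsub>uq_alg q\<^esub> ue q)"
    and "\<And>X. X \<in> carrier (uq_alg q) \<Longrightarrow> P X \<Longrightarrow> P (X \<otimes>\<^bsub>uq_alg q\<^esub> uf q)"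
    and "\<And>X Y. X \<in> carrier (uq_alg q) \<Longrightarrow> Y \<in> carrier (uq_alg q) \<Longrightarrow> P X \<Longrightarrow> P Y \<Longrightarrow> P (X \<oplus>\<^bsub>uq_alg q\<^esub> Y)"
    and "\<And>X c. X \<in> carrier (uq_alg q) \<Longrightarrow> P X \<Longrightarrow> P (c \<odot>\<^bsub>uq_alg q\<^esub> X)"
  shows "P X"
  using assms(1)[unfolded uq_alg_def]
proof (induction X rule: presented_induct)
  case (mult X x)
  then show ?case
    using assms(3-6) by (cases x) (simp_all add: uq_alg_def uk_def ukinv_def ue_def uf_def)
qed (use assms(2,7,8) in \<open>simp_all add: uq_alg_def\<close>)

text \<open>
  The images of \<open>ukinv q\<close> agree as well, being inverse to those of \<open>uk q\<close>.
\<close>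

lemma uq_hom_eqI:
  assumes B: "calg B" and g: "g \<in> alg_hom (uq_alg q) B" and h: "h \<in> alg_hom (uq_alg q) B"
    and eq: "g (uk q) = h (uk q)" "g (ue q) = h (ue q)" "g (uf q) = h (uf q)"
  shows "g = h"
proof -
  interpret B: calg B by fact
  note rel = uq_alg_relations[of q, unfolded uq_relations_def]
  have "g (ukinv q) \<otimes>\<^bsub>B\<^esub> g (uk q) = \<one>\<^bsub>B\<^esub>" "h (uk q) \<otimes>\<^bsub>B\<^esub> h (ukinv q) = \<one>\<^bsub>B\<^esub>"
    using alg_hom_memD(3,5)[OF g] alg_hom_memD(3,5)[OF h] rel uq_gens_closed by metis+
  then have kinv: "g (ukinv q) = h (ukinv q)"
    using B.inv_unique[of "g (ukinv q)" "g (uk q)" "h (ukinv q)"] eq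
      alg_hom_memD(2)[OF g] alg_hom_memD(2)[OF h] by simp
  have "g (gen (uq_rels q) x) = h (gen (uq_rels q) x)" for x
    using eq kinv by (cases x) (simp_all add: uk_def ukinv_def ue_def uf_def)
  then show ?thesis
    using g h by (intro presented_hom_eqI[of g "uq_rels q" B h]) (simp_all add: uq_alg_def)
qed

lemma uq_tensor: "tensor (uq_alg q) (uq_alg q)"
  by (intro tensor.intro calg_uq)

lemma kinv_relation:
  assumes "calg U" and "uq_relations q U k k' e f"
    and "k \<in> carrier U" "k' \<in> carrier U" "e \<in> carrier U"
  shows "e \<otimes>\<^bsub>U\<^esub> k' = (q powi 2) \<odot>\<^bsub>U\<^esub> (k' \<otimes>\<^bsub>U\<^esub> e)"
proof -
  interpret U: calg U by fact
  note rel = assms(2)[unfolded uq_relations_def]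
  note [simp] = assms(3-5)
  have "e \<otimes>\<^bsub>U\<^esub> k' = (k' \<otimes>\<^bsub>U\<^esub> k) \<otimes>\<^bsub>U\<^esub> (e \<otimes>\<^bsub>U\<^esub> k')"
    using rel by simp
  also have "\<dots> = k' \<otimes>\<^bsub>U\<^esub> (k \<otimes>\<^bsub>U\<^esub> e) \<otimes>\<^bsub>U\<^esub> k'"
    by (simp add: U.m_assoc)
  also have "\<dots> = (q powi 2) \<odot>\<^bsub>U\<^esub> (k' \<otimes>\<^bsub>U\<^esub> e \<otimes>\<^bsub>U\<^esub> (k \<otimes>\<^bsub>U\<^esub> k'))"
    using rel by (simp add: U.smult_mult_left U.smult_mult_right U.m_assoc)
  finally show ?thesis
    using rel by simp
qed

text \<open>
  In the commutator of the last two elements, the mixed products of \<open>e \<otimes> k\<close> with \<open>k' \<otimes> f\<close> cancel,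
  because moving \<open>k'\<close> past \<open>e\<close> and \<open>k\<close> past \<open>f\<close> produces inverse powers of \<open>q\<close>. What remains is
  \<open>k' \<otimes> (k - k')\<close> and \<open>(k - k') \<otimes> k\<close> up to a common factor, whose sum telescopes.
\<close>

lemma comult_relations:
  fixes U :: "(complex, 'a) module"
  assumes q: "q \<noteq> 0" and U: "calg U" and "uq_relations q U k k' e f"
    and gens: "k \<in> carrier U" "k' \<in> carrier U" "e \<in> carrier U" "f \<in> carrier U"
  shows "uq_relations q (tensor_alg U U) (pure_tensor U U k k) (pure_tensor U U k' k')
     (pure_tensor U U \<one>\<^bsub>U\<^esub> e \<oplus>\<^bsub>tensor_alg U U\<^esub> pure_tensor U U e k)
     (pure_tensor U U f \<one>\<^bsub>U\<^esub> \<oplus>\<^bsub>tensor_alg U U\<^esub> pure_tensor U U k' f)"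
proof -
  interpret U: calg U by fact
  interpret tensor U U by (intro tensor.intro U)
  note [simp] = gens
  define d where "d = 1 / (q - inverse q)"
  define P where "P = pure_tensor U U"
  note P_closed = pt_closed[folded P_def] and P_mult = pt_mult[folded P_def] and one = pt_one[folded P_def]
    and P_smult = pt_smult[folded P_def] and P_add = pt_add_left[folded P_def] pt_add_right[folded P_def]
  note [simp] = P_closed
  have P_neg: "P (\<ominus>\<^bsub>U\<^esub> a) b = \<ominus>\<^bsub>tensor_alg U U\<^esub> P a b" "P b (\<ominus>\<^bsub>U\<^esub> a) = \<ominus>\<^bsub>tensor_alg U U\<^esub> P b a"
    if "a \<in> carrier U" "b \<in> carrier U" for a b
    using that by (simp_all add: U.smult_minus_one[symmetric] T.smult_minus_one[symmetric] P_smult)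
  have ke: "k \<otimes>\<^bsub>U\<^esub> e = (q powi 2) \<odot>\<^bsub>U\<^esub> (e \<otimes>\<^bsub>U\<^esub> k)"
    and kf: "k \<otimes>\<^bsub>U\<^esub> f = (q powi (-2)) \<odot>\<^bsub>U\<^esub> (f \<otimes>\<^bsub>U\<^esub> k)"
    and kk: "k \<otimes>\<^bsub>U\<^esub> k' = \<one>\<^bsub>U\<^esub>" "k' \<otimes>\<^bsub>U\<^esub> k = \<one>\<^bsub>U\<^esub>"
    and ef: "e \<otimes>\<^bsub>U\<^esub> f \<ominus>\<^bsub>U\<^esub> f \<otimes>\<^bsub>U\<^esub> e = d \<odot>\<^bsub>U\<^esub> k \<ominus>\<^bsub>U\<^esub> d \<odot>\<^bsub>U\<^esub> k'"
    using assms(3) by (auto simp: uq_relations_def d_def)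
  have ek': "e \<otimes>\<^bsub>U\<^esub> k' = (q powi 2) \<odot>\<^bsub>U\<^esub> (k' \<otimes>\<^bsub>U\<^esub> e)"
    by (rule kinv_relation[OF U assms(3)]) simp_all
  let ?T = "tensor_alg U U"
  let ?E = "P \<one>\<^bsub>U\<^esub> e \<oplus>\<^bsub>?T\<^esub> P e k"
  let ?F = "P f \<one>\<^bsub>U\<^esub> \<oplus>\<^bsub>?T\<^esub> P k' f"
  have "P k' k' \<otimes>\<^bsub>?T\<^esub> P k k = \<one>\<^bsub>?T\<^esub>" "P k k \<otimes>\<^bsub>?T\<^esub> P k' k' = \<one>\<^bsub>?T\<^esub>"
    by (simp_all add: P_mult kk one)
  moreover have "P k k \<otimes>\<^bsub>?T\<^esub> ?E = (q powi 2) \<odot>\<^bsub>?T\<^esub> (?E \<otimes>\<^bsub>?T\<^esub> P k k)"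
    by (simp add: T.r_distr T.l_distr P_mult ke P_smult T.smult_add_right)
  moreover have "P k k \<otimes>\<^bsub>?T\<^esub> ?F = (q powi (-2)) \<odot>\<^bsub>?T\<^esub> (?F \<otimes>\<^bsub>?T\<^esub> P k k)"
    by (simp add: T.r_distr T.l_distr P_mult kf kk P_smult T.smult_add_right)
  moreover have "?E \<otimes>\<^bsub>?T\<^esub> ?F \<ominus>\<^bsub>?T\<^esub> ?F \<otimes>\<^bsub>?T\<^esub> ?E = d \<odot>\<^bsub>?T\<^esub> P k k \<ominus>\<^bsub>?T\<^esub> d \<odot>\<^bsub>?T\<^esub> P k' k'"
  proof -
    have mixed: "P (e \<otimes>\<^bsub>U\<^esub> k') (k \<otimes>\<^bsub>U\<^esub> f) = P (k' \<otimes>\<^bsub>U\<^esub> e) (f \<otimes>\<^bsub>U\<^esub> k)"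
      using q by (simp add: ek' kf P_smult power_int_minus)
    have "?E \<otimes>\<^bsub>?T\<^esub> ?F = P f e \<oplus>\<^bsub>?T\<^esub> P k' (e \<otimes>\<^bsub>U\<^esub> f) \<oplus>\<^bsub>?T\<^esub> P (e \<otimes>\<^bsub>U\<^esub> f) k
        \<oplus>\<^bsub>?T\<^esub> P (e \<otimes>\<^bsub>U\<^esub> k') (k \<otimes>\<^bsub>U\<^esub> f)"
      by (simp add: T.r_distr T.l_distr P_mult T.a_ac)
    then have EF: "?E \<otimes>\<^bsub>?T\<^esub> ?F = P f e \<oplus>\<^bsub>?T\<^esub> P k' (e \<otimes>\<^bsub>U\<^esub> f) \<oplus>\<^bsub>?T\<^esub> P (e \<otimes>\<^bsub>U\<^esub> f) k
        \<oplus>\<^bsub>?T\<^esub> P (k' \<otimes>\<^bsub>U\<^esub> e) (f \<otimes>\<^bsub>U\<^esub> k)"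
      unfolding mixed .
    have FE: "?F \<otimes>\<^bsub>?T\<^esub> ?E = P f e \<oplus>\<^bsub>?T\<^esub> P k' (f \<otimes>\<^bsub>U\<^esub> e) \<oplus>\<^bsub>?T\<^esub> P (f \<otimes>\<^bsub>U\<^esub> e) k
        \<oplus>\<^bsub>?T\<^esub> P (k' \<otimes>\<^bsub>U\<^esub> e) (f \<otimes>\<^bsub>U\<^esub> k)"
      by (simp add: T.r_distr T.l_distr P_mult T.a_ac)
    have cancel: "(x \<oplus>\<^bsub>?T\<^esub> y \<oplus>\<^bsub>?T\<^esub> z \<oplus>\<^bsub>?T\<^esub> w) \<ominus>\<^bsub>?T\<^esub> (x \<oplus>\<^bsub>?T\<^esub> y' \<oplus>\<^bsub>?T\<^esub> z' \<oplus>\<^bsub>?T\<^esub> w)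
        = (y \<ominus>\<^bsub>?T\<^esub> y') \<oplus>\<^bsub>?T\<^esub> (z \<ominus>\<^bsub>?T\<^esub> z')"
      if "x \<in> carrier ?T" "y \<in> carrier ?T" "z \<in> carrier ?T" "w \<in> carrier ?T" "y' \<in> carrier ?T" "z' \<in> carrier ?T"
      for x y z w y' z'
      using that by algebra
    have cancel': "(m \<ominus>\<^bsub>?T\<^esub> s) \<oplus>\<^bsub>?T\<^esub> (t \<ominus>\<^bsub>?T\<^esub> m) = t \<ominus>\<^bsub>?T\<^esub> s"
      if "m \<in> carrier ?T" "s \<in> carrier ?T" "t \<in> carrier ?T" for m s t
      using that by algebra
    have P_minus: "P a b \<ominus>\<^bsub>?T\<^esub> P a' b = P (a \<ominus>\<^bsub>U\<^esub> a') b" "P b a \<ominus>\<^bsub>?T\<^esub> P b a' = P b (a \<ominus>\<^bsub>U\<^esub> a')"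
      if "a \<in> carrier U" "b \<in> carrier U" "a' \<in> carrier U" for a b a'
      using that by (simp_all add: T.minus_eq U.minus_eq P_add P_neg)
    have "?E \<otimes>\<^bsub>?T\<^esub> ?F \<ominus>\<^bsub>?T\<^esub> ?F \<otimes>\<^bsub>?T\<^esub> ?E
        = P k' (e \<otimes>\<^bsub>U\<^esub> f \<ominus>\<^bsub>U\<^esub> f \<otimes>\<^bsub>U\<^esub> e) \<oplus>\<^bsub>?T\<^esub> P (e \<otimes>\<^bsub>U\<^esub> f \<ominus>\<^bsub>U\<^esub> f \<otimes>\<^bsub>U\<^esub> e) k"
      unfolding EF FE by (subst cancel) (simp_all add: P_minus)
    also have "\<dots> = (d \<odot>\<^bsub>?T\<^esub> P k' k \<ominus>\<^bsub>?T\<^esub> d \<odot>\<^bsub>?T\<^esub> P k' k') \<oplus>\<^bsub>?T\<^esub> (d \<odot>\<^bsub>?T\<^esub> P k k \<ominus>\<^bsub>?T\<^esub> d \<odot>\<^bsub>?T\<^esub> P k' k)"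
      unfolding ef by (simp add: P_minus[symmetric] P_smult)
    also have "\<dots> = d \<odot>\<^bsub>?T\<^esub> P k k \<ominus>\<^bsub>?T\<^esub> d \<odot>\<^bsub>?T\<^esub> P k' k'"
      by (rule cancel') simp_all
    finally show ?thesis .
  qed
  ultimately show ?thesis
    unfolding uq_relations_def by (simp add: d_def P_def)
qed

text \<open>
  The definite description in the definition of the coproduct is proper: existence is
  \<open>comult_relations\<close>, uniqueness is \<open>uq_hom_eqI\<close>.
\<close>

lemma uq_comult:
  fixes q
  assumes "q \<noteq> 0"
  defines "T \<equiv> tensor_alg (uq_alg q) (uq_alg q)"
  shows "uq_comult q \<in> alg_hom (uq_alg q) T"
    and "uq_comult q (uk q) = uq_tensor q (uk q) (uk q)"
    and "uq_comult q (ukinv q) = uq_tensor q (ukinv q) (ukinv q)"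
    and "uq_comult q (ue q) = uq_tensor q \<one>\<^bsub>uq_alg q\<^esub> (ue q) \<oplus>\<^bsub>T\<^esub> uq_tensor q (ue q) (uk q)"
    and "uq_comult q (uf q) = uq_tensor q (uf q) \<one>\<^bsub>uq_alg q\<^esub> \<oplus>\<^bsub>T\<^esub> uq_tensor q (ukinv q) (uf q)"
proof -
  interpret U: calg "uq_alg q" by (rule calg_uq)
  interpret tensor "uq_alg q" "uq_alg q" by (rule uq_tensor)
  let ?ok = "\<lambda>h. h \<in> alg_hom (uq_alg q) T \<and> h (uk q) = uq_tensor q (uk q) (uk q) \<and>
    h (ue q) = uq_tensor q \<one>\<^bsub>uq_alg q\<^esub> (ue q) \<oplus>\<^bsub>T\<^esub> uq_tensor q (ue q) (uk q) \<and>
    h (uf q) = uq_tensor q (uf q) \<one>\<^bsub>uq_alg q\<^esub> \<oplus>\<^bsub>T\<^esub> uq_tensor q (ukinv q) (uf q)"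
  have rel: "uq_relations q T (uq_tensor q (uk q) (uk q)) (uq_tensor q (ukinv q) (ukinv q))
     (uq_tensor q \<one>\<^bsub>uq_alg q\<^esub> (ue q) \<oplus>\<^bsub>T\<^esub> uq_tensor q (ue q) (uk q))
     (uq_tensor q (uf q) \<one>\<^bsub>uq_alg q\<^esub> \<oplus>\<^bsub>T\<^esub> uq_tensor q (ukinv q) (uf q))"
    unfolding T_def by (rule comult_relations[OF assms(1) calg_uq uq_alg_relations uq_gens_closed])
  have T: "calg T"
    unfolding T_def by (rule T.calg_axioms)
  have "\<exists>h. ?ok h \<and> h (ukinv q) = uq_tensor q (ukinv q) (ukinv q)"
    by (rule uq_lift[OF T _ _ _ _ rel]) (auto simp: T_def)
  then obtain h where h: "?ok h" "h (ukinv q) = uq_tensor q (ukinv q) (ukinv q)"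
    by blast
  have "uq_comult q = h"
    unfolding uq_comult_def Let_def T_def[symmetric]
  proof (rule the_equality)
    show "h' = h" if "?ok h'" for h'
      using h that by (intro uq_hom_eqI[OF T, of h' q h]) simp_all
  qed (rule h(1))
  then show "uq_comult q \<in> alg_hom (uq_alg q) T"
    and "uq_comult q (uk q) = uq_tensor q (uk q) (uk q)"
    and "uq_comult q (ukinv q) = uq_tensor q (ukinv q) (ukinv q)"
    and "uq_comult q (ue q) = uq_tensor q \<one>\<^bsub>uq_alg q\<^esub> (ue q) \<oplus>\<^bsub>T\<^esub> uq_tensor q (ue q) (uk q)"
    and "uq_comult q (uf q) = uq_tensor q (uf q) \<one>\<^bsub>uq_alg q\<^esub> \<oplus>\<^bsub>T\<^esub> uq_tensor q (ukinv q) (uf q)"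
    using h by simp_all
qed

lemma calg_complex: "calg complex_alg"
proof -
  have "\<exists>y. y + x = 0" for x :: complex
    by (rule exI[of _ "- x"]) simp
  then have "ring complex_alg"
    by (intro ringI abelian_groupI monoidI) (auto simp: complex_alg_def algebra_simps)
  then show ?thesis
    by (intro calg.intro calg_axioms.intro) (auto simp: complex_alg_def algebra_simps)
qed

lemma uq_counit:
  shows "uq_counit q \<in> alg_hom (uq_alg q) complex_alg"
    and "uq_counit q (uk q) = 1" "uq_counit q (ukinv q) = 1" "uq_counit q (ue q) = 0" "uq_counit q (uf q) = 0"
proof -
  interpret C: calg complex_alg by (rule calg_complex)
  have neg: "\<ominus>\<^bsub>complex_alg\<^esub> x = - x" for x
    using C.smult_minus_one[of x] by (simp add: complex_alg_def)
  have "uq_relations q complex_alg 1 1 0 0"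
    by (simp add: uq_relations_def C.minus_eq neg) (simp add: complex_alg_def)
  then obtain h where h: "h \<in> alg_hom (uq_alg q) complex_alg"
    "h (uk q) = 1" "h (ukinv q) = 1" "h (ue q) = 0" "h (uf q) = 0"
    using uq_lift[OF calg_complex, of 1 1 0 0 q thesis] by (simp add: complex_alg_def)
  have "uq_counit q = h"
    unfolding uq_counit_def
  proof (rule the_equality)
    fix h'
    assume "h' \<in> alg_hom (uq_alg q) complex_alg \<and> h' (uk q) = 1 \<and> h' (ue q) = 0 \<and> h' (uf q) = 0"
    then show "h' = h"
      using h by (intro uq_hom_eqI[OF calg_complex, of h' q h]) simp_all
  qed (use h in simp)
  then show "uq_counit q \<in> alg_hom (uq_alg q) complex_alg"
    "uq_counit q (uk q) = 1" "uq_counit q (ukinv q) = 1" "uq_counit q (ue q) = 0" "uq_counit q (uf q) = 0"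
    using h by simp_all
qed

lemma Uq_sl2_simps:
  "hopf_alg (Uq_sl2 q) = uq_alg q" "carrier (Uq_sl2 q) = carrier (uq_alg q)"
  "comult (Uq_sl2 q) = uq_comult q" "counit (Uq_sl2 q) = uq_counit q"
  "alg_hom (Uq_sl2 q) B = alg_hom (uq_alg q) B"
  by (simp_all add: Uq_sl2_def module.truncate_def module.extend_def hopf.fields_def alg_hom_def ring_hom_def)

section \<open>The quantum plane in the basis of ordered monomials\<close>

text \<open>
  The algebra \<open>qalg q\<close> on finitely supported functions is isomorphic to the presented algebra
  \<open>qplane q\<close>, by \<open>coords\<close> and its inverse \<open>from_coords\<close>. In particular the monomials form a basis.
\<close>

type_synonym qpoly = "nat \<times> nat \<Rightarrow>\<^sub>0 complex"

definition qmul :: "complex \<Rightarrow> qpoly \<Rightarrow> qpoly \<Rightarrow> qpoly" where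
  "qmul q = tmult (\<lambda>(m, n) (m', n'). (m + m', n + n')) (\<lambda>(m, n) (m', n'). q ^ (n * m'))"

definition qalg :: "complex \<Rightarrow> (complex, qpoly) module" where
  "qalg q = twisted_alg UNIV (\<lambda>(m, n) (m', n'). (m + m', n + n')) (\<lambda>(m, n) (m', n'). q ^ (n * m')) (0, 0)"

abbreviation mon :: "nat \<Rightarrow> nat \<Rightarrow> qpoly" where
  "mon m n \<equiv> single (m, n) 1"

lemma qalg_simps [simp]:
  "carrier (qalg q) = UNIV" "p \<otimes>\<^bsub>qalg q\<^esub> r = qmul q p r" "\<one>\<^bsub>qalg q\<^esub> = mon 0 0" "\<zero>\<^bsub>qalg q\<^esub> = 0"
  "p \<oplus>\<^bsub>qalg q\<^esub> r = p + r" "c \<odot>\<^bsub>qalg q\<^esub> p = c *\<^sub>p p"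
  by (simp_all add: qalg_def twisted_alg_def qmul_def)

lemma calg_qalg: "calg (qalg q)"
  unfolding qalg_def by (rule calg_twisted) (auto simp: power_add[symmetric] algebra_simps)

lemma qmul_single [simp]: "qmul q (single (m, n) a) (single (m', n') b) = single (m + m', n + n') (q ^ (n * m') * (a * b))"
  by (simp add: qmul_def)

lemma qmul_add_left: "qmul q (p + p') r = qmul q p r + qmul q p' r"
  and qmul_add_right: "qmul q p (r + r') = qmul q p r + qmul q p r'"
  and qmul_scale_left: "qmul q (c *\<^sub>p p) r = c *\<^sub>p qmul q p r"
  and qmul_scale_right: "qmul q p (c *\<^sub>p r) = c *\<^sub>p qmul q p r"
  and qmul_zero [simp]: "qmul q 0 r = 0" "qmul q p 0 = 0"
  by (simp_all add: qmul_def tmult_add_left tmult_add_right tmult_scale_left tmult_scale_right)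

lemma qmul_one [simp]: "qmul q (mon 0 0) p = p" "qmul q p (mon 0 0) = p"
proof -
  interpret calg "qalg q" by (rule calg_qalg)
  show "qmul q (mon 0 0) p = p" "qmul q p (mon 0 0) = p"
    using l_one[of p] r_one[of p] by simp_all
qed

lemma calg_qplane: "calg (qplane q)"
  unfolding qplane_def by (rule calg_presented)

lemma qxy_closed [simp]: "qx q \<in> carrier (qplane q)" "qy q \<in> carrier (qplane q)"
  by (simp_all add: qx_def qy_def qplane_def gen_closed)

lemma qplane_relation: "qy q \<otimes>\<^bsub>qplane q\<^esub> qx q = q \<odot>\<^bsub>qplane q\<^esub> (qx q \<otimes>\<^bsub>qplane q\<^esub> qy q)"
proof -
  interpret P: calg "presented_alg (qp_rels q)" by (rule calg_presented)
  have "single [gY, gX] 1 - single [gX, gY] q \<in> qp_rels q"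
    by (simp add: qp_rels_def)
  from presented_relation[OF this] show ?thesis
    by (simp add: P.free_eval_simps gen_closed P.minus_eq_zero_iff qplane_def qx_def qy_def)
qed

lemma qplane_hom_eqI:
  assumes "g \<in> alg_hom (qplane q) B" "h \<in> alg_hom (qplane q) B" "g (qx q) = h (qx q)" "g (qy q) = h (qy q)"
  shows "g = h"
proof (rule presented_hom_eqI)
  show "g (gen (qp_rels q) x) = h (gen (qp_rels q) x)" for x
    using assms by (cases x) (simp_all add: qx_def qy_def)
qed (use assms in \<open>simp_all add: qplane_def\<close>)

definition coords :: "complex \<Rightarrow> (qp_gen list \<Rightarrow>\<^sub>0 complex) set \<Rightarrow> qpoly" where
  "coords q = presented_lift (qp_rels q) (qalg q) (case_qp_gen (mon 1 0) (mon 0 1))"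

definition from_coords :: "complex \<Rightarrow> qpoly \<Rightarrow> (qp_gen list \<Rightarrow>\<^sub>0 complex) set" where
  "from_coords q = lext (qplane q) (\<lambda>(m, n). (qx q [^]\<^bsub>qplane q\<^esub> m) \<otimes>\<^bsub>qplane q\<^esub> (qy q [^]\<^bsub>qplane q\<^esub> n))"

lemma coords_hom: "coords q \<in> alg_hom (qplane q) (qalg q)"
  and coords_gens [simp]: "coords q (qx q) = mon 1 0" "coords q (qy q) = mon 0 1"
proof -
  interpret calg "qalg q" by (rule calg_qalg)
  let ?g = "case_qp_gen (mon 1 0) (mon 0 1)"
  have "free_eval (qalg q) ?g r = \<zero>\<^bsub>qalg q\<^esub>" if "r \<in> qp_rels q" for r
    using that by (simp add: qp_rels_def free_eval_simps minus_eq_zero_iff del: qalg_simps(4))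
  note lift = presented_lift[of "qalg q" ?g "qp_rels q", OF calg_qalg _ this, folded coords_def]
  show "coords q \<in> alg_hom (qplane q) (qalg q)" "coords q (qx q) = mon 1 0" "coords q (qy q) = mon 0 1"
    using lift by (simp_all add: qplane_def qx_def qy_def)
qed

lemma monomial_closed [simp]:
  "(qx q [^]\<^bsub>qplane q\<^esub> (m::nat)) \<otimes>\<^bsub>qplane q\<^esub> (qy q [^]\<^bsub>qplane q\<^esub> (n::nat)) \<in> carrier (qplane q)"
proof -
  interpret calg "qplane q" by (rule calg_qplane)
  show ?thesis by simp
qed

lemma (in calg) monomials_mult_if_q_commute:
  fixes m n m' n' :: nat
  assumes x: "x \<in> carrier A" and y: "y \<in> carrier A" and yx: "y \<otimes> x = q \<odot> (x \<otimes> y)"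
  shows "((x [^] m) \<otimes> (y [^] n)) \<otimes> ((x [^] m') \<otimes> (y [^] n'))
    = q ^ (n * m') \<odot> ((x [^] (m + m')) \<otimes> (y [^] (n + n')))"
proof -
  note [simp] = x y
  have y_xm: "y \<otimes> (x [^] m) = q ^ m \<odot> ((x [^] m) \<otimes> y)" for m :: nat
  proof (induction m)
    case (Suc m)
    have "y \<otimes> (x [^] Suc m) = (y \<otimes> (x [^] m)) \<otimes> x"
      by (simp add: m_assoc)
    also have "\<dots> = q ^ m \<odot> ((x [^] m) \<otimes> (y \<otimes> x))"
      unfolding Suc by (simp add: m_assoc smult_mult_left)
    also have "\<dots> = q ^ Suc m \<odot> ((x [^] Suc m) \<otimes> y)"
      unfolding yx by (simp add: m_assoc smult_mult_right mult.commute)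
    finally show ?case .
  qed simp
  have yn_xm: "(y [^] n) \<otimes> (x [^] m) = q ^ (n * m) \<odot> ((x [^] m) \<otimes> (y [^] n))" for m n :: nat
  proof (induction n)
    case (Suc n)
    have "(y [^] Suc n) \<otimes> (x [^] m) = (y [^] n) \<otimes> (y \<otimes> (x [^] m))"
      by (simp add: m_assoc)
    also have "\<dots> = q ^ m \<odot> (((y [^] n) \<otimes> (x [^] m)) \<otimes> y)"
      unfolding y_xm by (simp add: m_assoc smult_mult_right)
    also have "\<dots> = q ^ (Suc n * m) \<odot> ((x [^] m) \<otimes> (y [^] Suc n))"
      unfolding Suc by (simp add: m_assoc smult_mult_left power_add)
    finally show ?case .
  qed simp
  have "((x [^] m) \<otimes> (y [^] n)) \<otimes> ((x [^] m') \<otimes> (y [^] n'))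
      = (x [^] m) \<otimes> ((y [^] n) \<otimes> (x [^] m')) \<otimes> (y [^] n')"
    by (simp add: m_assoc)
  also have "\<dots> = q ^ (n * m') \<odot> (((x [^] m) \<otimes> (x [^] m')) \<otimes> ((y [^] n) \<otimes> (y [^] n')))"
    unfolding yn_xm by (simp add: m_assoc smult_mult_left smult_mult_right)
  finally show ?thesis
    by (simp add: nat_pow_mult)
qed

lemma from_coords_single [simp]:
  "from_coords q (single (m, n) c)
   = c \<odot>\<^bsub>qplane q\<^esub> ((qx q [^]\<^bsub>qplane q\<^esub> m) \<otimes>\<^bsub>qplane q\<^esub> (qy q [^]\<^bsub>qplane q\<^esub> n))"
  unfolding from_coords_def by (subst calg.lext_single[OF calg_qplane]) auto

lemma monomial_funcset:
  "(\<lambda>(m::nat, n::nat). (qx q [^]\<^bsub>qplane q\<^esub> m) \<otimes>\<^bsub>qplane q\<^esub> (qy q [^]\<^bsub>qplane q\<^esub> n)) \<in> UNIV \<rightarrow> carrier (qplane q)"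
  by auto

lemma from_coords_hom: "from_coords q \<in> alg_hom (qalg q) (qplane q)"
proof (rule alg_homI)
  interpret calg "qplane q" by (rule calg_qplane)
  fix p r :: qpoly and c
  show "from_coords q p \<in> carrier (qplane q)"
    unfolding from_coords_def by (rule lext_closed[OF subset_UNIV monomial_funcset])
  show "from_coords q (p \<oplus>\<^bsub>qalg q\<^esub> r) = from_coords q p \<oplus>\<^bsub>qplane q\<^esub> from_coords q r"
    by (simp add: from_coords_def lext_add[OF subset_UNIV subset_UNIV monomial_funcset])
  show "from_coords q (c \<odot>\<^bsub>qalg q\<^esub> p) = c \<odot>\<^bsub>qplane q\<^esub> from_coords q p"
    by (simp add: from_coords_def lext_scale[OF subset_UNIV monomial_funcset])
  show "from_coords q \<one>\<^bsub>qalg q\<^esub> = \<one>\<^bsub>qplane q\<^esub>"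
    by simp
  show "from_coords q (p \<otimes>\<^bsub>qalg q\<^esub> r) = from_coords q p \<otimes>\<^bsub>qplane q\<^esub> from_coords q r"
    unfolding from_coords_def qalg_simps qmul_def
  proof (rule lext_tmult[OF subset_UNIV subset_UNIV monomial_funcset UNIV_I], clarify)
    show "q ^ (n * m') \<odot>\<^bsub>qplane q\<^esub>
        ((qx q [^]\<^bsub>qplane q\<^esub> (m + m')) \<otimes>\<^bsub>qplane q\<^esub> (qy q [^]\<^bsub>qplane q\<^esub> (n + n')))
        = ((qx q [^]\<^bsub>qplane q\<^esub> m) \<otimes>\<^bsub>qplane q\<^esub> (qy q [^]\<^bsub>qplane q\<^esub> n))
          \<otimes>\<^bsub>qplane q\<^esub> ((qx q [^]\<^bsub>qplane q\<^esub> m') \<otimes>\<^bsub>qplane q\<^esub> (qy q [^]\<^bsub>qplane q\<^esub> n'))" for m n m' n' :: nat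
      by (rule monomials_mult_if_q_commute[symmetric]) (simp_all add: qplane_relation)
  qed
qed simp

lemmas coords_simps = alg_hom_memD[OF coords_hom, simplified]
lemmas from_coords_simps = alg_hom_memD[OF from_coords_hom, simplified]

lemma from_coords_closed [simp]: "from_coords q p \<in> carrier (qplane q)"
  by (rule from_coords_simps)

lemma coords_zero [simp]: "coords q \<zero>\<^bsub>qplane q\<^esub> = 0"
  using alg_hom_zero[OF calg_qplane calg_qalg coords_hom] by simp

lemma from_coords_zero [simp]: "from_coords q 0 = \<zero>\<^bsub>qplane q\<^esub>"
  using alg_hom_zero[OF calg_qalg calg_qplane from_coords_hom] by simp

lemma coords_from_coords [simp]: "coords q (from_coords q p) = p"
proof (induction p rule: poly_mapping_lin_induct)
  case (single u c)
  interpret calg "qplane q" by (rule calg_qplane)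
  have x: "coords q (qx q [^]\<^bsub>qplane q\<^esub> m) = mon m 0" for m :: nat
    by (induction m) (simp_all add: coords_simps)
  have y: "coords q (qy q [^]\<^bsub>qplane q\<^esub> n) = mon 0 n" for n :: nat
    by (induction n) (simp_all add: coords_simps)
  show ?case
    by (cases u) (simp add: coords_simps x y)
qed (simp_all add: coords_simps from_coords_simps)

text \<open>
  The composition is an algebra homomorphism that fixes both generators.
\<close>

lemma from_coords_coords [simp]:
  assumes "a \<in> carrier (qplane q)"
  shows "from_coords q (coords q a) = a"
proof -
  interpret calg "qplane q" by (rule calg_qplane)
  have "compose (carrier (qplane q)) (from_coords q) (coords q) = (\<lambda>a\<in>carrier (qplane q). a)"
  proof (rule qplane_hom_eqI)
    show "compose (carrier (qplane q)) (from_coords q) (coords q) \<in> alg_hom (qplane q) (qplane q)"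
      by (rule alg_hom_compose[OF coords_hom from_coords_hom calg_qplane])
  qed (simp_all add: alg_hom_id compose_eq)
  from fun_cong[OF this, of a] show ?thesis
    using assms by (simp add: compose_eq)
qed

lemma from_coords_gens [simp]: "from_coords q (mon 1 0) = qx q" "from_coords q (mon 0 1) = qy q"
  "from_coords q (mon (Suc 0) 0) = qx q" "from_coords q (mon 0 (Suc 0)) = qy q"
  using from_coords_coords[of "qx q" q] from_coords_coords[of "qy q" q] by simp_all

subsection \<open>Homogeneous components\<close>

text \<open>
  The freedom in \<open>S\<close> covers the homogeneous components, which are spanned by monomials, as well as
  the span of a union of components.
\<close>

lemma lin_span_qplane:
  assumes "(\<lambda>(m, n). from_coords q (mon m n)) ` D \<subseteq> S" and "S \<subseteq> from_coords q ` {p. keys p \<subseteq> D}"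
  shows "lin_span (qplane q) S = from_coords q ` {p. keys p \<subseteq> D}"
proof
  interpret calg "qplane q" by (rule calg_qplane)
  have "(\<Oplus>\<^bsub>qplane q\<^esub>v\<in>T. c v \<odot>\<^bsub>qplane q\<^esub> v) \<in> from_coords q ` {p. keys p \<subseteq> D}"
    if "finite T" "T \<subseteq> S" for c T
    using that
  proof (induction T rule: finite_induct)
    case empty
    have "from_coords q 0 \<in> from_coords q ` {p. keys p \<subseteq> D}"
      by (rule imageI) simp
    then show ?case
      by simp
  next
    case (insert v T)
    obtain p where p: "keys p \<subseteq> D" "v = from_coords q p"
      using insert.prems assms(2) by auto
    obtain r where r: "keys r \<subseteq> D" "(\<Oplus>\<^bsub>qplane q\<^esub>v\<in>T. c v \<odot>\<^bsub>qplane q\<^esub> v) = from_coords q r"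
      using insert by auto
    have "T \<subseteq> carrier (qplane q)"
      using insert.prems assms(2) by auto
    then have "(\<Oplus>\<^bsub>qplane q\<^esub>v\<in>insert v T. c v \<odot>\<^bsub>qplane q\<^esub> v)
        = c v \<odot>\<^bsub>qplane q\<^esub> v \<oplus>\<^bsub>qplane q\<^esub> (\<Oplus>\<^bsub>qplane q\<^esub>v\<in>T. c v \<odot>\<^bsub>qplane q\<^esub> v)"
      using insert.hyps p by (intro finsum_insert) auto
    also have "\<dots> = from_coords q (c v *\<^sub>p p + r)"
      unfolding r(2) by (simp add: from_coords_simps p)
    also have "\<dots> \<in> from_coords q ` {p. keys p \<subseteq> D}"
      using p(1) r(1) keys_pscale[of "c v" p] Poly_Mapping.keys_add[of "c v *\<^sub>p p" r]
      by (intro imageI CollectI) blast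
    finally show ?case .
  qed
  then show "lin_span (qplane q) S \<subseteq> from_coords q ` {p. keys p \<subseteq> D}"
    by (auto simp: lin_span_def)
  show "from_coords q ` {p. keys p \<subseteq> D} \<subseteq> lin_span (qplane q) S"
  proof clarify
    fix p :: qpoly
    assume p: "keys p \<subseteq> D"
    define b where "b = (\<lambda>(m::nat, n::nat). (qx q [^]\<^bsub>qplane q\<^esub> m) \<otimes>\<^bsub>qplane q\<^esub> (qy q [^]\<^bsub>qplane q\<^esub> n))"
    have b: "b u = from_coords q (single u 1)" for u
      by (cases u) (simp add: b_def)
    have inv: "coords q (b u) = single u 1" for u
      by (simp add: b)
    have inj: "inj b"
      by (metis inv injI keys_single singleton_inject zero_neq_one)
    define c where "c = (\<lambda>v. lookup p (the_inv b v))"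
    have "from_coords q p = (\<Oplus>\<^bsub>qplane q\<^esub>u\<in>keys p. c (b u) \<odot>\<^bsub>qplane q\<^esub> b u)"
      by (simp add: from_coords_def lext_def b_def[symmetric] c_def the_inv_f_f[OF inj])
    also have "\<dots> = (\<Oplus>\<^bsub>qplane q\<^esub>v\<in>b ` keys p. c v \<odot>\<^bsub>qplane q\<^esub> v)"
      using inj by (intro finsum_reindex[symmetric]) (auto simp: b inj_on_def)
    finally have "from_coords q p = (\<Oplus>\<^bsub>qplane q\<^esub>v\<in>b ` keys p. c v \<odot>\<^bsub>qplane q\<^esub> v)" .
    moreover have "b ` keys p \<subseteq> S"
    proof
      fix v
      assume "v \<in> b ` keys p"
      then obtain m n where "(m, n) \<in> D" "v = from_coords q (mon m n)"
        using p by (auto simp: b simp del: from_coords_single)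
      then show "v \<in> S"
        using assms(1) by blast
    qed
    ultimately show "from_coords q p \<in> lin_span (qplane q) S"
      unfolding lin_span_def
      by (intro CollectI exI[of _ c] exI[of _ "b ` keys p"] conjI) (assumption | simp)+
  qed
qed

lemma qcomp_eq: "qcomp q i = from_coords q ` {p. keys p \<subseteq> {(m, n). m + n = i}}"
proof -
  interpret calg "qplane q" by (rule calg_qplane)
  have mon: "(qx q [^]\<^bsub>qplane q\<^esub> m) \<otimes>\<^bsub>qplane q\<^esub> (qy q [^]\<^bsub>qplane q\<^esub> n) = from_coords q (mon m n)" for m n :: nat
    by simp
  show ?thesis
    unfolding qcomp_def mon by (rule lin_span_qplane) (auto simp del: from_coords_single)
qed

text \<open>
  Since the monomials form a basis, only the part of degree \<open>i\<close> meets the description of the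
  projection.
\<close>

lemma qproj_eq_zero_iff:
  assumes a: "a \<in> carrier (qplane q)"
  shows "qproj q i a = \<zero>\<^bsub>qplane q\<^esub> \<longleftrightarrow> (\<forall>m n. m + n = i \<longrightarrow> lookup (coords q a) (m, n) = 0)"
proof -
  interpret calg "qplane q" by (rule calg_qplane)
  define part where "part = Poly_Mapping.mapp (\<lambda>(m, n) c. if m + n = i then c else 0) (coords q a)"
  have part: "lookup part (m, n) = (if m + n = i then lookup (coords q a) (m, n) else 0)" for m n
    by (auto simp: part_def lookup_mapp when_def in_keys_iff)
  have span: "lin_span (qplane q) (\<Union>j\<in>{j. j \<noteq> i}. qcomp q j) = from_coords q ` {p. keys p \<subseteq> {(m, n). m + n \<noteq> i}}"
  proof (rule lin_span_qplane)
    show "(\<lambda>(m, n). from_coords q (mon m n)) ` {(m, n). m + n \<noteq> i} \<subseteq> (\<Union>j\<in>{j. j \<noteq> i}. qcomp q j)"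
      unfolding qcomp_eq by (auto simp del: from_coords_single intro!: imageI)
    show "(\<Union>j\<in>{j. j \<noteq> i}. qcomp q j) \<subseteq> from_coords q ` {p. keys p \<subseteq> {(m, n). m + n \<noteq> i}}"
      unfolding qcomp_eq by fastforce
  qed
  have diff: "a \<ominus>\<^bsub>qplane q\<^esub> from_coords q r = from_coords q (coords q a - r)" for r
    using lext_diff[OF subset_UNIV subset_UNIV monomial_funcset, of "coords q a" r] a
    by (simp add: from_coords_def[symmetric])
  have "qproj q i a = from_coords q part"
    unfolding qproj_def span qcomp_eq
  proof (rule the_equality)
    have "keys part \<subseteq> {(m, n). m + n = i}" "keys (coords q a - part) \<subseteq> {(m, n). m + n \<noteq> i}"
      by (auto simp: in_keys_iff part lookup_minus split: if_splits)
    then show "from_coords q part \<in> from_coords q ` {p. keys p \<subseteq> {(m, n). m + n = i}} \<and>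
        a \<ominus>\<^bsub>qplane q\<^esub> from_coords q part \<in> from_coords q ` {p. keys p \<subseteq> {(m, n). m + n \<noteq> i}}"
      by (simp add: diff)
  next
    fix r
    assume "r \<in> from_coords q ` {p. keys p \<subseteq> {(m, n). m + n = i}} \<and>
        a \<ominus>\<^bsub>qplane q\<^esub> r \<in> from_coords q ` {p. keys p \<subseteq> {(m, n). m + n \<noteq> i}}"
    then obtain p s where p: "r = from_coords q p" "keys p \<subseteq> {(m, n). m + n = i}"
      and s: "from_coords q (coords q a - p) = from_coords q s" "keys s \<subseteq> {(m, n). m + n \<noteq> i}"
      by (auto simp: diff)
    then have eq: "coords q a - p = s"
      by (metis coords_from_coords)
    have "p = part"
    proof (rule poly_mapping_eqI)
      fix u :: "nat \<times> nat"
      obtain m n where u: "u = (m, n)" by fastforce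
      have "lookup (coords q a) u - lookup p u = lookup s u"
        using eq by (metis lookup_minus)
      moreover have "m + n \<noteq> i \<Longrightarrow> lookup p u = 0" "m + n = i \<Longrightarrow> lookup s u = 0"
        using p(2) s(2) u by (auto simp: in_keys_iff subset_iff)
      ultimately show "lookup p u = lookup part u"
        by (auto simp: u part)
    qed
    then show "r = from_coords q part"
      using p by simp
  qed
  also have "from_coords q part = \<zero>\<^bsub>qplane q\<^esub> \<longleftrightarrow> part = 0"
    by (metis coords_from_coords from_coords_zero)
  also have "\<dots> \<longleftrightarrow> (\<forall>m n. m + n = i \<longrightarrow> lookup (coords q a) (m, n) = 0)"
    by (auto simp: poly_mapping_eq_iff fun_eq_iff part)
  finally show ?thesis .
qed

section \<open>Module algebra structures in terms of generators\<close>

lemma End_alg_simps: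
  "carrier (End_alg A) = lin_end A" "f \<otimes>\<^bsub>End_alg A\<^esub> g = compose (carrier A) f g"
  "\<one>\<^bsub>End_alg A\<^esub> = (\<lambda>a\<in>carrier A. a)"
  "f \<oplus>\<^bsub>End_alg A\<^esub> g = (\<lambda>a\<in>carrier A. f a \<oplus>\<^bsub>A\<^esub> g a)"
  "c \<odot>\<^bsub>End_alg A\<^esub> f = (\<lambda>a\<in>carrier A. c \<odot>\<^bsub>A\<^esub> f a)"
  by (simp_all add: End_alg_def)

locale uq_action = A: calg A for q and A :: "(complex, 'a) module" (structure) and \<pi> +
  assumes q: "q \<noteq> 0" and hom: "\<pi> \<in> alg_hom (uq_alg q) (End_alg A)"
begin

abbreviation "U \<equiv> uq_alg q"

sublocale U: calg U by (rule calg_uq)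
sublocale tensor U U by (rule uq_tensor)

lemmas homD = alg_hom_memD[OF hom]

lemma lin_endD:
  assumes "h \<in> carrier U" and "a \<in> carrier A"
  shows "\<pi> h a \<in> carrier A"
    and "b \<in> carrier A \<Longrightarrow> \<pi> h (a \<oplus> b) = \<pi> h a \<oplus> \<pi> h b"
    and "\<pi> h (c \<odot> a) = c \<odot> \<pi> h a"
  using homD(2)[OF assms(1)] assms(2) by (auto simp: End_alg_simps lin_end_def)

lemma act_one: "a \<in> carrier A \<Longrightarrow> \<pi> \<one>\<^bsub>U\<^esub> a = a"
  and act_mult: "h \<in> carrier U \<Longrightarrow> g \<in> carrier U \<Longrightarrow> a \<in> carrier A \<Longrightarrow> \<pi> (h \<otimes>\<^bsub>U\<^esub> g) a = \<pi> h (\<pi> g a)"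
  and act_add: "h \<in> carrier U \<Longrightarrow> g \<in> carrier U \<Longrightarrow> a \<in> carrier A \<Longrightarrow> \<pi> (h \<oplus>\<^bsub>U\<^esub> g) a = \<pi> h a \<oplus> \<pi> g a"
  and act_smult: "h \<in> carrier U \<Longrightarrow> a \<in> carrier A \<Longrightarrow> \<pi> (c \<odot>\<^bsub>U\<^esub> h) a = c \<odot> \<pi> h a"
  by (simp_all add: homD End_alg_simps compose_eq)

lemma act_minus:
  assumes "h \<in> carrier U" "g \<in> carrier U" "a \<in> carrier A"
  shows "\<pi> (h \<ominus>\<^bsub>U\<^esub> g) a = \<pi> h a \<ominus> \<pi> g a"
  using assms
  by (simp add: U.minus_eq A.minus_eq U.smult_minus_one[symmetric] A.smult_minus_one[symmetric]
      act_add act_smult lin_endD)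

lemma act_zero_right: "h \<in> carrier U \<Longrightarrow> \<pi> h \<zero> = \<zero>"
  using lin_endD(3)[of h \<zero> 0] lin_endD(1)[of h \<zero>] by simp

definition product_map :: "'a \<Rightarrow> 'a \<Rightarrow> (uq_gen list \<Rightarrow>\<^sub>0 complex) set \<Rightarrow> (uq_gen list \<Rightarrow>\<^sub>0 complex) set \<Rightarrow> 'a" where
  "product_map a b h g = \<pi> h a \<otimes> \<pi> g b"

lemma bilinear_product_map:
  assumes "a \<in> carrier A" "b \<in> carrier A"
  shows "bilinear_map U U A (product_map a b)"
  unfolding bilinear_map_def product_map_def using assms
  by (auto simp: act_add act_smult lin_endD A.l_distr A.r_distr A.smult_mult_left A.smult_mult_right)

abbreviation "act2 a b \<equiv> tensor_lift A (product_map a b)"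

lemma act2_pt:
  assumes "a \<in> carrier A" "b \<in> carrier A" "h \<in> carrier U" "g \<in> carrier U"
  shows "act2 a b (pt h g) = \<pi> h a \<otimes> \<pi> g b"
  using tensor_lift_pt[OF A.calg_axioms bilinear_product_map[OF assms(1,2)] assms(3,4)]
  by (simp add: product_map_def)

lemma act2_mult_pt:
  assumes "a \<in> carrier A" "b \<in> carrier A" "h \<in> carrier U" "g \<in> carrier U" "t \<in> carrier T"
  shows "act2 a b (t \<otimes>\<^bsub>T\<^esub> pt h g) = act2 (\<pi> h a) (\<pi> g b) t"
proof -
  have "act2 a b (t \<otimes>\<^bsub>T\<^esub> pt h g)
      = tensor_lift A (\<lambda>x y. product_map a b (x \<otimes>\<^bsub>U\<^esub> h) (y \<otimes>\<^bsub>U\<^esub> g)) t"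
    using assms by (intro tensor_lift_mult_pt[OF A.calg_axioms bilinear_product_map])
  also have "\<dots> = act2 (\<pi> h a) (\<pi> g b) t"
    using assms
    by (intro tensor_lift_cong[OF A.calg_axioms bilinear_product_map])
      (auto simp: lin_endD product_map_def act_mult)
  finally show ?thesis .
qed

lemmas act2_add = tensor_lift_add[OF A.calg_axioms bilinear_product_map]
lemmas act2_scale = tensor_lift_scale[OF A.calg_axioms bilinear_product_map]

lemmas comult = uq_comult[OF q]
lemmas comult_hom = alg_hom_memD[OF comult(1)]
lemmas counit_hom = alg_hom_memD[OF uq_counit(1)[of q]]

definition twisted_leibniz :: bool where
  "twisted_leibniz \<longleftrightarrow> (\<forall>a\<in>carrier A. \<forall>b\<in>carrier A.
     \<pi> (uk q) (a \<otimes> b) = \<pi> (uk q) a \<otimes> \<pi> (uk q) b \<and>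
     \<pi> (ukinv q) (a \<otimes> b) = \<pi> (ukinv q) a \<otimes> \<pi> (ukinv q) b \<and>
     \<pi> (ue q) (a \<otimes> b) = a \<otimes> \<pi> (ue q) b \<oplus> \<pi> (ue q) a \<otimes> \<pi> (uk q) b \<and>
     \<pi> (uf q) (a \<otimes> b) = \<pi> (uf q) a \<otimes> b \<oplus> \<pi> (ukinv q) a \<otimes> \<pi> (uf q) b) \<and>
   \<pi> (uk q) \<one> = \<one> \<and> \<pi> (ukinv q) \<one> = \<one> \<and> \<pi> (ue q) \<one> = \<zero> \<and> \<pi> (uf q) \<one> = \<zero>"

text \<open>
  The coproduct of each generator is a single pure tensor or the sum of two.
\<close>

lemma twisted_leibniz_if_structure:
  assumes "\<pi> \<in> module_algebra_structures (Uq_sl2 q) A"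
  shows twisted_leibniz
proof -
  have prod: "\<pi> h (a \<otimes> b) = (\<Oplus>i\<in>{..<n}. \<pi> (h' i) a \<otimes> \<pi> (h'' i) b)"
    if "h \<in> carrier U" "a \<in> carrier A" "b \<in> carrier A" "h' \<in> {..<n::nat} \<rightarrow> carrier U" "h'' \<in> {..<n} \<rightarrow> carrier U"
      "uq_comult q h = (\<Oplus>\<^bsub>T\<^esub>i\<in>{..<n}. pt (h' i) (h'' i))" for h a b n h' h''
    using assms that unfolding module_algebra_structures_def Uq_sl2_simps mem_Collect_eq by blast
  have one: "\<pi> h \<one> = uq_counit q h \<odot> \<one>" if "h \<in> carrier U" for h
    using assms that unfolding module_algebra_structures_def Uq_sl2_simps mem_Collect_eq by blast
  have prod1: "\<pi> h (a \<otimes> b) = \<pi> g a \<otimes> \<pi> g' b"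
    if "h \<in> carrier U" "a \<in> carrier A" "b \<in> carrier A" "g \<in> carrier U" "g' \<in> carrier U" "uq_comult q h = pt g g'"
    for h a b g g'
    using prod[of h a b "\<lambda>_. g" 1 "\<lambda>_. g'"] that
    by (simp add: lessThan_Suc T.finsum_insert A.finsum_insert lin_endD)
  have prod2: "\<pi> h (a \<otimes> b) = \<pi> g1 a \<otimes> \<pi> g1' b \<oplus> \<pi> g2 a \<otimes> \<pi> g2' b"
    if "h \<in> carrier U" "a \<in> carrier A" "b \<in> carrier A" "g1 \<in> carrier U" "g1' \<in> carrier U"
      "g2 \<in> carrier U" "g2' \<in> carrier U" "uq_comult q h = pt g1 g1' \<oplus>\<^bsub>T\<^esub> pt g2 g2'"
    for h a b g1 g1' g2 g2'
    using prod[of h a b "\<lambda>i. if i = 0 then g1 else g2" 2 "\<lambda>i. if i = 0 then g1' else g2'"] that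
    by (simp add: numeral_2_eq_2 lessThan_Suc T.finsum_insert A.finsum_insert lin_endD Pi_def T.a_comm A.a_comm)
  show ?thesis
    unfolding twisted_leibniz_def
    using prod1[OF _ _ _ _ _ comult(2)] prod1[OF _ _ _ _ _ comult(3)] prod2[OF _ _ _ _ _ _ _ comult(4)]
      prod2[OF _ _ _ _ _ _ _ comult(5)]
    by (simp add: act_one one uq_counit)
qed

text \<open>
  Conversely, the elements \<open>h\<close> that act on products through their coproduct and on 1 through the counit
  form a linear subspace which is closed under right multiplication by the generators.
\<close>

lemma structure_if_twisted_leibniz:
  assumes twisted_leibniz
  shows "\<pi> \<in> module_algebra_structures (Uq_sl2 q) A"
proof -
  note L = assms[unfolded twisted_leibniz_def]
  have main: "(\<forall>a\<in>carrier A. \<forall>b\<in>carrier A. \<pi> h (a \<otimes> b) = act2 a b (uq_comult q h)) \<and> \<pi> h \<one> = uq_counit q h \<odot> \<one>"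
    if "h \<in> carrier U" for h
    using that
  proof (induction h rule: uq_induct)
    case one
    then show ?case
      using counit_hom(5) by (simp add: comult_hom(5) pt_one act2_pt act_one complex_alg_def)
  next
    case (k X)
    then show ?case
      using L counit_hom(3)[of X "uk q"]
      by (simp add: comult_hom comult act2_mult_pt act_mult lin_endD uq_counit complex_alg_def)
  next
    case (kinv X)
    then show ?case
      using L counit_hom(3)[of X "ukinv q"]
      by (simp add: comult_hom comult act2_mult_pt act_mult lin_endD uq_counit complex_alg_def)
  next
    case (e X)
    then show ?case
      using L counit_hom(3)[of X "ue q"]
      by (simp add: comult_hom comult T.r_distr act2_add act2_mult_pt act_mult act_one lin_endD act_zero_right
          uq_counit complex_alg_def)
  next
    case (f X)
    then show ?case
      using L counit_hom(3)[of X "uf q"]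
      by (simp add: comult_hom comult T.r_distr act2_add act2_mult_pt act_mult act_one lin_endD act_zero_right
          uq_counit complex_alg_def)
  next
    case (add X Y)
    then show ?case
      using counit_hom(4)[of X Y]
      by (simp add: comult_hom act2_add act_add complex_alg_def A.smult_add_left)
  next
    case (scale X c)
    then show ?case
      using counit_hom(6)[of X c]
      by (simp add: comult_hom act2_scale act_smult complex_alg_def)
  qed
  show ?thesis
    unfolding module_algebra_structures_def Uq_sl2_simps mem_Collect_eq
  proof (intro conjI hom ballI allI impI)
    fix h a b n h' h''
    assume h: "h \<in> carrier U" and ab: "a \<in> carrier A" "b \<in> carrier A"
      and *: "h' \<in> {..<n::nat} \<rightarrow> carrier U \<and> h'' \<in> {..<n} \<rightarrow> carrier U \<and>
        uq_comult q h = (\<Oplus>\<^bsub>T\<^esub>i\<in>{..<n}. pt (h' i) (h'' i))"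
    have "\<pi> h (a \<otimes> b) = act2 a b (\<Oplus>\<^bsub>T\<^esub>i\<in>{..<n}. pt (h' i) (h'' i))"
      using main[OF h] ab * by simp
    also have "\<dots> = (\<Oplus>i\<in>{..<n}. product_map a b (h' i) (h'' i))"
      using * by (intro tensor_lift_sum[OF A.calg_axioms bilinear_product_map[OF ab]]) auto
    finally show "\<pi> h (a \<otimes> b) = (\<Oplus>i\<in>{..<n}. \<pi> (h' i) a \<otimes> \<pi> (h'' i) b)"
      by (simp add: product_map_def)
  qed (use main in blast)
qed

end

section \<open>Structures on the quantum plane as quadruples of operators\<close>

definition linear_op :: "(qpoly \<Rightarrow> qpoly) \<Rightarrow> bool" where
  "linear_op S \<longleftrightarrow> (\<forall>p r. S (p + r) = S p + S r) \<and> (\<forall>c p. S (c *\<^sub>p p) = c *\<^sub>p S p)"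

lemma linear_opD:
  assumes "linear_op S"
  shows "S (p + r) = S p + S r" "S (c *\<^sub>p p) = c *\<^sub>p S p" "S 0 = 0"
  using assms pscale_zero(2)[of 0] by (auto simp: linear_op_def) (metis pscale_zero(2))

text \<open>
  The conditions on the operators of \<open>uk q\<close>, \<open>ukinv q\<close>, \<open>ue q\<close>, \<open>uf q\<close> that define a structure. The product
  rule of \<open>K'\<close> and the values of all four operators at 1 are consequences.
\<close>

definition uq_operators ::
  "complex \<Rightarrow> (qpoly \<Rightarrow> qpoly) \<Rightarrow> (qpoly \<Rightarrow> qpoly) \<Rightarrow> (qpoly \<Rightarrow> qpoly) \<Rightarrow> (qpoly \<Rightarrow> qpoly) \<Rightarrow> bool" where
  "uq_operators q K K' E F \<longleftrightarrow>
     linear_op K \<and> linear_op K' \<and> linear_op E \<and> linear_op F \<and>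
     (\<forall>p. K (K' p) = p \<and> K' (K p) = p) \<and>
     (\<forall>p. K (E p) = (q powi 2) *\<^sub>p E (K p)) \<and> (\<forall>p. K (F p) = (q powi (-2)) *\<^sub>p F (K p)) \<and>
     (\<forall>p. E (F p) - F (E p) = (1 / (q - inverse q)) *\<^sub>p (K p - K' p)) \<and>
     (\<forall>p r. K (qmul q p r) = qmul q (K p) (K r)) \<and>
     (\<forall>p r. E (qmul q p r) = qmul q p (E r) + qmul q (E p) (K r)) \<and>
     (\<forall>p r. F (qmul q p r) = qmul q (F p) r + qmul q (K' p) (F r))"

definition coord_op ::
  "complex \<Rightarrow> ((qp_gen list \<Rightarrow>\<^sub>0 complex) set \<Rightarrow> (qp_gen list \<Rightarrow>\<^sub>0 complex) set) \<Rightarrow> qpoly \<Rightarrow> qpoly" where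
  "coord_op q S p = coords q (S (from_coords q p))"

lemma coords_minus:
  assumes "a \<in> carrier (qplane q)" "b \<in> carrier (qplane q)"
  shows "coords q (a \<ominus>\<^bsub>qplane q\<^esub> b) = coords q a - coords q b"
proof -
  interpret calg "qplane q" by (rule calg_qplane)
  have "(- 1) *\<^sub>p p = - p" for p :: qpoly
    by (rule poly_mapping_eqI) simp
  then show ?thesis
    using assms by (simp add: minus_eq smult_minus_one[symmetric] coords_simps)
qed

lemma uq_operators_of_structure:
  assumes q: "q \<noteq> 0" and \<pi>: "\<pi> \<in> qplane_structures q"
  shows "uq_operators q (coord_op q (\<pi> (uk q))) (coord_op q (\<pi> (ukinv q)))
    (coord_op q (\<pi> (ue q))) (coord_op q (\<pi> (uf q)))"
proof -
  let ?A = "qplane q"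
  have "\<pi> \<in> alg_hom (uq_alg q) (End_alg ?A)"
    using \<pi> by (simp add: qplane_structures_def module_algebra_structures_def Uq_sl2_simps)
  then interpret uq_action q ?A \<pi>
    by (intro uq_action.intro uq_action_axioms.intro calg_qplane q)
  have L: twisted_leibniz
    using \<pi> by (intro twisted_leibniz_if_structure) (simp add: qplane_structures_def)
  note L = L[unfolded twisted_leibniz_def]
  note rel = uq_alg_relations[of q, unfolded uq_relations_def]
  have [simp]: "\<pi> h (from_coords q p) \<in> carrier ?A" if "h \<in> carrier U" for h p
    using that by (simp add: lin_endD)
  have lin: "linear_op (coord_op q (\<pi> h))" if "h \<in> carrier U" for h
    using that unfolding linear_op_def coord_op_def by (simp add: from_coords_simps lin_endD coords_simps)
  have comp: "coord_op q (\<pi> h) (coord_op q (\<pi> g) p) = coord_op q (\<pi> (h \<otimes>\<^bsub>U\<^esub> g)) p"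
    if "h \<in> carrier U" "g \<in> carrier U" for h g p
    using that by (simp add: coord_op_def act_mult)
  have scale: "coord_op q (\<pi> (c \<odot>\<^bsub>U\<^esub> h)) p = c *\<^sub>p coord_op q (\<pi> h) p" if "h \<in> carrier U" for c h p
    using that by (simp add: coord_op_def act_smult coords_simps)
  have minus: "coord_op q (\<pi> (h \<ominus>\<^bsub>U\<^esub> g)) p = coord_op q (\<pi> h) p - coord_op q (\<pi> g) p"
    if "h \<in> carrier U" "g \<in> carrier U" for h g p
    using that by (simp add: coord_op_def act_minus coords_minus)
  have one: "coord_op q (\<pi> \<one>\<^bsub>U\<^esub>) p = p" for p
    by (simp add: coord_op_def act_one)
  let ?K = "coord_op q (\<pi> (uk q))" and ?K' = "coord_op q (\<pi> (ukinv q))"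
  let ?E = "coord_op q (\<pi> (ue q))" and ?F = "coord_op q (\<pi> (uf q))"
  show ?thesis
    unfolding uq_operators_def
  proof (intro conjI allI lin uq_gens_closed)
    fix p r
    let ?d = "1 / (q - inverse q)"
    show "?K (?K' p) = p" "?K' (?K p) = p"
      using rel by (simp_all add: comp one)
    show "?K (?E p) = (q powi 2) *\<^sub>p ?E (?K p)" "?K (?F p) = (q powi (-2)) *\<^sub>p ?F (?K p)"
      using rel by (simp_all add: comp scale[symmetric])
    have "?E (?F p) - ?F (?E p) = coord_op q (\<pi> (ue q \<otimes>\<^bsub>U\<^esub> uf q \<ominus>\<^bsub>U\<^esub> uf q \<otimes>\<^bsub>U\<^esub> ue q)) p"
      by (simp add: comp minus)
    also have "\<dots> = coord_op q (\<pi> (?d \<odot>\<^bsub>U\<^esub> uk q \<ominus>\<^bsub>U\<^esub> ?d \<odot>\<^bsub>U\<^esub> ukinv q)) p"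
      using rel by simp
    also have "\<dots> = ?d *\<^sub>p (?K p - ?K' p)"
      by (simp add: minus scale pscale_diff_right)
    finally show "?E (?F p) - ?F (?E p) = ?d *\<^sub>p (?K p - ?K' p)" .
    show "?K (qmul q p r) = qmul q (?K p) (?K r)"
      "?E (qmul q p r) = qmul q p (?E r) + qmul q (?E p) (?K r)"
      "?F (qmul q p r) = qmul q (?F p) r + qmul q (?K' p) (?F r)"
      using L by (simp_all add: coord_op_def from_coords_simps coords_simps)
  qed
qed

lemma structure_determined_by_operators:
  assumes q: "q \<noteq> 0" and "\<pi> \<in> qplane_structures q" "\<rho> \<in> qplane_structures q"
    and "coord_op q (\<pi> (uk q)) = coord_op q (\<rho> (uk q))"
    and "coord_op q (\<pi> (ue q)) = coord_op q (\<rho> (ue q))"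
    and "coord_op q (\<pi> (uf q)) = coord_op q (\<rho> (uf q))"
  shows "\<pi> = \<rho>"
proof -
  have hom: "\<pi> \<in> alg_hom (uq_alg q) (End_alg (qplane q))" "\<rho> \<in> alg_hom (uq_alg q) (End_alg (qplane q))"
    using assms(2,3) by (simp_all add: qplane_structures_def module_algebra_structures_def Uq_sl2_simps)
  have eq: "\<pi> h = \<rho> h" if h: "h \<in> carrier (uq_alg q)" and "coord_op q (\<pi> h) = coord_op q (\<rho> h)" for h
  proof (rule extensionalityI)
    have lin_end: "\<pi> h \<in> lin_end (qplane q)" "\<rho> h \<in> lin_end (qplane q)"
      using alg_hom_memD(2)[OF hom(1) h] alg_hom_memD(2)[OF hom(2) h] by (simp_all add: End_alg_simps)
    then show "\<pi> h \<in> extensional (carrier (qplane q))" "\<rho> h \<in> extensional (carrier (qplane q))"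
      by (auto simp: lin_end_def PiE_def)
    fix a
    assume a: "a \<in> carrier (qplane q)"
    have "coords q (\<pi> h a) = coords q (\<rho> h a)"
      using fun_cong[OF that(2), of "coords q a"] a by (simp add: coord_op_def)
    moreover have "\<pi> h a \<in> carrier (qplane q)" "\<rho> h a \<in> carrier (qplane q)"
      using lin_end a by (auto simp: lin_end_def)
    ultimately show "\<pi> h a = \<rho> h a"
      by (metis from_coords_coords)
  qed
  show ?thesis
    by (rule uq_hom_eqI[OF calg_End_alg[OF calg_qplane] hom]) (use assms(4-6) eq in simp_all)
qed

text \<open>
  The inverse of \<open>coord_op\<close>, extensional because the elements of \<open>End_alg\<close> are.
\<close>

definition lift_op ::
  "complex \<Rightarrow> (qpoly \<Rightarrow> qpoly) \<Rightarrow> (qp_gen list \<Rightarrow>\<^sub>0 complex) set \<Rightarrow> (qp_gen list \<Rightarrow>\<^sub>0 complex) set" where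
  "lift_op q S = (\<lambda>a\<in>carrier (qplane q). from_coords q (S (coords q a)))"

lemma lift_op_simps:
  shows "linear_op S \<Longrightarrow> lift_op q S \<in> carrier (End_alg (qplane q))"
    and "lift_op q S \<otimes>\<^bsub>End_alg (qplane q)\<^esub> lift_op q S' = lift_op q (\<lambda>p. S (S' p))"
    and "lift_op q S \<oplus>\<^bsub>End_alg (qplane q)\<^esub> lift_op q S' = lift_op q (\<lambda>p. S p + S' p)"
    and "c \<odot>\<^bsub>End_alg (qplane q)\<^esub> lift_op q S = lift_op q (\<lambda>p. c *\<^sub>p S p)"
    and "\<one>\<^bsub>End_alg (qplane q)\<^esub> = lift_op q (\<lambda>p. p)"
proof -
  interpret calg "qplane q" by (rule calg_qplane)
  show "linear_op S \<Longrightarrow> lift_op q S \<in> carrier (End_alg (qplane q))"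
    by (auto simp: End_alg_simps lin_end_def lift_op_def linear_op_def coords_simps from_coords_simps)
qed (auto simp: End_alg_simps lift_op_def compose_def from_coords_simps coords_simps fun_eq_iff)

lemma linear_op_intros:
  "linear_op S \<Longrightarrow> linear_op S' \<Longrightarrow> linear_op (\<lambda>p. S (S' p))"
  "linear_op S \<Longrightarrow> linear_op (\<lambda>p. c *\<^sub>p S p)"
  by (simp_all add: linear_op_def pscale_add_right mult.commute)

lemma lift_op_minus:
  assumes "linear_op S" "linear_op S'"
  shows "lift_op q S \<ominus>\<^bsub>End_alg (qplane q)\<^esub> lift_op q S' = lift_op q (\<lambda>p. S p - S' p)"
proof -
  interpret E: calg "End_alg (qplane q)" by (rule calg_End_alg[OF calg_qplane])
  have "p + (- 1) *\<^sub>p r = p - r" for p r :: qpoly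
    by (rule poly_mapping_eqI) (simp add: lookup_add lookup_minus)
  moreover have "\<ominus>\<^bsub>End_alg (qplane q)\<^esub> lift_op q S' = lift_op q (\<lambda>p. (- 1) *\<^sub>p S' p)"
    using E.smult_minus_one[OF lift_op_simps(1)[OF assms(2)]] by (simp only: lift_op_simps(4))
  ultimately show ?thesis
    by (simp only: E.minus_eq lift_op_simps(3))
qed

lemma coord_op_lift_op [simp]: "coord_op q (lift_op q S) = S"
  by (simp add: coord_op_def lift_op_def fun_eq_iff)

lemma structure_of_uq_operators:
  assumes q: "q \<noteq> 0" and ops: "uq_operators q K K' E F"
  obtains \<pi> where "\<pi> \<in> qplane_structures q" "coord_op q (\<pi> (uk q)) = K"
    "coord_op q (\<pi> (ue q)) = E" "coord_op q (\<pi> (uf q)) = F"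
proof -
  let ?A = "qplane q"
  note ops = ops[unfolded uq_operators_def]
  have lin: "linear_op K" "linear_op K'" "linear_op E" "linear_op F"
    using ops by auto
  have EndA: "calg (End_alg ?A)"
    by (rule calg_End_alg[OF calg_qplane])
  have "uq_relations q (End_alg ?A) (lift_op q K) (lift_op q K') (lift_op q E) (lift_op q F)"
    using ops unfolding uq_relations_def
    by (simp add: lift_op_simps lift_op_minus linear_op_intros lin pscale_diff_right)
  then obtain \<pi> where hom: "\<pi> \<in> alg_hom (uq_alg q) (End_alg ?A)" and
    \<pi>: "\<pi> (uk q) = lift_op q K" "\<pi> (ukinv q) = lift_op q K'" "\<pi> (ue q) = lift_op q E" "\<pi> (uf q) = lift_op q F"
    by (rule uq_lift[OF EndA, rotated 4]) (use lin in \<open>auto simp: lift_op_simps(1)\<close>)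
  interpret uq_action q ?A \<pi>
    by (intro uq_action.intro uq_action_axioms.intro calg_qplane q hom)
  have K_surj: "\<exists>r. K r = p" for p
    using ops by metis
  have K1: "K (mon 0 0) = mon 0 0"
    using ops K_surj by (metis qmul_one)
  have K'mult: "K' (qmul q p r) = qmul q (K' p) (K' r)" for p r
    using ops by metis
  have "E (mon 0 0) = E (mon 0 0) + E (mon 0 0)"
    using ops K1 by (metis qmul_one)
  moreover have "F (mon 0 0) = F (mon 0 0) + F (mon 0 0)"
    using ops K1 by (metis qmul_one)
  ultimately have EF1: "E (mon 0 0) = 0" "F (mon 0 0) = 0"
    by auto
  have K'1: "K' (mon 0 0) = mon 0 0"
    using ops K1 by metis
  have twisted_leibniz
    unfolding twisted_leibniz_def \<pi> lift_op_def
    using ops K1 K'1 EF1 K'mult A.m_closed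
    by (auto simp: coords_simps from_coords_simps)
  then have "\<pi> \<in> qplane_structures q"
    unfolding qplane_structures_def by (rule structure_if_twisted_leibniz)
  then show ?thesis
    using that \<pi> by simp
qed

section \<open>Skew derivations of the quantum plane\<close>

definition qext :: "(nat \<times> nat \<Rightarrow> qpoly) \<Rightarrow> qpoly \<Rightarrow> qpoly" where
  "qext g = lext (qalg 1) g"

lemma linear_qext: "linear_op (qext g)"
  using calg.lext_add[OF calg_qalg subset_UNIV subset_UNIV, of g] calg.lext_scale[OF calg_qalg subset_UNIV, of g]
  unfolding linear_op_def qext_def by simp

lemma qext_single [simp]: "qext g (single u c) = c *\<^sub>p g u"
  unfolding qext_def by (subst calg.lext_single[OF calg_qalg]) simp_all

lemma linear_op_eqI:
  assumes "linear_op S" "linear_op S'" and "\<And>m n. S (mon m n) = S' (mon m n)"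
  shows "S = S'"
proof
  fix p
  show "S p = S' p"
  proof (induction p rule: poly_mapping_lin_induct)
    case (single u c)
    have "single u c = c *\<^sub>p mon (fst u) (snd u)"
      by simp
    then show ?case
      using assms by (metis linear_opD(2))
  qed (simp_all add: linear_opD[OF assms(1)] linear_opD[OF assms(2)])
qed

lemma product_rule_from_monomials:
  assumes lin: "linear_op S" "linear_op A" "linear_op B" "linear_op C" "linear_op D"
    and mon: "\<And>m n m' n'. S (qmul q (mon m n) (mon m' n'))
      = qmul q (A (mon m n)) (B (mon m' n')) + qmul q (C (mon m n)) (D (mon m' n'))"
  shows "S (qmul q p r) = qmul q (A p) (B r) + qmul q (C p) (D r)"
proof (induction p rule: poly_mapping_lin_induct)
  case zero
  show ?case
    by (simp add: lin[THEN linear_opD(3)])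
next
  case (single u a)
  show ?case
  proof (induction r rule: poly_mapping_lin_induct)
    case zero
    show ?case
      by (simp add: lin[THEN linear_opD(3)])
  next
    case (single v b)
    have *: "single u a = a *\<^sub>p mon (fst u) (snd u)" "single v b = b *\<^sub>p mon (fst v) (snd v)"
      by simp_all
    show ?case
      unfolding * lin[THEN linear_opD(2)] qmul_scale_left qmul_scale_right mon pscale_add_right ..
  next
    case (add r r')
    then show ?case
      by (simp add: qmul_add_right lin[THEN linear_opD(1)])
  qed
next
  case (add p p')
  then show ?case
    by (simp add: qmul_add_left lin[THEN linear_opD(1)])
qed

text \<open>
  The two product rules correspond to the coproducts of \<open>ue q\<close> and \<open>uf q\<close>.
\<close>

definition e_derivation :: "complex \<Rightarrow> (qpoly \<Rightarrow> qpoly) \<Rightarrow> (qpoly \<Rightarrow> qpoly) \<Rightarrow> bool" where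
  "e_derivation q K E \<longleftrightarrow> linear_op E \<and> (\<forall>p r. E (qmul q p r) = qmul q p (E r) + qmul q (E p) (K r))"

definition f_derivation :: "complex \<Rightarrow> (qpoly \<Rightarrow> qpoly) \<Rightarrow> (qpoly \<Rightarrow> qpoly) \<Rightarrow> bool" where
  "f_derivation q K' F \<longleftrightarrow> linear_op F \<and> (\<forall>p r. F (qmul q p r) = qmul q (F p) r + qmul q (K' p) (F r))"

lemma linear_op_sum:
  assumes "\<And>i. linear_op (S i)"
  shows "linear_op (\<lambda>p. \<Sum>i\<in>I. c i *\<^sub>p S i p)"
proof -
  have "a *\<^sub>p (\<Sum>i\<in>I. f i) = (\<Sum>i\<in>I. a *\<^sub>p f i)" for a and f :: "'a \<Rightarrow> qpoly"
    by (induction I rule: infinite_finite_induct) (simp_all add: pscale_add_right)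
  then show ?thesis
    by (simp add: linear_op_def linear_opD[OF assms] pscale_add_right sum.distrib mult.commute)
qed

lemma qmul_sum:
  "qmul q (\<Sum>i\<in>I. f i) r = (\<Sum>i\<in>I. qmul q (f i) r)" "qmul q p (\<Sum>i\<in>I. f i) = (\<Sum>i\<in>I. qmul q p (f i))"
  by (induction I rule: infinite_finite_induct) (simp_all add: qmul_add_left qmul_add_right)

lemma e_derivation_sum:
  assumes "\<And>i. e_derivation q K (E i)"
  shows "e_derivation q K (\<lambda>p. \<Sum>i\<in>I. c i *\<^sub>p E i p)"
  using assms linear_op_sum[where S = E and I = I and c = c] unfolding e_derivation_def
  by (simp add: qmul_sum qmul_scale_left qmul_scale_right pscale_add_right sum.distrib)

lemma f_derivation_sum:
  assumes "\<And>i. f_derivation q K' (F i)"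
  shows "f_derivation q K' (\<lambda>p. \<Sum>i\<in>I. c i *\<^sub>p F i p)"
  using assms linear_op_sum[where S = F and I = I and c = c] unfolding f_derivation_def
  by (simp add: qmul_sum qmul_scale_left qmul_scale_right pscale_add_right sum.distrib)

lemma monomial_induct:
  assumes "P (mon 0 0)" "\<And>p. P p \<Longrightarrow> P (qmul q (mon 1 0) p)" "\<And>p. P p \<Longrightarrow> P (qmul q (mon 0 1) p)"
  shows "P (mon m n)"
proof (induction m)
  case 0
  show ?case
  proof (induction n)
    case (Suc n)
    then show ?case
      using assms(3)[of "mon 0 n"] by simp
  qed (rule assms(1))
next
  case (Suc m)
  then show ?case
    using assms(2)[of "mon m n"] by simp
qed

text \<open>
  The product rule forces the value 0 at 1, and then the values at \<open>x\<close> and \<open>y\<close> determine everything.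
\<close>

lemma e_derivation_eqI:
  assumes E: "e_derivation q K E" and E': "e_derivation q K E'" and K1: "K (mon 0 0) = mon 0 0"
    and "E (mon 1 0) = E' (mon 1 0)" "E (mon 0 1) = E' (mon 0 1)"
  shows "E = E'"
proof (rule linear_op_eqI)
  fix m n
  have "S (mon 0 0) = 0" if "e_derivation q K S" for S
  proof -
    have "S (mon 0 0) = S (mon 0 0) + S (mon 0 0)"
      using that K1 unfolding e_derivation_def by (metis qmul_one)
    then show ?thesis by simp
  qed
  then have one: "E (mon 0 0) = 0" "E' (mon 0 0) = 0"
    using E E' by blast+
  have mult: "E (qmul q p r) = qmul q p (E r) + qmul q (E p) (K r)" "E' (qmul q p r) = qmul q p (E' r) + qmul q (E' p) (K r)" for p r
    using E E' by (simp_all add: e_derivation_def)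
  show "E (mon m n) = E' (mon m n)"
    by (rule monomial_induct[of _ q]) (simp_all only: one mult assms(4,5))
qed (use E E' in \<open>simp_all add: e_derivation_def\<close>)

lemma f_derivation_eqI:
  assumes F: "f_derivation q K' F" and F': "f_derivation q K' F'" and K1: "K' (mon 0 0) = mon 0 0"
    and "F (mon 1 0) = F' (mon 1 0)" "F (mon 0 1) = F' (mon 0 1)"
  shows "F = F'"
proof (rule linear_op_eqI)
  fix m n
  have "S (mon 0 0) = 0" if "f_derivation q K' S" for S
  proof -
    have "S (mon 0 0) = S (mon 0 0) + S (mon 0 0)"
      using that K1 unfolding f_derivation_def by (metis qmul_one)
    then show ?thesis by simp
  qed
  then have one: "F (mon 0 0) = 0" "F' (mon 0 0) = 0"
    using F F' by blast+
  have mult: "F (qmul q p r) = qmul q (F p) r + qmul q (K' p) (F r)" "F' (qmul q p r) = qmul q (F' p) r + qmul q (K' p) (F' r)" for p r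
    using F F' by (simp_all add: f_derivation_def)
  show "F (mon m n) = F' (mon m n)"
    by (rule monomial_induct[of _ q]) (simp_all only: one mult assms(4,5))
qed (use F F' in \<open>simp_all add: f_derivation_def\<close>)

subsection \<open>Homogeneous skew derivations\<close>

definition plane_K :: "complex \<Rightarrow> qpoly \<Rightarrow> qpoly" where
  "plane_K q = qext (\<lambda>(m, n). single (m, n) (q ^ m / q ^ (2 * n)))"

definition plane_K' :: "complex \<Rightarrow> qpoly \<Rightarrow> qpoly" where
  "plane_K' q = qext (\<lambda>(m, n). single (m, n) (q ^ (2 * n) / q ^ m))"

text \<open>
  If \<open>q\<close> is not a root of unity, then \<open>e_hom q r\<close> and \<open>f_hom q t\<close> are up to scalars the only skew
  derivations for \<open>plane_K q\<close> and \<open>plane_K' q\<close> that shift exponents by \<open>(2 r, r - 1)\<close> and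
  \<open>(2 t, t + 1)\<close>: the values at \<open>x\<close> and \<open>y\<close> are linked by \<open>y x = q x y\<close>, and the
  product rule then gives a geometric sum for each monomial. The truncated subtraction \<open>n + r - 1\<close> is
  harmless, since the coefficient vanishes for \<open>n = r = 0\<close>.
\<close>

definition e_hom :: "complex \<Rightarrow> nat \<Rightarrow> qpoly \<Rightarrow> qpoly" where
  "e_hom q r = qext (\<lambda>(m, n). single (m + 2 * r, n + r - 1) (q ^ (2 * r * n) - q ^ (r * m) / q ^ (2 * n)))"

definition f_hom :: "complex \<Rightarrow> nat \<Rightarrow> qpoly \<Rightarrow> qpoly" where
  "f_hom q t = qext (\<lambda>(m, n).
     single (m + 2 * t, n + t + 1) (q ^ ((t + 1) * m) - q ^ ((2 * t + 2) * n) / q ^ m))"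

lemma plane_ops_single [simp]:
  "plane_K q (single (m, n) a) = single (m, n) (a * (q ^ m / q ^ (2 * n)))"
  "plane_K' q (single (m, n) a) = single (m, n) (a * (q ^ (2 * n) / q ^ m))"
  "e_hom q r (single (m, n) a)
    = single (m + 2 * r, n + r - 1) (a * (q ^ (2 * r * n) - q ^ (r * m) / q ^ (2 * n)))"
  "f_hom q t (single (m, n) a)
    = single (m + 2 * t, n + t + 1) (a * (q ^ ((t + 1) * m) - q ^ ((2 * t + 2) * n) / q ^ m))"
  by (simp_all add: plane_K_def plane_K'_def e_hom_def f_hom_def)

lemma linear_plane_ops [simp]:
  "linear_op (plane_K q)" "linear_op (plane_K' q)" "linear_op (e_hom q r)" "linear_op (f_hom q t)"
  by (simp_all add: plane_K_def plane_K'_def e_hom_def f_hom_def linear_qext)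

lemmas plane_ops_linear = linear_plane_ops[THEN linear_opD(1)] linear_plane_ops[THEN linear_opD(2)]
lemmas plane_ops_zero [simp] = linear_plane_ops[THEN linear_opD(3)]

lemma linear_op_id: "linear_op (\<lambda>p. p)" and linear_op_zero: "linear_op (\<lambda>p. 0)"
  by (simp_all add: linear_op_def)

context
  fixes q :: complex
  assumes q: "q \<noteq> 0"
begin

lemma plane_K_mult: "plane_K q (qmul q p r) = qmul q (plane_K q p) (plane_K q r)"
proof -
  have "plane_K q (qmul q p r) = qmul q (plane_K q p) (plane_K q r) + qmul q 0 0"
    by (rule product_rule_from_monomials[where C = "\<lambda>_. 0" and D = "\<lambda>_. 0"])
      (auto simp: linear_op_zero power_add field_simps)
  then show ?thesis by simp
qed

lemma plane_K_inverse: "plane_K q (plane_K' q p) = p" "plane_K' q (plane_K q p) = p"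
proof -
  have "(\<lambda>p. plane_K q (plane_K' q p)) = (\<lambda>p. p)"
    by (rule linear_op_eqI) (use q in \<open>simp_all add: linear_op_intros linear_op_id\<close>)
  moreover have "(\<lambda>p. plane_K' q (plane_K q p)) = (\<lambda>p. p)"
    by (rule linear_op_eqI) (use q in \<open>simp_all add: linear_op_intros linear_op_id\<close>)
  ultimately show "plane_K q (plane_K' q p) = p" "plane_K' q (plane_K q p) = p"
    by meson+
qed

lemma e_derivation_e_hom: "e_derivation q (plane_K q) (e_hom q r)"
  unfolding e_derivation_def
proof (intro conjI allI)
  show "e_hom q r (qmul q p s) = qmul q p (e_hom q r s) + qmul q (e_hom q r p) (plane_K q s)" for p s
  proof (rule product_rule_from_monomials[where A = "\<lambda>p. p" and B = "e_hom q r" and C = "e_hom q r" and D = "plane_K q"])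
    fix m n m' n'
    have eq: "q ^ (n * m') * (q ^ (2 * r * (n + n')) - q ^ (r * (m + m')) / q ^ (2 * (n + n')))
        = q ^ (n * (m' + 2 * r)) * (q ^ (2 * r * n') - q ^ (r * m') / q ^ (2 * n'))
          + q ^ (n * m' + r * m') * ((q ^ (2 * r * n) - q ^ (r * m) / q ^ (2 * n)) / q ^ (2 * n'))"
      using q by (simp add: field_simps) (simp add: power_add[symmetric] algebra_simps)
    show "e_hom q r (qmul q (mon m n) (mon m' n'))
        = qmul q (mon m n) (e_hom q r (mon m' n')) + qmul q (e_hom q r (mon m n)) (plane_K q (mon m' n'))"
    proof (cases "r = 0")
      case False
      then obtain s where r: "r = Suc s"
        by (cases r) auto
      show ?thesis
        using eq by (simp add: r single_add[symmetric] algebra_simps power_add)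
    next
      case True
      show ?thesis
        using eq True by (cases n; cases n') (simp_all add: single_add[symmetric] algebra_simps power_add)
    qed
  qed (simp_all add: linear_op_id)
qed simp

lemma f_derivation_f_hom: "f_derivation q (plane_K' q) (f_hom q t)"
  unfolding f_derivation_def
proof (intro conjI allI)
  show "f_hom q t (qmul q p s) = qmul q (f_hom q t p) s + qmul q (plane_K' q p) (f_hom q t s)" for p s
  proof (rule product_rule_from_monomials[where A = "f_hom q t" and B = "\<lambda>p. p" and C = "plane_K' q" and D = "f_hom q t"])
    fix m n m' n'
    have eq: "q ^ (n * m') * (q ^ ((t + 1) * (m + m')) - q ^ ((2 * t + 2) * (n + n')) / q ^ (m + m'))
        = q ^ ((n + t + 1) * m') * (q ^ ((t + 1) * m) - q ^ ((2 * t + 2) * n) / q ^ m)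
          + q ^ (n * (m' + 2 * t)) * (q ^ (2 * n) / q ^ m * (q ^ ((t + 1) * m') - q ^ ((2 * t + 2) * n') / q ^ m'))"
      using q by (simp add: field_simps) (simp add: power_add[symmetric] algebra_simps)
    then show "f_hom q t (qmul q (mon m n) (mon m' n'))
        = qmul q (f_hom q t (mon m n)) (mon m' n') + qmul q (plane_K' q (mon m n)) (f_hom q t (mon m' n'))"
      by (simp add: single_add[symmetric] add_ac)
  qed (simp_all add: linear_op_id)
qed simp

text \<open>
  The scalars are chosen such that \<open>E y = b\<close> and \<open>F x = inverse b x y\<close>. The product of the two scalars
  is what the commutator relation requires, independently of \<open>b\<close>.
\<close>

lemma uq_operators_family:
  assumes b: "b \<noteq> 0" and q2: "q ^ 2 \<noteq> 1"
  shows "uq_operators q (plane_K q) (plane_K' q)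
    (\<lambda>p. (b / (1 - 1 / q ^ 2)) *\<^sub>p e_hom q 0 p) (\<lambda>p. (inverse b / (q - inverse q)) *\<^sub>p f_hom q 0 p)"
proof -
  define l where "l = b / (1 - 1 / q ^ 2)"
  define u where "u = inverse b / (q - inverse q)"
  have nz: "1 - 1 / q ^ 2 \<noteq> 0" "q - inverse q \<noteq> 0"
    using q q2 by (auto simp: field_simps power2_eq_square)
  have "b / z * (inverse b / w) * z = 1 / w" if "z \<noteq> 0" "w \<noteq> 0" for z w
    using b that by (simp add: field_simps)
  from this[OF nz] have lu: "l * u * (1 - 1 / q ^ 2) = 1 / (q - inverse q)"
    unfolding l_def u_def .
  have zero: "e_hom q 0 (single (m, n) a) = single (m, n - 1) (a * (1 - 1 / q ^ (2 * n)))"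
    "f_hom q 0 (single (m, n) a) = single (m, n + 1) (a * (q ^ m - q ^ (2 * n) / q ^ m))" for m n a
    by (simp_all add: mult_2)
  have KE: "plane_K q (l *\<^sub>p e_hom q 0 p) = (q powi 2) *\<^sub>p (l *\<^sub>p e_hom q 0 (plane_K q p))" for p
  proof -
    have "(\<lambda>p. plane_K q (l *\<^sub>p e_hom q 0 p)) = (\<lambda>p. (q powi 2) *\<^sub>p (l *\<^sub>p e_hom q 0 (plane_K q p)))"
    proof (rule linear_op_eqI)
      show "plane_K q (l *\<^sub>p e_hom q 0 (mon m n)) = (q powi 2) *\<^sub>p (l *\<^sub>p e_hom q 0 (plane_K q (mon m n)))" for m n
      proof (cases n)
        case (Suc k)
        have "l * (1 - 1 / q ^ (2 * n)) * (q ^ m / q ^ (2 * k)) = q ^ 2 * (l * (q ^ m / q ^ (2 * n) * (1 - 1 / q ^ (2 * n))))"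
          using q by (simp add: Suc power2_eq_square)
        then show ?thesis
          using Suc by (simp add: mult_ac)
      qed simp
    qed (simp_all add: linear_op_def plane_ops_linear pscale_add_right mult_ac)
    then show ?thesis by meson
  qed
  have KF: "plane_K q (u *\<^sub>p f_hom q 0 p) = (q powi (-2)) *\<^sub>p (u *\<^sub>p f_hom q 0 (plane_K q p))" for p
  proof -
    have "(\<lambda>p. plane_K q (u *\<^sub>p f_hom q 0 p)) = (\<lambda>p. (q powi (-2)) *\<^sub>p (u *\<^sub>p f_hom q 0 (plane_K q p)))"
    proof (rule linear_op_eqI)
      show "plane_K q (u *\<^sub>p f_hom q 0 (mon m n)) = (q powi (-2)) *\<^sub>p (u *\<^sub>p f_hom q 0 (plane_K q (mon m n)))" for m n
        using q by (simp add: power_int_minus field_simps power2_eq_square)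
    qed (simp_all add: linear_op_def plane_ops_linear pscale_add_right mult_ac)
    then show ?thesis by meson
  qed
  have EF: "l *\<^sub>p e_hom q 0 (u *\<^sub>p f_hom q 0 p) - u *\<^sub>p f_hom q 0 (l *\<^sub>p e_hom q 0 p)
      = (1 / (q - inverse q)) *\<^sub>p (plane_K q p - plane_K' q p)" for p
  proof -
    have "(\<lambda>p. l *\<^sub>p e_hom q 0 (u *\<^sub>p f_hom q 0 p) - u *\<^sub>p f_hom q 0 (l *\<^sub>p e_hom q 0 p))
        = (\<lambda>p. (1 / (q - inverse q)) *\<^sub>p (plane_K q p - plane_K' q p))"
    proof (rule linear_op_eqI)
      fix m n
      have "l * u * ((q ^ m - q ^ (2 * n) / q ^ m) * (1 - 1 / q ^ (2 * n + 2))
          - (1 - 1 / q ^ (2 * n)) * (q ^ m - q ^ (2 * n) / q ^ 2 / q ^ m))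
        = (l * u * (1 - 1 / q ^ 2)) * (q ^ m / q ^ (2 * n) - q ^ (2 * n) / q ^ m)"
        using q by (simp add: field_simps power2_eq_square)
      then have "l * u * ((q ^ m - q ^ (2 * n) / q ^ m) * (1 - 1 / q ^ (2 * n + 2))
          - (1 - 1 / q ^ (2 * n)) * (q ^ m - q ^ (2 * n) / q ^ 2 / q ^ m))
        = 1 / (q - inverse q) * (q ^ m / q ^ (2 * n) - q ^ (2 * n) / q ^ m)"
        unfolding lu .
      moreover have "l *\<^sub>p e_hom q 0 (u *\<^sub>p f_hom q 0 (mon m n))
          = single (m, n) (l * u * ((q ^ m - q ^ (2 * n) / q ^ m) * (1 - 1 / q ^ (2 * n + 2))))"
        by (simp add: zero mult_ac del: plane_ops_single)
      moreover have "u *\<^sub>p f_hom q 0 (l *\<^sub>p e_hom q 0 (mon m n))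
          = single (m, n) (l * u * ((1 - 1 / q ^ (2 * n)) * (q ^ m - q ^ (2 * n) / q ^ 2 / q ^ m)))"
      proof (cases n)
        case (Suc k)
        have "q ^ (2 * n) / q ^ 2 = q ^ (2 * k)"
          using q by (simp add: Suc power2_eq_square)
        then show ?thesis
          by (simp add: zero Suc mult_ac del: plane_ops_single)
      qed (simp add: zero del: plane_ops_single)
      ultimately show "l *\<^sub>p e_hom q 0 (u *\<^sub>p f_hom q 0 (mon m n)) - u *\<^sub>p f_hom q 0 (l *\<^sub>p e_hom q 0 (mon m n))
          = (1 / (q - inverse q)) *\<^sub>p (plane_K q (mon m n) - plane_K' q (mon m n))"
        by (simp only: plane_ops_single pscale_single single_diff[symmetric] right_diff_distrib[symmetric] mult_1)
    qed (simp_all add: linear_op_def plane_ops_linear pscale_add_right pscale_diff_right mult_ac)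
    then show ?thesis by meson
  qed
  have "e_derivation q (plane_K q) (\<lambda>p. l *\<^sub>p e_hom q 0 p)"
    using e_derivation_sum[OF e_derivation_e_hom, where I = "{0}" and c = "\<lambda>_. l"] by simp
  moreover have "f_derivation q (plane_K' q) (\<lambda>p. u *\<^sub>p f_hom q 0 p)"
    using f_derivation_sum[OF f_derivation_f_hom, where I = "{0}" and c = "\<lambda>_. u"] by simp
  ultimately show ?thesis
    unfolding uq_operators_def l_def[symmetric] u_def[symmetric]
    using plane_K_inverse KE KF EF plane_K_mult by (simp add: e_derivation_def f_derivation_def)
qed

end

section \<open>Automorphisms of the quantum plane\<close>

lemma lookup_qmul_single_left:
  "lookup (qmul q (single (a, b) c) p) (m, n)
   = (if a \<le> m \<and> b \<le> n then c * q ^ (b * (m - a)) * lookup p (m - a, n - b) else 0)"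
proof (induction p rule: poly_mapping_lin_induct)
  case (single u d)
  obtain i j where u: "u = (i, j)" by fastforce
  have "(a + i, b + j) = (m, n) \<longleftrightarrow> a \<le> m \<and> b \<le> n \<and> (i, j) = (m - a, n - b)"
    by auto
  then show ?case
    by (auto simp: u lookup_single when_def)
qed (simp_all add: qmul_add_right lookup_add distrib_left)

lemma lookup_qmul_single_right:
  "lookup (qmul q p (single (a, b) c)) (m, n)
   = (if a \<le> m \<and> b \<le> n then c * q ^ ((n - b) * a) * lookup p (m - a, n - b) else 0)"
proof (induction p rule: poly_mapping_lin_induct)
  case (single u d)
  obtain i j where u: "u = (i, j)" by fastforce
  have "(i + a, j + b) = (m, n) \<longleftrightarrow> a \<le> m \<and> b \<le> n \<and> (i, j) = (m - a, n - b)"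
    by auto
  then show ?case
    by (auto simp: u lookup_single when_def)
qed (simp_all add: qmul_add_left lookup_add distrib_left)

lemma linear_op_expand:
  assumes "linear_op S"
  shows "S p = (\<Sum>u\<in>keys p. lookup p u *\<^sub>p S (single u 1))"
proof -
  have p: "p = (\<Sum>u\<in>keys p. lookup p u *\<^sub>p single u 1)"
    by (rule poly_mapping_eqI) (auto simp: lookup_sum lookup_single when_def in_keys_iff sum.delta')
  have "S (\<Sum>u\<in>I. c u *\<^sub>p f u) = (\<Sum>u\<in>I. c u *\<^sub>p S (f u))" for I c and f :: "nat \<times> nat \<Rightarrow> qpoly"
    by (induction I rule: infinite_finite_induct) (simp_all add: linear_opD[OF assms])
  from this[of "lookup p" "\<lambda>u. single u 1" "keys p"] show ?thesis
    using p by simp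
qed

text \<open>
  Lexicographic order with the exponent of \<open>y\<close> first. Any monomial order makes leading exponents
  additive; with this one, leading exponents \<open>(1, 0)\<close> and \<open>(0, 1)\<close> leave only a constant below \<open>x\<close> and
  only powers of \<open>x\<close> below \<open>y\<close>.
\<close>

definition lex_le :: "nat \<times> nat \<Rightarrow> nat \<times> nat \<Rightarrow> bool" where
  "lex_le u v \<longleftrightarrow> snd u < snd v \<or> snd u = snd v \<and> fst u \<le> fst v"

definition lead_exp :: "qpoly \<Rightarrow> nat \<times> nat \<Rightarrow> bool" where
  "lead_exp p u \<longleftrightarrow> u \<in> keys p \<and> (\<forall>v\<in>keys p. lex_le v u)"

lemma lex_le_antisym: "lex_le u v \<Longrightarrow> lex_le v u \<Longrightarrow> u = v"
  by (auto simp: lex_le_def prod_eq_iff)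

lemma lex_le_total: "lex_le u v \<or> lex_le v u"
  and lex_le_trans: "lex_le u v \<Longrightarrow> lex_le v w \<Longrightarrow> lex_le u w"
  by (auto simp: lex_le_def)

lemma lex_max_exists:
  assumes "finite S" "S \<noteq> {}"
  shows "\<exists>u\<in>S. \<forall>v\<in>S. lex_le (h v) (h u)"
  using assms
proof (induction S rule: finite_ne_induct)
  case (singleton u)
  then show ?case
    by (simp add: lex_le_def)
next
  case (insert u S)
  then obtain w where "w \<in> S" "\<forall>v\<in>S. lex_le (h v) (h w)"
    by blast
  then show ?case
    using lex_le_total[of "h u" "h w"] lex_le_total[of "h u" "h u"] lex_le_trans by (metis insert_iff)
qed

lemma lead_exp_mult:
  assumes q: "q \<noteq> 0" and p: "lead_exp p (i, j)" and r: "lead_exp r (k, l)"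
  shows "lead_exp (qmul q p r) (i + k, j + l)"
    and "lookup (qmul q p r) (i + k, j + l) = q ^ (j * k) * (lookup p (i, j) * lookup r (k, l))"
proof -
  have le: "lex_le (m + m', n + n') (i + k, j + l)"
    and eq: "(m + m', n + n') = (i + k, j + l) \<Longrightarrow> (m, n) = (i, j) \<and> (m', n') = (k, l)"
    if "(m, n) \<in> keys p" "(m', n') \<in> keys r" for m n m' n'
  proof -
    have "lex_le (m, n) (i, j)" "lex_le (m', n') (k, l)"
      using that p r by (auto simp: lead_exp_def)
    then show "lex_le (m + m', n + n') (i + k, j + l)"
      "(m + m', n + n') = (i + k, j + l) \<Longrightarrow> (m, n) = (i, j) \<and> (m', n') = (k, l)"
      by (auto simp: lex_le_def)
  qed
  define g where "g = (\<lambda>u v. lookup (single (fst u + fst v, snd u + snd v)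
    (q ^ (snd u * fst v) * (lookup p u * lookup r v))) (i + k, j + l))"
  have "lookup (qmul q p r) (i + k, j + l) = (\<Sum>u\<in>keys p. \<Sum>v\<in>keys r. g u v)"
    by (simp add: qmul_def tmult_def lookup_sum g_def split_beta)
  also have "\<dots> = (\<Sum>u\<in>keys p. \<Sum>v\<in>keys r. if u = (i, j) then if v = (k, l) then g u v else 0 else 0)"
  proof (intro sum.cong refl)
    fix u v
    assume "u \<in> keys p" "v \<in> keys r"
    then have *: "(fst u + fst v, snd u + snd v) = (i + k, j + l) \<Longrightarrow> u = (i, j) \<and> v = (k, l)"
      using eq[of "fst u" "snd u" "fst v" "snd v"] by simp
    have "g u v = 0" if "\<not> (u = (i, j) \<and> v = (k, l))"
      unfolding g_def by (rule lookup_single_not_eq) (use * that in blast)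
    then show "g u v = (if u = (i, j) then if v = (k, l) then g u v else 0 else 0)"
      by argo
  qed
  also have "\<dots> = (\<Sum>u\<in>keys p. if u = (i, j) then g (i, j) (k, l) else 0)"
    using r by (intro sum.cong refl) (auto simp: lead_exp_def)
  also have "\<dots> = g (i, j) (k, l)"
    using p by (simp add: lead_exp_def)
  finally show *: "lookup (qmul q p r) (i + k, j + l) = q ^ (j * k) * (lookup p (i, j) * lookup r (k, l))"
    by (simp add: g_def)
  have "lex_le w (i + k, j + l)" if "w \<in> keys (qmul q p r)" for w
    using keys_tmult[of _ _ p r] that le unfolding qmul_def by fastforce
  then show "lead_exp (qmul q p r) (i + k, j + l)"
    using * p r q by (auto simp: lead_exp_def in_keys_iff)
qed

locale quantum_parameter =
  fixes q :: complex
  assumes q0: "q \<noteq> 0" and not_root: "\<forall>n::nat. n > 0 \<longrightarrow> q ^ n \<noteq> 1"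
begin

lemma power_eq_iff: "q ^ a = q ^ b \<longleftrightarrow> a = b"
proof
  have *: "a = b" if "q ^ a = q ^ b" "a \<le> b" for a b
  proof (rule ccontr)
    assume "a \<noteq> b"
    moreover have "q ^ b = q ^ a * q ^ (b - a)"
      using \<open>a \<le> b\<close> by (simp add: power_add[symmetric])
    then have "q ^ (b - a) = 1"
      using that q0 by simp
    ultimately show False
      using not_root \<open>a \<le> b\<close> by auto
  qed
  then show "q ^ a = q ^ b \<Longrightarrow> a = b"
    by (metis nat_le_linear)
qed simp

text \<open>
  The leading exponents \<open>(i, j)\<close> and \<open>(k, l)\<close> of the images of \<open>x\<close> and \<open>y\<close> satisfy \<open>i l - j k = 1\<close>,
  because the images \<open>q\<close>-commute. Hence distinct monomials have distinct leading exponents after the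
  automorphism, and by surjectivity these leading exponents exhaust all pairs. As \<open>(1, 0)\<close> and
  \<open>(0, 1)\<close> are nonnegative combinations of \<open>(i, j)\<close> and \<open>(k, l)\<close>, the images of \<open>x\<close> and \<open>y\<close> have these
  two leading exponents, and \<open>q\<close>-commutation removes the lower terms.
\<close>

lemma automorphism_diagonal:
  assumes lin: "linear_op K" and mult: "\<And>p r. K (qmul q p r) = qmul q (K p) (K r)"
    and inv: "\<And>p. K (K' p) = p" "\<And>p. K' (K p) = p"
  obtains \<alpha> \<beta> where "K (mon 1 0) = single (1, 0) \<alpha>" "K (mon 0 1) = single (0, 1) \<beta>"
proof -
  let ?X = "K (mon 1 0)" and ?Y = "K (mon 0 1)"
  have K_eq0: "K p = 0 \<longleftrightarrow> p = 0" for p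
    using inv linear_opD(3)[OF lin] by metis
  have K1: "K (mon 0 0) = mon 0 0"
    using inv mult qmul_one by metis
  have lead_exists: "\<exists>i j. lead_exp p (i, j)" if "p \<noteq> 0" for p
    using lex_max_exists[of "keys p" "\<lambda>u. u"] that by (auto simp: lead_exp_def)
  have mon_nz: "single u (1::complex) \<noteq> 0" for u :: "nat \<times> nat"
    by (metis lookup_single_eq lookup_zero zero_neq_one)
  obtain i j where X: "lead_exp ?X (i, j)"
    using lead_exists[of ?X] mon_nz by (auto simp: K_eq0)
  obtain k l where Y: "lead_exp ?Y (k, l)"
    using lead_exists[of ?Y] mon_nz by (auto simp: K_eq0)
  have yx: "qmul q ?Y ?X = q *\<^sub>p qmul q ?X ?Y"
  proof -
    have "qmul q (mon 0 1) (mon 1 0) = q *\<^sub>p qmul q (mon 1 0) (mon 0 1)"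
      by simp
    then show ?thesis
      using mult linear_opD(2)[OF lin] by metis
  qed
  have "q ^ (l * i) * (lookup ?Y (k, l) * lookup ?X (i, j)) = q * (q ^ (j * k) * (lookup ?X (i, j) * lookup ?Y (k, l)))"
    using arg_cong[OF yx, of "\<lambda>p. lookup p (i + k, j + l)"] lead_exp_mult(2)[OF q0 X Y] lead_exp_mult(2)[OF q0 Y X]
    by (simp add: add.commute) metis
  moreover have "lookup ?X (i, j) \<noteq> 0" "lookup ?Y (k, l) \<noteq> 0"
    using X Y by (auto simp: lead_exp_def in_keys_iff)
  ultimately have "q ^ (l * i) = q ^ Suc (j * k)"
    by (simp add: mult_ac)
  then have det: "l * i = Suc (j * k)"
    by (simp only: power_eq_iff)
  \<comment> \<open>The leading exponent of the image of \<open>mon m n\<close>.\<close>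
  define L where "L = (\<lambda>(m, n). (m * i + n * k, m * j + n * l))"
  have L_inj: "u = v" if "L u = L v" for u v
  proof -
    obtain m n m' n' where uv: "u = (m, n)" "v = (m', n')" by fastforce
    have eq: "int m * int i + int n * int k = int m' * int i + int n' * int k"
      "int m * int j + int n * int l = int m' * int j + int n' * int l"
      using that by (simp_all add: uv L_def) (metis of_nat_add of_nat_mult)+
    have D: "int l * int i = 1 + int j * int k"
      using arg_cong[OF det, of int] by simp
    have solve: "M = int l * (M * int i + N * int k) - int k * (M * int j + N * int l)"
      "N = int i * (M * int j + N * int l) - int j * (M * int i + N * int k)" for M N
    proof -
      have "int l * (M * int i + N * int k) - int k * (M * int j + N * int l) = M * (int l * int i - int j * int k)"
        "int i * (M * int j + N * int l) - int j * (M * int i + N * int k) = N * (int l * int i - int j * int k)"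
        by (simp_all add: algebra_simps)
      then show "M = int l * (M * int i + N * int k) - int k * (M * int j + N * int l)"
        "N = int i * (M * int j + N * int l) - int j * (M * int i + N * int k)"
        using D by simp_all
    qed
    have "int m = int l * (int m' * int i + int n' * int k) - int k * (int m' * int j + int n' * int l)"
      unfolding eq[symmetric] by (rule solve(1))
    also have "\<dots> = int m'"
      by (rule solve(1)[symmetric])
    finally have "m = m'"
      by simp
    have "int n = int i * (int m' * int j + int n' * int l) - int j * (int m' * int i + int n' * int k)"
      unfolding eq[symmetric] by (rule solve(2))
    also have "\<dots> = int n'"
      by (rule solve(2)[symmetric])
    finally have "n = n'"
      by simp
    with \<open>m = m'\<close> show ?thesis
      by (simp add: uv)
  qed
  have lead_mon: "lead_exp (K (mon m n)) (L (m, n))" for m n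
  proof (induction m)
    case 0
    show ?case
    proof (induction n)
      case 0
      then show ?case
        by (simp add: K1 L_def lead_exp_def lex_le_def)
    next
      case (Suc n)
      then show ?case
        using lead_exp_mult(1)[OF q0 Y, of "K (mon 0 n)" "n * k" "n * l"] by (simp add: L_def mult[symmetric])
    qed
  next
    case (Suc m)
    then show ?case
      using lead_exp_mult(1)[OF q0 X, of "K (mon m n)" "m * i + n * k" "m * j + n * l"]
      by (simp add: L_def mult[symmetric] add_ac)
  qed
  \<comment> \<open>In the expansion of \<open>K p\<close> over the monomials of \<open>p\<close>, the largest leading exponent cannot cancel.\<close>
  have L_surj: "\<exists>w. L w = u" for u
  proof -
    define p where "p = K' (single u 1)"
    have Kp: "K p = single u 1"
      by (simp add: p_def inv)
    then have "p \<noteq> 0"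
      using K_eq0 mon_nz by metis
    then obtain w where w: "w \<in> keys p" "\<forall>v\<in>keys p. lex_le (L v) (L w)"
      using lex_max_exists[of "keys p" L] by auto
    have "lookup (K (single v 1)) (L w) = 0" if v: "v \<in> keys p" "v \<noteq> w" for v
    proof (rule ccontr)
      assume "lookup (K (single v 1)) (L w) \<noteq> 0"
      then have "lex_le (L w) (L v)"
        using lead_mon[of "fst v" "snd v"] by (simp add: lead_exp_def in_keys_iff)
      then have "L w = L v"
        using w(2) v(1) by (auto intro: lex_le_antisym)
      then show False
        using L_inj v(2) by blast
    qed
    note other = this
    have "lookup (K p) (L w) = (\<Sum>v\<in>keys p. lookup p v * lookup (K (single v 1)) (L w))"
      by (subst linear_op_expand[OF lin]) (simp add: lookup_sum)
    also have "\<dots> = (\<Sum>v\<in>keys p. if v = w then lookup p w * lookup (K (single w 1)) (L w) else 0)"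
      by (intro sum.cong refl) (simp add: other)
    also have "\<dots> = lookup p w * lookup (K (single w 1)) (L w)"
      using w(1) by simp
    also have "\<dots> \<noteq> 0"
      using w(1) lead_mon[of "fst w" "snd w"] by (simp add: lead_exp_def in_keys_iff)
    finally have "L w = u"
      by (simp add: Kp lookup_single when_def split: if_splits)
    then show ?thesis ..
  qed
  have "l > 0" "i > 0"
    using det by (cases l; cases i; simp)+
  obtain m n where "L (m, n) = (1, 0)"
    using L_surj by (metis surj_pair)
  then have "m * i + n * k = 1" "m * j + n * l = 0"
    by (simp_all add: L_def)
  then have ij: "i = 1" "j = 0"
    using \<open>l > 0\<close> by auto
  obtain m' n' where "L (m', n') = (0, 1)"
    using L_surj by (metis surj_pair)
  then have "m' * i + n' * k = 0" "m' * j + n' * l = 1"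
    by (simp_all add: L_def)
  then have kl: "k = 0" "l = 1"
    using \<open>i > 0\<close> by auto
  define a c d where "a = lookup ?X (1, 0)" and "c = lookup ?X (0, 0)" and "d = lookup ?Y (0, 1)"
  have ad: "a \<noteq> 0" "d \<noteq> 0"
    using X Y by (auto simp: ij kl a_def d_def lead_exp_def in_keys_iff)
  have X_supp: "lookup ?X (m, n) = 0" if "(m, n) \<noteq> (1, 0)" "(m, n) \<noteq> (0, 0)" for m n
  proof (rule ccontr)
    assume "lookup ?X (m, n) \<noteq> 0"
    then have "lex_le (m, n) (1, 0)"
      using X by (auto simp: ij lead_exp_def in_keys_iff)
    then show False
      using that by (auto simp: lex_le_def)
  qed
  have Y_supp: "lookup ?Y (m, n) = 0" if "(m, n) \<noteq> (0, 1)" "n \<noteq> 0" for m n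
  proof (rule ccontr)
    assume "lookup ?Y (m, n) \<noteq> 0"
    then have "lex_le (m, n) (0, 1)"
      using Y by (auto simp: kl lead_exp_def in_keys_iff)
    then show False
      using that by (auto simp: lex_le_def)
  qed
  have X_eq: "?X = single (0, 0) c + single (1, 0) a"
  proof (rule poly_mapping_eqI)
    fix u :: "nat \<times> nat"
    show "lookup ?X u = lookup (single (0, 0) c + single (1, 0) a) u"
      using X_supp[of "fst u" "snd u"] by (auto simp: lookup_add lookup_single when_def a_def c_def)
  qed
  have comm: "lookup (qmul q ?Y (single (0, 0) c + single (1, 0) a)) u
      = q * lookup (qmul q (single (0, 0) c + single (1, 0) a) ?Y) u" for u
    using arg_cong[OF yx[unfolded X_eq], of "\<lambda>p. lookup p u"] by simp
  have q1: "q \<noteq> 1"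
    using not_root[rule_format, of 1] by simp
  \<comment> \<open>Compare the coefficients of \<open>y\<close>, and then those of the powers of \<open>x\<close>.\<close>
  have "c * d = q * (c * d)"
    using comm[of "(0, 1)"]
    by (simp add: qmul_add_left qmul_add_right lookup_add lookup_qmul_single_left lookup_qmul_single_right d_def)
  then have c: "c = 0"
    using ad q1 by simp
  have "lookup ?Y (m, 0) = 0" for m
  proof -
    have "a * lookup ?Y (m, 0) = q * (a * lookup ?Y (m, 0))"
      using comm[of "(Suc m, 0)"]
      by (simp add: c lookup_qmul_single_left lookup_qmul_single_right)
    then show ?thesis
      using ad q1 by simp
  qed
  then have "lookup ?Y u = lookup (single (0, 1) d) u" for u
    using Y_supp[of "fst u" "snd u"] by (cases u) (auto simp: lookup_single when_def d_def)
  then have "?Y = single (0, 1) d"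
    by (rule poly_mapping_eqI)
  moreover have "?X = single (1, 0) a"
    using X_eq c by simp
  ultimately show ?thesis
    using that by blast
qed

end

section \<open>Classification of the operators\<close>

lemma lookup_plane_K: "lookup (plane_K q p) (m, n) = q ^ m / q ^ (2 * n) * lookup p (m, n)"
proof (induction p rule: poly_mapping_lin_induct)
  case (single u c)
  then show ?case
    by (cases u) (auto simp: lookup_single when_def)
qed (simp_all add: plane_ops_linear lookup_add distrib_left)

lemma linear_op_sum_apply:
  assumes "linear_op S"
  shows "S (\<Sum>i\<in>I. c i *\<^sub>p f i) = (\<Sum>i\<in>I. c i *\<^sub>p S (f i))"
  by (induction I rule: infinite_finite_induct) (simp_all add: linear_opD[OF assms])

lemma pscale_sum: "a *\<^sub>p (\<Sum>i\<in>I. f i) = (\<Sum>i\<in>I. a *\<^sub>p f i)"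
  by (induction I rule: infinite_finite_induct) (simp_all add: pscale_add_right)

lemma eq_sum_singleI:
  assumes "finite I" "inj_on pos I" and on: "\<And>i. i \<in> I \<Longrightarrow> lookup p (pos i) = c i"
    and supp: "\<And>u. lookup p u \<noteq> 0 \<Longrightarrow> u \<in> pos ` I"
  shows "p = (\<Sum>i\<in>I. single (pos i) (c i))"
proof (rule poly_mapping_eqI)
  fix u
  show "lookup p u = lookup (\<Sum>i\<in>I. single (pos i) (c i)) u"
  proof (cases "u \<in> pos ` I")
    case True
    then obtain j where j: "j \<in> I" "u = pos j"
      by blast
    have "lookup (\<Sum>i\<in>I. single (pos i) (c i)) u = (\<Sum>i\<in>I. if i = j then c j else 0)"
      unfolding lookup_sum using assms(2) j
      by (intro sum.cong refl) (auto simp: lookup_single when_def dest: inj_onD)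
    also have "\<dots> = lookup p u"
      using assms(1) j on by simp
    finally show ?thesis ..
  next
    case False
    then have "lookup (single (pos i) (c i)) u = 0" if "i \<in> I" for i
      using that by (auto simp: lookup_single when_def)
    then show ?thesis
      using supp False by (auto simp: lookup_sum)
  qed
qed

context quantum_parameter
begin

lemma K_determined:
  assumes ops: "uq_operators q K K' E F" and e: "lookup (E (mon 0 1)) (0, 0) \<noteq> 0"
  shows "K = plane_K q" and "K' = plane_K' q"
proof -
  note ops = ops[unfolded uq_operators_def]
  have lin: "linear_op K" "linear_op E"
    using ops by auto
  note K_lin = linear_opD[OF lin(1)] and E_lin = linear_opD[OF lin(2)]
  have mult: "K (qmul q p r) = qmul q (K p) (K r)" for p r
    using ops by blast
  obtain \<alpha> \<beta> where \<alpha>: "K (mon 1 0) = single (1, 0) \<alpha>" and \<beta>: "K (mon 0 1) = single (0, 1) \<beta>"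
    by (rule automorphism_diagonal[of K K']) (use ops in auto)
  have K1: "K (mon 0 0) = mon 0 0"
    using ops qmul_one by metis
  have K_mon: "K (mon m n) = single (m, n) (\<alpha> ^ m * \<beta> ^ n)" for m n
  proof (induction m)
    case 0
    show ?case
    proof (induction n)
      case (Suc n)
      then show ?case
        using mult[of "mon 0 1" "mon 0 n"] \<beta> by simp
    qed (simp add: K1)
  next
    case (Suc m)
    then show ?case
      using mult[of "mon 1 0" "mon m n"] \<alpha> by (simp add: mult_ac)
  qed
  have lookup_K: "lookup (K p) (m, n) = \<alpha> ^ m * \<beta> ^ n * lookup p (m, n)" for p m n
  proof (induction p rule: poly_mapping_lin_induct)
    case (single u c)
    have "single u c = c *\<^sub>p mon (fst u) (snd u)"
      by simp
    then have "K (single u c) = single u (c * (\<alpha> ^ fst u * \<beta> ^ snd u))"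
      using K_lin(2)[of c "mon (fst u) (snd u)"] K_mon[of "fst u" "snd u"] by simp
    then show ?case
      by (cases u) (auto simp: lookup_single when_def)
  qed (simp_all add: K_lin lookup_add distrib_left)
  \<comment> \<open>The weight of the constant term of \<open>E y\<close> gives the eigenvalue of \<open>y\<close>.\<close>
  have "K (E (mon 0 1)) = (q ^ 2 * \<beta>) *\<^sub>p E (mon 0 1)"
  proof -
    have "K (mon 0 1) = \<beta> *\<^sub>p mon 0 1"
      using \<beta> by simp
    then show ?thesis
      using ops E_lin(2)[of \<beta> "mon 0 1"] by simp
  qed
  from arg_cong[OF this, of "\<lambda>p. lookup p (0, 0)"]
  have "\<beta> = 1 / q ^ 2"
    using e q0 by (simp add: lookup_K field_simps)
  \<comment> \<open>The coefficient of \<open>x\<close> in \<open>E (y x) = q E (x y)\<close> gives the eigenvalue of \<open>x\<close>.\<close>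
  have "E (qmul q (mon 0 1) (mon 1 0)) = q *\<^sub>p E (qmul q (mon 1 0) (mon 0 1))"
    using E_lin(2)[of q "mon 1 1"] by simp
  then have "qmul q (mon 0 1) (E (mon 1 0)) + qmul q (E (mon 0 1)) (single (1, 0) \<alpha>)
      = q *\<^sub>p (qmul q (mon 1 0) (E (mon 0 1)) + qmul q (E (mon 1 0)) (single (0, 1) \<beta>))"
    using ops \<alpha> \<beta> by metis
  from arg_cong[OF this, of "\<lambda>p. lookup p (1, 0)"]
  have "\<alpha> = q"
    using e by (simp add: lookup_add lookup_qmul_single_left lookup_qmul_single_right)
  show K: "K = plane_K q"
    by (rule linear_op_eqI)
      (simp_all add: lin K_mon \<open>\<alpha> = q\<close> \<open>\<beta> = 1 / q ^ 2\<close> power_divide power_mult)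
  show "K' = plane_K' q"
  proof
    fix p
    have "K' (K (plane_K' q p)) = plane_K' q p"
      using ops by blast
    then show "K' p = plane_K' q p"
      by (simp add: K plane_K_inverse[OF q0])
  qed
qed

text \<open>
  The coefficient of the commutator of \<open>e_hom q r\<close> and \<open>f_hom q t\<close> on \<open>x\<close>. In this factored form it is
  visibly nonzero.
\<close>

definition comm_coeff :: "nat \<Rightarrow> nat \<Rightarrow> complex" where
  "comm_coeff r t = q ^ (2 * r * t) / q ^ Suc (2 * t + 2) * (1 - q ^ (r + t + 2)) * (1 - q ^ (2 * r + 2 * t + 2))"

lemma comm_coeff_nonzero: "comm_coeff r t \<noteq> 0"
  using not_root[rule_format, of "r + t + 2"] not_root[rule_format, of "2 * r + 2 * t + 2"] q0
  by (simp add: comm_coeff_def)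

lemma commutator_on_x:
  "e_hom q r (f_hom q t (mon 1 0)) - f_hom q t (e_hom q r (mon 1 0)) = single (1 + 2 * (r + t), r + t) (comm_coeff r t)"
proof (cases r)
  case 0
  show ?thesis
    using q0 by (simp add: 0 comm_coeff_def) (intro arg_cong[of _ _ "single _"], simp add: field_simps power_add power_mult power3_eq_cube)
next
  case (Suc s)
  have "(q ^ (t + 1) - 1 / q) * (q ^ (2 * r * (t + 1)) - q ^ (r * (1 + 2 * t)) / q ^ (2 * (t + 1)))
      - (1 - q ^ r) * (q ^ ((t + 1) * (1 + 2 * r)) - q ^ ((2 * t + 2) * s) / q ^ (1 + 2 * r)) = comm_coeff r t"
    using q0 unfolding comm_coeff_def Suc
    by (simp add: field_simps) (simp add: power_add[symmetric] algebra_simps)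
  then show ?thesis
    by (simp add: Suc single_diff[symmetric] algebra_simps)
qed

text \<open>
  The relation with \<open>K\<close> confines \<open>E x\<close> to the monomials with exponents \<open>(2 n + 3, n)\<close> and \<open>E y\<close> to those
  with \<open>(2 n, n)\<close>. Applying \<open>E\<close> to \<open>y x = q x y\<close> expresses the coefficients of \<open>E x\<close> by those of \<open>E y\<close>, in
  the same ratio as for the homogeneous skew derivations. Hence both sides agree on \<open>x\<close> and \<open>y\<close>.
\<close>

lemma e_decomposition:
  assumes E: "e_derivation q (plane_K q) E" and KE: "\<And>p. plane_K q (E p) = (q powi 2) *\<^sub>p E (plane_K q p)"
  defines "lam \<equiv> \<lambda>r. lookup (E (mon 0 1)) (2 * r, r) / (q ^ (2 * r) - 1 / q ^ 2)"
  shows "finite {r. lam r \<noteq> 0}" and "E = (\<lambda>p. \<Sum>r\<in>{r. lam r \<noteq> 0}. lam r *\<^sub>p e_hom q r p)"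
proof -
  have lin: "linear_op E" and mult: "\<And>p r. E (qmul q p r) = qmul q p (E r) + qmul q (E p) (plane_K q r)"
    using E by (auto simp: e_derivation_def)
  note E_lin = linear_opD[OF lin]
  let ?x = "E (mon 1 0)" and ?y = "E (mon 0 1)"
  have denom: "q ^ (2 * r) - 1 / q ^ 2 \<noteq> 0" for r
    using not_root[rule_format, of "2 * r + 2"] q0
    by (simp add: field_simps power_add power2_eq_square)
  have weight_x: "m = 2 * n + 3" if "lookup ?x (m, n) \<noteq> 0" for m n
  proof -
    have "plane_K q ?x = (q ^ 2 * q) *\<^sub>p ?x"
    proof -
      have "plane_K q (mon 1 0) = q *\<^sub>p mon 1 0"
        by simp
      then show ?thesis
        using KE[of "mon 1 0"] E_lin(2)[of q "mon 1 0"] by simp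
    qed
    from arg_cong[OF this, of "\<lambda>p. lookup p (m, n)"]
    have "q ^ m = q ^ (2 * n + 3)"
      using that q0 by (simp add: lookup_plane_K field_simps power_add power2_eq_square power3_eq_cube)
    then show ?thesis
      by (simp only: power_eq_iff)
  qed
  have weight_y: "m = 2 * n" if "lookup ?y (m, n) \<noteq> 0" for m n
  proof -
    have "plane_K q ?y = ?y"
    proof -
      have "plane_K q (mon 0 1) = (1 / q ^ 2) *\<^sub>p mon 0 1"
        by simp
      then show ?thesis
        using KE[of "mon 0 1"] E_lin(2)[of "1 / q ^ 2" "mon 0 1"] q0 by simp
    qed
    from arg_cong[OF this, of "\<lambda>p. lookup p (m, n)"]
    have "q ^ m = q ^ (2 * n)"
      using that q0 by (simp add: lookup_plane_K field_simps)
    then show ?thesis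
      by (simp only: power_eq_iff)
  qed
  have y_coeff: "lookup ?y (2 * r, r) = lam r * (q ^ (2 * r) - 1 / q ^ 2)" for r
    using denom[of r] by (simp add: lam_def)
  have x_coeff: "lookup ?x (2 * s + 3, s) = lam (Suc s) * (1 - q ^ Suc s)" for s
  proof -
    have "E (qmul q (mon 0 1) (mon 1 0)) = q *\<^sub>p E (qmul q (mon 1 0) (mon 0 1))"
      using E_lin(2)[of q "mon 1 1"] by simp
    then have "qmul q (mon 0 1) ?x + qmul q ?y (single (1, 0) q)
        = q *\<^sub>p (qmul q (mon 1 0) ?y + qmul q ?x (single (0, 1) (1 / q ^ 2)))"
      unfolding mult by simp
    from arg_cong[OF this, of "\<lambda>p. lookup p (2 * s + 3, Suc s)"]
    have "q ^ (2 * s + 3) * lookup ?x (2 * s + 3, s) + q * q ^ Suc s * lookup ?y (2 * Suc s, Suc s)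
        = q * (lookup ?y (2 * Suc s, Suc s) + lookup ?x (2 * s + 3, s) / q ^ 2)"
      by (simp add: lookup_add lookup_qmul_single_left lookup_qmul_single_right numeral_3_eq_3)
    also have "\<dots> = q * lookup ?y (2 * Suc s, Suc s) + lookup ?x (2 * s + 3, s) / q"
      using q0 by (simp add: distrib_left power2_eq_square)
    finally have "lookup ?x (2 * s + 3, s) * (q ^ (2 * s + 3) - 1 / q) = lookup ?y (2 * Suc s, Suc s) * (q - q * q ^ Suc s)"
      by (simp add: algebra_simps)
    also have "\<dots> = lam (Suc s) * (1 - q ^ Suc s) * (q ^ (2 * s + 3) - 1 / q)"
      unfolding y_coeff using q0 by (simp add: field_simps power2_eq_square power3_eq_cube power_add)
    finally have "lookup ?x (2 * s + 3, s) * (q ^ (2 * s + 3) - 1 / q)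
        = lam (Suc s) * (1 - q ^ Suc s) * (q ^ (2 * s + 3) - 1 / q)" .
    moreover have "q ^ (2 * s + 3) - 1 / q \<noteq> 0"
      using not_root[rule_format, of "2 * s + 4"] q0
      by (simp add: field_simps power_add power3_eq_cube eval_nat_numeral)
    ultimately show ?thesis
      by simp
  qed
  have "(\<lambda>r. (2 * r, r)) ` {r. lam r \<noteq> 0} \<subseteq> keys ?y"
    by (auto simp: lam_def in_keys_iff)
  then show fin: "finite {r. lam r \<noteq> 0}"
    by (rule finite_imageD[OF finite_subset]) (auto simp: inj_on_def)
  show "E = (\<lambda>p. \<Sum>r\<in>{r. lam r \<noteq> 0}. lam r *\<^sub>p e_hom q r p)"
  proof (rule e_derivation_eqI[OF E])
    show "e_derivation q (plane_K q) (\<lambda>p. \<Sum>r\<in>{r. lam r \<noteq> 0}. lam r *\<^sub>p e_hom q r p)"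
      by (rule e_derivation_sum) (rule e_derivation_e_hom[OF q0])
    have "?x = (\<Sum>r\<in>{r. lam r \<noteq> 0}. single (1 + 2 * r, r - 1) (lam r * (1 - q ^ r)))"
    proof (rule eq_sum_singleI[OF fin])
      fix r
      show "lookup ?x (1 + 2 * r, r - 1) = lam r * (1 - q ^ r)"
        using weight_x[of 1 0] x_coeff[of "r - 1"] by (cases r) (auto simp: eval_nat_numeral)
    next
      fix u
      assume nz: "lookup ?x u \<noteq> 0"
      then obtain s where u: "u = (2 * s + 3, s)"
        using weight_x[of "fst u" "snd u"] by (cases u) auto
      then show "u \<in> (\<lambda>r. (1 + 2 * r, r - 1)) ` {r. lam r \<noteq> 0}"
        using nz x_coeff[of s] by (intro image_eqI[of _ _ "Suc s"]) auto
    qed (auto simp: inj_on_def)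
    then show "?x = (\<Sum>r\<in>{r. lam r \<noteq> 0}. lam r *\<^sub>p e_hom q r (mon 1 0))"
      by simp
    have "?y = (\<Sum>r\<in>{r. lam r \<noteq> 0}. single (2 * r, r) (lam r * (q ^ (2 * r) - 1 / q ^ 2)))"
    proof (rule eq_sum_singleI[OF fin])
      fix u
      assume nz: "lookup ?y u \<noteq> 0"
      then obtain r where "u = (2 * r, r)"
        using weight_y[of "fst u" "snd u"] by (cases u) auto
      then show "u \<in> (\<lambda>r. (2 * r, r)) ` {r. lam r \<noteq> 0}"
        using nz y_coeff[of r] by auto
    qed (use y_coeff in \<open>auto simp: inj_on_def\<close>)
    then show "?y = (\<Sum>r\<in>{r. lam r \<noteq> 0}. lam r *\<^sub>p e_hom q r (mon 0 1))"
      by simp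
  qed simp
qed

text \<open>
  The same argument, with exponents \<open>(2 t + 1, t + 1)\<close> for \<open>F x\<close> and \<open>(2 t, t + 2)\<close> for \<open>F y\<close>; here the
  coefficients of \<open>F x\<close> determine those of \<open>F y\<close>.
\<close>

lemma f_decomposition:
  assumes F: "f_derivation q (plane_K' q) F" and KF: "\<And>p. plane_K q (F p) = (q powi (-2)) *\<^sub>p F (plane_K q p)"
  defines "mu \<equiv> \<lambda>t. lookup (F (mon 1 0)) (2 * t + 1, t + 1) / (q ^ (t + 1) - 1 / q)"
  shows "finite {t. mu t \<noteq> 0}" and "F = (\<lambda>p. \<Sum>t\<in>{t. mu t \<noteq> 0}. mu t *\<^sub>p f_hom q t p)"
proof -
  have lin: "linear_op F" and mult: "\<And>p r. F (qmul q p r) = qmul q (F p) r + qmul q (plane_K' q p) (F r)"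
    using F by (auto simp: f_derivation_def)
  note F_lin = linear_opD[OF lin]
  let ?x = "F (mon 1 0)" and ?y = "F (mon 0 1)"
  have denom: "q ^ (t + 1) - 1 / q \<noteq> 0" for t
    using not_root[rule_format, of "t + 2"] q0 by (simp add: field_simps power_add power2_eq_square)
  have weight_x: "m + 1 = 2 * n" if "lookup ?x (m, n) \<noteq> 0" for m n
  proof -
    have "plane_K q ?x = (1 / q) *\<^sub>p ?x"
    proof -
      have "plane_K q (mon 1 0) = q *\<^sub>p mon 1 0"
        by simp
      then show ?thesis
        using KF[of "mon 1 0"] F_lin(2)[of q "mon 1 0"] q0
        by (simp add: power_int_minus power2_eq_square field_simps)
    qed
    from arg_cong[OF this, of "\<lambda>p. lookup p (m, n)"]
    have "q ^ (m + 1) = q ^ (2 * n)"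
      using that q0 by (simp add: lookup_plane_K field_simps)
    then show ?thesis
      by (simp only: power_eq_iff)
  qed
  have weight_y: "m + 4 = 2 * n" if "lookup ?y (m, n) \<noteq> 0" for m n
  proof -
    have "plane_K q ?y = (1 / q ^ 4) *\<^sub>p ?y"
    proof -
      have "plane_K q (mon 0 1) = (1 / q ^ 2) *\<^sub>p mon 0 1"
        by simp
      then show ?thesis
        using KF[of "mon 0 1"] F_lin(2)[of "1 / q ^ 2" "mon 0 1"] q0
        by (simp add: power_int_minus field_simps power_add[symmetric])
    qed
    from arg_cong[OF this, of "\<lambda>p. lookup p (m, n)"]
    have "q ^ (m + 4) = q ^ (2 * n)"
      using that q0 by (simp add: lookup_plane_K field_simps power_add)
    then show ?thesis
      by (simp only: power_eq_iff)
  qed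
  have x_coeff: "lookup ?x (2 * t + 1, t + 1) = mu t * (q ^ (t + 1) - 1 / q)" for t
    using denom[of t] by (simp add: mu_def)
  have y_coeff: "lookup ?y (2 * t, t + 2) = mu t * (1 - q ^ (2 * t + 2))" for t
  proof -
    have "F (qmul q (mon 0 1) (mon 1 0)) = q *\<^sub>p F (qmul q (mon 1 0) (mon 0 1))"
      using F_lin(2)[of q "mon 1 1"] by simp
    then have "qmul q ?y (mon 1 0) + qmul q (single (0, 1) (q ^ 2)) ?x
        = q *\<^sub>p (qmul q ?x (mon 0 1) + qmul q (single (1, 0) (1 / q)) ?y)"
      unfolding mult by simp
    from arg_cong[OF this, of "\<lambda>p. lookup p (2 * t + 1, t + 2)"]
    have "q ^ (t + 2) * lookup ?y (2 * t, t + 2) + q ^ 2 * q ^ (2 * t + 1) * lookup ?x (2 * t + 1, t + 1)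
        = q * (lookup ?x (2 * t + 1, t + 1) + lookup ?y (2 * t, t + 2) / q)"
      by (simp add: lookup_add lookup_qmul_single_left lookup_qmul_single_right)
    also have "\<dots> = q * lookup ?x (2 * t + 1, t + 1) + lookup ?y (2 * t, t + 2)"
      using q0 by (simp add: distrib_left)
    finally have "lookup ?y (2 * t, t + 2) * (q ^ (t + 2) - 1) = lookup ?x (2 * t + 1, t + 1) * (q - q ^ (2 * t + 3))"
      using q0 by (simp add: field_simps power2_eq_square power3_eq_cube power_add)
    also have "\<dots> = mu t * (1 - q ^ (2 * t + 2)) * (q ^ (t + 2) - 1)"
      unfolding x_coeff using q0 by (simp add: field_simps power2_eq_square power3_eq_cube power_add)
    finally have "lookup ?y (2 * t, t + 2) * (q ^ (t + 2) - 1) = mu t * (1 - q ^ (2 * t + 2)) * (q ^ (t + 2) - 1)" .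
    moreover have "q ^ (t + 2) - 1 \<noteq> 0"
      using not_root[rule_format, of "t + 2"] by simp
    ultimately show ?thesis
      by simp
  qed
  have "(\<lambda>t. (2 * t + 1, t + 1)) ` {t. mu t \<noteq> 0} \<subseteq> keys ?x"
    by (auto simp: mu_def in_keys_iff)
  then show fin: "finite {t. mu t \<noteq> 0}"
    by (rule finite_imageD[OF finite_subset]) (auto simp: inj_on_def)
  show "F = (\<lambda>p. \<Sum>t\<in>{t. mu t \<noteq> 0}. mu t *\<^sub>p f_hom q t p)"
  proof (rule f_derivation_eqI[OF F])
    show "f_derivation q (plane_K' q) (\<lambda>p. \<Sum>t\<in>{t. mu t \<noteq> 0}. mu t *\<^sub>p f_hom q t p)"
      by (rule f_derivation_sum) (rule f_derivation_f_hom[OF q0])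
    have "?x = (\<Sum>t\<in>{t. mu t \<noteq> 0}. single (2 * t + 1, t + 1) (mu t * (q ^ (t + 1) - 1 / q)))"
    proof (rule eq_sum_singleI[OF fin])
      fix u
      assume nz: "lookup ?x u \<noteq> 0"
      then have "fst u + 1 = 2 * snd u"
        using weight_x[of "fst u" "snd u"] by simp
      then obtain t where "u = (2 * t + 1, t + 1)"
        by (cases u; cases "snd u") auto
      then show "u \<in> (\<lambda>t. (2 * t + 1, t + 1)) ` {t. mu t \<noteq> 0}"
        using nz x_coeff[of t] by auto
    qed (use x_coeff in \<open>auto simp: inj_on_def\<close>)
    then show "?x = (\<Sum>t\<in>{t. mu t \<noteq> 0}. mu t *\<^sub>p f_hom q t (mon 1 0))"
      by simp
    have "?y = (\<Sum>t\<in>{t. mu t \<noteq> 0}. single (2 * t, t + 2) (mu t * (1 - q ^ (2 * t + 2))))"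
    proof (rule eq_sum_singleI[OF fin])
      fix u
      assume nz: "lookup ?y u \<noteq> 0"
      then have u: "fst u + 4 = 2 * snd u"
        using weight_y[of "fst u" "snd u"] by simp
      have "u = (2 * (snd u - 2), snd u - 2 + 2)"
        using u by (simp add: prod_eq_iff, arith)
      then obtain t where "u = (2 * t, t + 2)"
        by blast
      then show "u \<in> (\<lambda>t. (2 * t, t + 2)) ` {t. mu t \<noteq> 0}"
        using nz y_coeff[of t] by auto
    qed (use y_coeff in \<open>auto simp: inj_on_def\<close>)
    then show "?y = (\<Sum>t\<in>{t. mu t \<noteq> 0}. mu t *\<^sub>p f_hom q t (mon 0 1))"
      by simp
  qed simp
qed

text \<open>
  The commutator of \<open>E\<close> and \<open>F\<close> fixes \<open>x\<close>, while the top components \<open>r0\<close> and \<open>t0\<close> contribute a nonzero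
  term in degree \<open>(1 + 2 (r0 + t0), r0 + t0)\<close> that no other pair of components reaches. Therefore
  \<open>r0 = t0 = 0\<close>.
\<close>

lemma operators_classified:
  assumes ops: "uq_operators q K K' E F" and e: "lookup (E (mon 0 1)) (0, 0) \<noteq> 0"
  obtains b where "b \<noteq> 0" "K = plane_K q" "E = (\<lambda>p. (b / (1 - 1 / q ^ 2)) *\<^sub>p e_hom q 0 p)"
    "F = (\<lambda>p. (inverse b / (q - inverse q)) *\<^sub>p f_hom q 0 p)"
proof -
  note K = K_determined[OF ops e]
  note ops = ops[unfolded uq_operators_def K]
  define lam where "lam = (\<lambda>r. lookup (E (mon 0 1)) (2 * r, r) / (q ^ (2 * r) - 1 / q ^ 2))"
  define mu where "mu = (\<lambda>t. lookup (F (mon 1 0)) (2 * t + 1, t + 1) / (q ^ (t + 1) - 1 / q))"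
  define R where "R = {r. lam r \<noteq> 0}"
  define T where "T = {t. mu t \<noteq> 0}"
  have "e_derivation q (plane_K q) E" "f_derivation q (plane_K' q) F"
    using ops by (auto simp: e_derivation_def f_derivation_def)
  then have fin: "finite R" "finite T" and E: "E = (\<lambda>p. \<Sum>r\<in>R. lam r *\<^sub>p e_hom q r p)"
    and F: "F = (\<lambda>p. \<Sum>t\<in>T. mu t *\<^sub>p f_hom q t p)"
    unfolding R_def T_def lam_def mu_def
    using ops e_decomposition[of E] f_decomposition[of F] by blast+
  have nz: "1 - 1 / q ^ 2 \<noteq> 0" "q - 1 / q \<noteq> 0"
    using not_root[rule_format, of 2] q0 by (auto simp: field_simps power2_eq_square)
  have EF: "mon 1 0 = (\<Sum>r\<in>R. \<Sum>t\<in>T. single (1 + 2 * (r + t), r + t) (lam r * mu t * comm_coeff r t))"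
  proof -
    have "mon 1 0 = E (F (mon 1 0)) - F (E (mon 1 0))"
    proof -
      have "E (F (mon 1 0)) - F (E (mon 1 0)) = (1 / (q - inverse q)) *\<^sub>p (plane_K q (mon 1 0) - plane_K' q (mon 1 0))"
        using ops by blast
      then show ?thesis
        using nz(2) by (simp add: single_diff[symmetric] inverse_eq_divide)
    qed
    also have "E (F (mon 1 0)) = (\<Sum>r\<in>R. \<Sum>t\<in>T. (lam r * mu t) *\<^sub>p e_hom q r (f_hom q t (mon 1 0)))"
      unfolding E F by (simp only: linear_op_sum_apply[OF linear_plane_ops(3)] pscale_sum pscale_pscale)
    also have "F (E (mon 1 0)) = (\<Sum>t\<in>T. \<Sum>r\<in>R. (lam r * mu t) *\<^sub>p f_hom q t (e_hom q r (mon 1 0)))"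
      unfolding E F by (simp only: linear_op_sum_apply[OF linear_plane_ops(4)] pscale_sum pscale_pscale mult.commute)
    also have "\<dots> = (\<Sum>r\<in>R. \<Sum>t\<in>T. (lam r * mu t) *\<^sub>p f_hom q t (e_hom q r (mon 1 0)))"
      by (rule sum.swap)
    finally show ?thesis
      by (simp only: sum_subtractf[symmetric] pscale_diff_right[symmetric] commutator_on_x pscale_single)
  qed
  have "lam 0 \<noteq> 0"
    using e nz by (simp add: lam_def)
  then have R0: "0 \<in> R"
    by (simp add: R_def)
  have "T \<noteq> {}"
  proof
    assume "T = {}"
    then have "mon 1 0 = 0"
      using EF by simp
    then show False
      by (metis lookup_single_eq lookup_zero zero_neq_one)
  qed
  define r0 where "r0 = Max R"
  define t0 where "t0 = Max T"
  have r0: "r0 \<in> R" "\<And>r. r \<in> R \<Longrightarrow> r \<le> r0" and t0: "t0 \<in> T" "\<And>t. t \<in> T \<Longrightarrow> t \<le> t0"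
    using Max_in[OF fin(1)] Max_in[OF fin(2) \<open>T \<noteq> {}\<close>] Max_ge[OF fin(1)] Max_ge[OF fin(2)] R0
    unfolding r0_def t0_def by blast+
  have "lookup (mon 1 0) (1 + 2 * (r0 + t0), r0 + t0)
      = (\<Sum>r\<in>R. \<Sum>t\<in>T. if r = r0 then if t = t0 then lam r0 * mu t0 * comm_coeff r0 t0 else 0 else 0)"
    unfolding EF lookup_sum
  proof (intro sum.cong refl)
    fix r t
    assume "r \<in> R" "t \<in> T"
    then have "r + t = r0 + t0 \<longleftrightarrow> r = r0 \<and> t = t0"
      using r0(2)[of r] t0(2)[of t] by linarith
    then show "lookup (single (1 + 2 * (r + t), r + t) (lam r * mu t * comm_coeff r t)) (1 + 2 * (r0 + t0), r0 + t0)
        = (if r = r0 then if t = t0 then lam r0 * mu t0 * comm_coeff r0 t0 else 0 else 0)"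
      by (auto simp: lookup_single when_def)
  qed
  also have "\<dots> = (\<Sum>r\<in>R. if r = r0 then lam r0 * mu t0 * comm_coeff r0 t0 else 0)"
    using fin t0(1) by (intro sum.cong refl) auto
  also have "\<dots> = lam r0 * mu t0 * comm_coeff r0 t0"
    using fin r0(1) by simp
  finally have top: "lookup (mon 1 0) (1 + 2 * (r0 + t0), r0 + t0) = lam r0 * mu t0 * comm_coeff r0 t0" .
  moreover have "lam r0 * mu t0 * comm_coeff r0 t0 \<noteq> 0"
    using r0(1) t0(1) comm_coeff_nonzero by (simp add: R_def T_def)
  ultimately have "r0 = 0" "t0 = 0"
    by (auto simp: lookup_single when_def split: if_splits)
  then have RT: "R = {0}" "T = {0}"
    using R0 r0 t0 by auto
  define b where "b = lam 0 * (1 - 1 / q ^ 2)"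
  have b: "b \<noteq> 0"
    using \<open>lam 0 \<noteq> 0\<close> nz by (simp add: b_def)
  have "comm_coeff 0 0 = (1 - 1 / q ^ 2) * (q - 1 / q)"
    using q0 by (simp add: comm_coeff_def field_simps power2_eq_square power3_eq_cube)
  then have "b * (mu 0 * (q - 1 / q)) = 1"
    using top by (simp add: \<open>r0 = 0\<close> \<open>t0 = 0\<close> b_def mult_ac)
  then have "mu 0 = inverse b / (q - inverse q)"
    using inverse_unique[of b "mu 0 * (q - 1 / q)"] nz(2) by (simp add: inverse_eq_divide nonzero_eq_divide_eq)
  moreover have "lam 0 = b / (1 - 1 / q ^ 2)"
    using nz by (simp add: b_def)
  ultimately show ?thesis
    using that[OF b K(1)] E F RT by simp
qed

end

section \<open>The one-parameter family\<close>

definition family_E :: "complex \<Rightarrow> complex \<Rightarrow> qpoly \<Rightarrow> qpoly" where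
  "family_E q b p = (b / (1 - 1 / q ^ 2)) *\<^sub>p e_hom q 0 p"

definition family_F :: "complex \<Rightarrow> complex \<Rightarrow> qpoly \<Rightarrow> qpoly" where
  "family_F q b p = (inverse b / (q - inverse q)) *\<^sub>p f_hom q 0 p"

lemma structure_action:
  assumes "q \<noteq> 0" "\<pi> \<in> qplane_structures q"
  shows "uq_action q (qplane q) \<pi>"
  using assms
  by (intro uq_action.intro uq_action_axioms.intro calg_qplane)
    (simp_all add: qplane_structures_def module_algebra_structures_def Uq_sl2_simps)

lemma structure_apply:
  assumes "q \<noteq> 0" "\<pi> \<in> qplane_structures q" and h: "h \<in> carrier (uq_alg q)"
  shows "a \<in> carrier (qplane q) \<Longrightarrow> \<pi> h a = from_coords q (coord_op q (\<pi> h) (coords q a))"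
    and "\<pi> h (qx q) = from_coords q (coord_op q (\<pi> h) (mon 1 0))"
    and "\<pi> h (qy q) = from_coords q (coord_op q (\<pi> h) (mon 0 1))"
proof -
  interpret uq_action q "qplane q" \<pi>
    using assms by (intro structure_action)
  show *: "\<pi> h a = from_coords q (coord_op q (\<pi> h) (coords q a))" if "a \<in> carrier (qplane q)" for a
    using that h by (simp add: coord_op_def lin_endD)
  show "\<pi> h (qx q) = from_coords q (coord_op q (\<pi> h) (mon 1 0))"
    and "\<pi> h (qy q) = from_coords q (coord_op q (\<pi> h) (mon 0 1))"
    using *[of "qx q"] *[of "qy q"] by simp_all
qed

lemma from_coords_eq_iff: "from_coords q p = from_coords q r \<longleftrightarrow> p = r"
  by (metis coords_from_coords)

lemma family_values_iff_coords:
  assumes "q \<noteq> 0" "\<pi> \<in> qplane_structures q"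
  shows "family_values q b \<pi> \<longleftrightarrow>
    coord_op q (\<pi> (uk q)) (mon 1 0) = single (1, 0) q \<and>
    coord_op q (\<pi> (uk q)) (mon 0 1) = single (0, 1) (1 / q ^ 2) \<and>
    coord_op q (\<pi> (ue q)) (mon 1 0) = 0 \<and>
    coord_op q (\<pi> (ue q)) (mon 0 1) = single (0, 0) b \<and>
    coord_op q (\<pi> (uf q)) (mon 1 0) = single (1, 1) (inverse b) \<and>
    coord_op q (\<pi> (uf q)) (mon 0 1) = single (0, 2) (- q * inverse b)"
proof -
  interpret A: calg "qplane q" by (rule calg_qplane)
  have rhs: "q \<odot>\<^bsub>qplane q\<^esub> qx q = from_coords q (single (1, 0) q)"
    "(q powi (-2)) \<odot>\<^bsub>qplane q\<^esub> qy q = from_coords q (single (0, 1) (1 / q ^ 2))"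
    "\<zero>\<^bsub>qplane q\<^esub> = from_coords q 0"
    "b \<odot>\<^bsub>qplane q\<^esub> \<one>\<^bsub>qplane q\<^esub> = from_coords q (single (0, 0) b)"
    "inverse b \<odot>\<^bsub>qplane q\<^esub> (qx q \<otimes>\<^bsub>qplane q\<^esub> qy q) = from_coords q (single (1, 1) (inverse b))"
    "(- q * inverse b) \<odot>\<^bsub>qplane q\<^esub> (qy q \<otimes>\<^bsub>qplane q\<^esub> qy q) = from_coords q (single (0, 2) (- q * inverse b))"
    by (simp_all add: power_int_minus inverse_eq_divide numeral_2_eq_2)
  show ?thesis
    unfolding family_values_def Let_def rhs structure_apply(2,3)[OF assms uq_gens_closed(1)]
      structure_apply(2,3)[OF assms uq_gens_closed(3)] structure_apply(2,3)[OF assms uq_gens_closed(4)]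
      from_coords_eq_iff ..
qed

definition rescale :: "complex \<Rightarrow> qpoly \<Rightarrow> qpoly" where
  "rescale s = qext (\<lambda>(m, n). single (m, n) (s ^ n))"

lemma rescale_single [simp]: "rescale s (single (m, n) a) = single (m, n) (a * s ^ n)"
  by (simp add: rescale_def)

lemma linear_rescale [simp]: "linear_op (rescale s)"
  by (simp add: rescale_def linear_qext)

lemma rescale_inverse:
  assumes "s \<noteq> 0"
  shows "rescale (1 / s) (rescale s p) = p"
proof -
  have "(\<lambda>p. rescale (1 / s) (rescale s p)) = (\<lambda>p. p)"
    by (rule linear_op_eqI) (use assms in \<open>simp_all add: linear_op_intros linear_op_id power_one_over\<close>)
  then show ?thesis by meson
qed

lemma rescale_mult: "rescale s (qmul q p r) = qmul q (rescale s p) (rescale s r)"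
proof -
  have "rescale s (qmul q p r) = qmul q (rescale s p) (rescale s r) + qmul q 0 0"
    by (rule product_rule_from_monomials[where C = "\<lambda>_. 0" and D = "\<lambda>_. 0"])
      (simp_all add: linear_op_zero power_add)
  then show ?thesis by simp
qed

text \<open>
  \<open>E\<close> lowers the degree in \<open>y\<close> by one and \<open>F\<close> raises it by one. So both the factor \<open>b1\<close> of \<open>E\<close> and the
  factor \<open>1 / b1\<close> of \<open>F\<close> are adjusted by the same substitution for \<open>y\<close>.
\<close>

lemma rescale_intertwines:
  assumes "b1 \<noteq> 0" "b2 \<noteq> 0"
  shows "rescale (b1 / b2) (plane_K q p) = plane_K q (rescale (b1 / b2) p)"
    and "rescale (b1 / b2) (plane_K' q p) = plane_K' q (rescale (b1 / b2) p)"
    and "rescale (b1 / b2) (family_E q b1 p) = family_E q b2 (rescale (b1 / b2) p)"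
    and "rescale (b1 / b2) (family_F q b1 p) = family_F q b2 (rescale (b1 / b2) p)"
proof -
  let ?R = "rescale (b1 / b2)"
  note R_lin = linear_opD[OF linear_rescale]
  have eq: "S p = S' p" if "\<And>p r. S (p + r) = S p + S r" "\<And>p r. S' (p + r) = S' p + S' r"
    "\<And>c p. S (c *\<^sub>p p) = c *\<^sub>p S p" "\<And>c p. S' (c *\<^sub>p p) = c *\<^sub>p S' p"
    "\<And>m n. S (mon m n) = S' (mon m n)" for S S' :: "qpoly \<Rightarrow> qpoly"
    using linear_op_eqI[of S S'] that by (simp add: linear_op_def)
  show "?R (plane_K q p) = plane_K q (?R p)"
    by (rule eq[of "\<lambda>p. ?R (plane_K q p)"]) (simp_all add: plane_ops_linear R_lin mult.commute)
  show "?R (plane_K' q p) = plane_K' q (?R p)"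
    by (rule eq[of "\<lambda>p. ?R (plane_K' q p)"]) (simp_all add: plane_ops_linear R_lin mult.commute)
  show "?R (family_E q b1 p) = family_E q b2 (?R p)"
  proof (rule eq[of "\<lambda>p. ?R (family_E q b1 p)"])
    show "?R (family_E q b1 (mon m n)) = family_E q b2 (?R (mon m n))" for m n
      using assms by (cases n) (simp_all add: family_E_def R_lin mult_ac)
  qed (simp_all add: family_E_def plane_ops_linear R_lin pscale_add_right mult_ac)
  show "?R (family_F q b1 p) = family_F q b2 (?R p)"
  proof (rule eq[of "\<lambda>p. ?R (family_F q b1 p)"])
    show "?R (family_F q b1 (mon m n)) = family_F q b2 (?R (mon m n))" for m n
      using assms by (simp add: family_F_def inverse_eq_divide mult_ac)
  qed (simp_all add: family_F_def plane_ops_linear R_lin pscale_add_right mult_ac)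
qed

context quantum_parameter
begin

lemma family_ops_values:
  assumes "b \<noteq> 0"
  shows "family_E q b (mon 1 0) = 0" "family_E q b (mon 0 1) = single (0, 0) b"
    "family_F q b (mon 1 0) = single (1, 1) (inverse b)"
    "family_F q b (mon 0 1) = single (0, 2) (- q * inverse b)"
proof -
  have nz: "1 - 1 / q ^ 2 \<noteq> 0" "q - inverse q \<noteq> 0"
    using not_root[rule_format, of 2] q0 by (auto simp: field_simps power2_eq_square)
  have "(1 - q ^ 2) = - q * (q - inverse q)"
    using q0 by (simp add: field_simps power2_eq_square)
  then have "inverse b / (q - inverse q) * (1 - q ^ 2) = - q * inverse b"
    using nz by simp
  then show "family_F q b (mon 0 1) = single (0, 2) (- q * inverse b)"
    by (simp add: family_F_def numeral_2_eq_2)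
  show "family_E q b (mon 1 0) = 0" "family_E q b (mon 0 1) = single (0, 0) b"
    using nz(1) by (simp_all add: family_E_def)
  show "family_F q b (mon 1 0) = single (1, 1) (inverse b)"
    using nz(2) by (simp add: family_F_def inverse_eq_divide)
qed

text \<open>
  The values on \<open>x\<close> and \<open>y\<close> determine the operators: the constant term \<open>b\<close> of \<open>E y\<close> is nonzero, so the
  classification applies, and it identifies the parameter as \<open>b\<close>.
\<close>

lemma family_structure_iff:
  assumes \<pi>: "\<pi> \<in> qplane_structures q" and b: "b \<noteq> 0"
  shows "family_values q b \<pi> \<longleftrightarrow>
    coord_op q (\<pi> (uk q)) = plane_K q \<and> coord_op q (\<pi> (ukinv q)) = plane_K' q \<and>
    coord_op q (\<pi> (ue q)) = family_E q b \<and> coord_op q (\<pi> (uf q)) = family_F q b"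
proof
  note ops = uq_operators_of_structure[OF q0 \<pi>]
  assume "family_values q b \<pi>"
  then have E: "coord_op q (\<pi> (ue q)) (mon 0 1) = single (0, 0) b"
    by (simp add: family_values_iff_coords[OF q0 \<pi>])
  then have e: "lookup (coord_op q (\<pi> (ue q)) (mon 0 1)) (0, 0) \<noteq> 0"
    using b by simp
  obtain c where c: "c \<noteq> 0" "coord_op q (\<pi> (uk q)) = plane_K q" "coord_op q (\<pi> (ue q)) = family_E q c"
    "coord_op q (\<pi> (uf q)) = family_F q c"
    by (rule operators_classified[OF ops e]) (auto simp: family_E_def family_F_def fun_eq_iff)
  have "single (0::nat, 0::nat) c = single (0, 0) b"
    using E[unfolded c(3)] family_ops_values(2)[OF c(1)] by simp
  then have "c = b"
    by (metis lookup_single_eq)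
  with c K_determined(2)[OF ops e] show "coord_op q (\<pi> (uk q)) = plane_K q \<and> coord_op q (\<pi> (ukinv q)) = plane_K' q \<and>
    coord_op q (\<pi> (ue q)) = family_E q b \<and> coord_op q (\<pi> (uf q)) = family_F q b"
    by simp
next
  assume "coord_op q (\<pi> (uk q)) = plane_K q \<and> coord_op q (\<pi> (ukinv q)) = plane_K' q \<and>
    coord_op q (\<pi> (ue q)) = family_E q b \<and> coord_op q (\<pi> (uf q)) = family_F q b"
  then show "family_values q b \<pi>"
    unfolding family_values_iff_coords[OF q0 \<pi>] using family_ops_values[OF b] by simp
qed

lemma family_structure_exists_unique:
  assumes b: "b \<noteq> 0"
  shows "\<exists>!\<pi>. \<pi> \<in> qplane_structures q \<and> family_values q b \<pi>"
proof (rule ex_ex1I)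
  have "q ^ 2 \<noteq> 1"
    using not_root by simp
  then have "uq_operators q (plane_K q) (plane_K' q) (family_E q b) (family_F q b)"
    using uq_operators_family[OF q0 b] by (simp add: family_E_def[abs_def] family_F_def[abs_def])
  then obtain \<pi> where \<pi>: "\<pi> \<in> qplane_structures q" "coord_op q (\<pi> (uk q)) = plane_K q"
    "coord_op q (\<pi> (ue q)) = family_E q b" "coord_op q (\<pi> (uf q)) = family_F q b"
    by (rule structure_of_uq_operators[OF q0])
  then have "family_values q b \<pi>"
    unfolding family_values_iff_coords[OF q0 \<pi>(1)] using family_ops_values[OF b] by simp
  with \<pi>(1) show "\<exists>\<pi>. \<pi> \<in> qplane_structures q \<and> family_values q b \<pi>"
    by blast
next
  fix \<pi> \<rho>
  assume "\<pi> \<in> qplane_structures q \<and> family_values q b \<pi>" "\<rho> \<in> qplane_structures q \<and> family_values q b \<rho>"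
  then show "\<pi> = \<rho>"
    using b family_structure_iff[of \<pi> b] family_structure_iff[of \<rho> b]
    by (intro structure_determined_by_operators[OF q0]) simp_all
qed

text \<open>
  A nonzero constant term of the image of \<open>y\<close> under \<open>ue q\<close> makes the classification of the operators
  applicable. Conversely, the values in the family are multiples of monomials of degree 0 and 2.
\<close>

lemma selected_structures_eq:
  "selected_structures q = {\<pi> \<in> qplane_structures q. \<exists>b. b \<noteq> 0 \<and> family_values q b \<pi>}"
proof (intro equalityI subsetI)
  fix \<pi>
  assume "\<pi> \<in> selected_structures q"
  then have \<pi>: "\<pi> \<in> qplane_structures q" and e: "qproj q 0 (\<pi> (ue q) (qy q)) \<noteq> \<zero>\<^bsub>qplane q\<^esub>"
    by (simp_all add: selected_structures_def)
  have "lookup (coord_op q (\<pi> (ue q)) (mon 0 1)) (0, 0) \<noteq> 0"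
    using e unfolding structure_apply(3)[OF q0 \<pi> uq_gens_closed(3)] by (subst (asm) qproj_eq_zero_iff) auto
  then obtain b where "b \<noteq> 0" "coord_op q (\<pi> (uk q)) = plane_K q" "coord_op q (\<pi> (ue q)) = family_E q b"
    "coord_op q (\<pi> (uf q)) = family_F q b"
    by (rule operators_classified[OF uq_operators_of_structure[OF q0 \<pi>]])
      (auto simp: family_E_def family_F_def fun_eq_iff)
  then have "b \<noteq> 0" "family_values q b \<pi>"
    unfolding family_values_iff_coords[OF q0 \<pi>] using family_ops_values[of b] by simp_all
  then show "\<pi> \<in> {\<pi> \<in> qplane_structures q. \<exists>b. b \<noteq> 0 \<and> family_values q b \<pi>}"
    using \<pi> by blast
next
  fix \<pi>
  assume "\<pi> \<in> {\<pi> \<in> qplane_structures q. \<exists>b. b \<noteq> 0 \<and> family_values q b \<pi>}"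
  then obtain b where \<pi>: "\<pi> \<in> qplane_structures q" and b: "b \<noteq> 0" "family_values q b \<pi>"
    by blast
  note v = b(2)[unfolded family_values_iff_coords[OF q0 \<pi>]]
  have v: "\<pi> (ue q) (qx q) = from_coords q 0" "\<pi> (ue q) (qy q) = from_coords q (single (0, 0) b)"
    "\<pi> (uf q) (qx q) = from_coords q (single (1, 1) (inverse b))"
    "\<pi> (uf q) (qy q) = from_coords q (single (0, 2) (- q * inverse b))"
    unfolding structure_apply(2,3)[OF q0 \<pi> uq_gens_closed(3)] structure_apply(2,3)[OF q0 \<pi> uq_gens_closed(4)]
    using v by simp_all
  show "\<pi> \<in> selected_structures q"
    unfolding selected_structures_def v mem_Collect_eq qproj_eq_zero_iff[OF from_coords_closed] coords_from_coords
    using \<pi> b(1) by (auto simp: lookup_single when_def)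
qed

text \<open>
  The elements of the quantum group whose actions are intertwined by the rescaling of \<open>y\<close> form a
  linear subspace that contains 1 and is stable under right multiplication by the generators.
\<close>

lemma family_structures_isomorphic:
  assumes \<pi>: "\<pi> \<in> qplane_structures q" "family_values q b1 \<pi>" and \<rho>: "\<rho> \<in> qplane_structures q" "family_values q b2 \<rho>"
    and b: "b1 \<noteq> 0" "b2 \<noteq> 0"
  shows "isomorphic_structures (Uq_sl2 q) (qplane q) \<pi> \<rho>"
proof -
  let ?A = "qplane q"
  interpret P: uq_action q ?A \<pi> by (rule structure_action[OF q0 \<pi>(1)])
  interpret R: uq_action q ?A \<rho> by (rule structure_action[OF q0 \<rho>(1)])
  note \<pi>_ops = family_structure_iff[OF \<pi>(1) b(1), THEN iffD1, OF \<pi>(2)]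
  note \<rho>_ops = family_structure_iff[OF \<rho>(1) b(2), THEN iffD1, OF \<rho>(2)]
  define s where "s = b1 / b2"
  have s: "s \<noteq> 0"
    using b by (simp add: s_def)
  define \<Psi> where "\<Psi> = lift_op q (rescale s)"
  have \<Psi>: "\<Psi> a = from_coords q (rescale s (coords q a))" if "a \<in> carrier ?A" for a
    using that by (simp add: \<Psi>_def lift_op_def)
  have \<Psi>_closed: "\<Psi> a \<in> carrier ?A" if "a \<in> carrier ?A" for a
    using that by (simp add: \<Psi>)
  have hom: "\<Psi> \<in> alg_hom ?A ?A"
  proof (rule alg_homI)
    show "\<Psi> \<in> extensional (carrier ?A)"
      by (simp add: \<Psi>_def lift_op_def)
  qed (simp_all add: \<Psi> coords_simps from_coords_simps rescale_mult linear_opD[OF linear_rescale])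
  have bij: "bij_betw \<Psi> (carrier ?A) (carrier ?A)"
  proof (rule bij_betw_byWitness[where f' = "lift_op q (rescale (1 / s))"])
    show "\<forall>a\<in>carrier ?A. lift_op q (rescale (1 / s)) (\<Psi> a) = a"
      using rescale_inverse[OF s] by (simp add: \<Psi> lift_op_def)
    show "\<forall>a\<in>carrier ?A. \<Psi> (lift_op q (rescale (1 / s)) a) = a"
      using rescale_inverse[of "1 / s"] s by (simp add: \<Psi> lift_op_def)
  qed (auto simp: \<Psi> lift_op_def)
  have gens: "\<Psi> (\<pi> h a) = \<rho> h (\<Psi> a)"
    if "h \<in> carrier (uq_alg q)" "a \<in> carrier ?A"
      and "\<And>p. rescale s (coord_op q (\<pi> h) p) = coord_op q (\<rho> h) (rescale s p)" for h a
    using that structure_apply(1)[OF q0 \<pi>(1), of h a] structure_apply(1)[OF q0 \<rho>(1), of h "\<Psi> a"]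
    by (simp add: \<Psi>)
  note int = rescale_intertwines[OF b, folded s_def]
  have main: "\<forall>a\<in>carrier ?A. \<Psi> (\<pi> h a) = \<rho> h (\<Psi> a)" if "h \<in> carrier (uq_alg q)" for h
    using that
  proof (induction h rule: uq_induct)
    case one
    then show ?case
      by (simp add: P.act_one R.act_one \<Psi>_closed)
  next
    case (add X Y)
    then show ?case
      by (simp add: P.act_add R.act_add \<Psi>_closed P.lin_endD alg_hom_memD(4)[OF hom])
  next
    case (scale X c)
    then show ?case
      by (simp add: P.act_smult R.act_smult \<Psi>_closed P.lin_endD alg_hom_memD(6)[OF hom])
  qed (use \<pi>_ops \<rho>_ops in \<open>simp_all add: P.act_mult R.act_mult \<Psi>_closed P.lin_endD gens int\<close>)
  show ?thesis
    unfolding isomorphic_structures_def Uq_sl2_simps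
  proof (intro bexI[OF _ hom] conjI bij ballI)
    fix h a
    assume h: "h \<in> carrier (uq_alg q)" and a: "a \<in> carrier ?A"
    then have "a \<in> \<Psi> ` carrier ?A"
      using bij by (simp add: bij_betw_def)
    then show "\<Psi> (\<pi> h (inv_into (carrier ?A) \<Psi> a)) = \<rho> h a"
      using main[OF h] by (simp add: inv_into_into f_inv_into_f)
  qed
qed

end

theorem theorem10:
  fixes q :: complex
  assumes "q \<noteq> 0"
    and "\<forall>n::nat. n > 0 \<longrightarrow> q ^ n \<noteq> 1"
  shows "(\<forall>b0. b0 \<noteq> 0 \<longrightarrow> (\<exists>!\<pi>. \<pi> \<in> qplane_structures q \<and> family_values q b0 \<pi>)) \<and>
    selected_structures q = {\<pi> \<in> qplane_structures q. \<exists>b0. b0 \<noteq> 0 \<and> family_values q b0 \<pi>} \<and>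
    (\<forall>\<pi>1 \<in> selected_structures q. \<forall>\<pi>2 \<in> selected_structures q.
       isomorphic_structures (Uq_sl2 q) (qplane q) \<pi>1 \<pi>2) \<and>
    (\<forall>\<pi> \<in> selected_structures q. \<forall>\<pi>1 \<in> qplane_structures q.
       family_values q 1 \<pi>1 \<longrightarrow> isomorphic_structures (Uq_sl2 q) (qplane q) \<pi> \<pi>1)"
proof -
  interpret quantum_parameter q
    using assms by unfold_locales auto
  show ?thesis
    unfolding selected_structures_eq
    using family_structure_exists_unique family_structures_isomorphic[where ?b2.0 = 1]
    by (auto intro: family_structures_isomorphic)
qed

end
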